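(* (Linear filtering equation for photodetection.) In the repeated interaction model of the context with photodetection observations $\Delta Y(l)=U(l)^*\Delta\Lambda(l)U(l)$, assume $\sin\lambda\neq0$ and $\cos\lambda\ne 0$, and define for $X\in\mathscr{M}$ the unnormalized conditional expectation $$\sigma_l(X)=U(l)^*R(l)^*\,\mathbb{P}(V(l)^*XV(l)|\mathscr{R}_l)\,R(l)U(l),\qquad 0\le l\le k .$$ Then for all $X\in\mathscr{M}$ and $1\le l\le k$, $$\Delta\sigma_l(X)=\sigma_{l-1}(\mathcal{L}(X))\,\Delta t(l)+\sigma_{l-1}(\mathcal{T}(X))\left(\Delta Y(l)-\frac{\sin^2\lambda}{\lambda^2}\,\Delta t(l)\right),\qquad \sigma_0(X)=\rho(X),$$ where $\mathcal{L}(X)=M^{+*}XM^++\lambda^2M^{\circ*}XM^\circ+M^{\circ*}X+XM^\circ$ and $$\mathcal{T}(X)=\frac{1}{\cos^2\lambda}\left(\frac{\lambda^2}{\sin^2\lambda}M^{+*}XM^+-X-\lambda^2\mathcal{L}(X)\right).$$ Furthermore, the noncommutative Kallianpur-Striebel formula holds: for all $X\in\mathscr{M}$ and $0\le l\le k$, with probability one, $$\pi_l(X)=\frac{\sigma_l(X)}{\sigma_l(I)},\qquad\text{where }\pi_l(X)=\mathbb{P}(j_l(X)|\mathscr{Y}_l).$$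
   Context: Let $\mathscr{M}=M_2(\mathbb{C})$, $\sigma_-=\begin{pmatrix}0&0\\1&0\end{pmatrix}$, $\sigma_+=\sigma_-^*$, $\Phi=(0,1)^T$, $\phi(X)=\langle\Phi,X\Phi\rangle$. Fix $k\in\mathbb{N}$, $T>0$, $\lambda=\sqrt{T/k}$, a state $\rho$ on $\mathscr{M}$, $\mathscr{W}_k=\mathscr{M}^{\otimes k}$, and the state $\mathbb{P}=\rho\otimes\phi^{\otimes k}$ on $\mathscr{M}\otimes\mathscr{W}_k$. Identify $X\in\mathscr{M}$ with $X\otimes I$. For $X\in\mathscr{M}$, $X_i$ denotes $X$ placed in the $i$-th factor of $\mathscr{W}_k$. Set $\Delta A(i)=\lambda(\sigma_-)_i$, $\Delta A^*(i)=\lambda(\sigma_+)_i$, $\Delta\Lambda(i)=(\sigma_+\sigma_-)_i$, $\Delta t(i)=\lambda^2I$, and $A(l)=\sum_{i\le l}\Delta A(i)$, $A^*(l)=\sum_{i\le l}\Delta A^*(i)$. Repeated interaction: given $L_1,L_2,L_3\in\mathscr{M}$ with $L_1,L_3$ self-adjoint, let $M_l=\exp(-i\{L_1\Delta\Lambda(l)+L_2\Delta A^*(l)+L_2^*\Delta A(l)+L_3\Delta t(l)\})$, and let $M^{\pm},M^+,M^-,M^\circ\in\mathscr{M}$ be the unique matrices (independent of $l$) with $M_l-I=M^\pm\Delta\Lambda(l)+M^+\Delta A^*(l)+M^-\Delta A(l)+M^\circ\Delta t(l)$. Put $U(0)=I$, $U(l)=M_l\cdots M_1$, $j_l(X)=U(l)^*XU(l)$.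 $\mathscr{C}_l$ is the commutative $^*$-algebra generated by $I$ and $\Delta\Lambda(1),\ldots,\Delta\Lambda(l)$; $\mathscr{Y}_l$ is the (commutative) $^*$-algebra generated by $I,\Delta Y(1),\ldots,\Delta Y(l)$, and $\mathscr{Y}_l=U(l)^*\mathscr{C}_lU(l)$. Let $R(l)=\exp(A(l)-A^*(l))$ (unitary, acting only on the field factors; $R(0)=I$), $\mathscr{R}_l=R(l)\mathscr{C}_lR(l)^*$ and $\Delta\overline{Z}(l)=R(l)\,\Delta\Lambda(l)\,R(l)^*$. $V(l)$ is defined by $V(0)=I$ and $$V(l)-V(l-1)=\Bigl\{\Bigl(\tfrac{\lambda}{\sin\lambda}M^+-\tfrac{\lambda^2}{\cos\lambda}M^\circ-\tfrac{1}{\cos\lambda}\Bigr)\Bigl(\Delta\overline{Z}(l)-\tfrac{\sin^2\lambda}{\lambda^2}\Delta t(l)\Bigr)+\Bigl(\tfrac{\sin\lambda}{\lambda}M^++\cos\lambda\,M^\circ+\tfrac{\cos\lambda-1}{\lambda^2}\Bigr)\Delta t(l)\Bigr\}V(l-1);$$ it commutes with every element of $\mathscr{R}_l$. Conditional expectation: for a commutative $^*$-subalgebra $\mathscr{C}$ with commutant $\mathscr{C}'$ and $B\in\mathscr{C}'$, a version of $\mathbb{P}(B|\mathscr{C})$ is any element of $\mathscr{C}$ with $\mathbb{P}(\mathbb{P}(B|\mathscr{C})C)=\mathbb{P}(BC)$ for all $C\in\mathscr{C}$. Equality "with probability one" of $P,Q\in\mathscr{C}$ means $\mathbb{P}((P-Q)^*(P-Q))=0$.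 Elements of a commutative algebra are identified with complex functions on a finite probability space, so quotients make sense pointwise (where defined). *)

theory Defs
  imports
    "Jordan_Normal_Form.Schur_Decomposition"
    "HOL-Library.FuncSet"
    "HOL-Library.Nonpos_Ints"
begin

section \<open>Matrices, tensor products and states\<close>

text \<open>
  The algebra \<open>M\<^sub>n(\<complex>)\<close> is \<^term>\<open>carrier_mat n n :: complex mat set\<close>; the adjoint is
  \<^const>\<open>mat_adjoint\<close>.  Tensor products are Kronecker products, the left factor carrying
  the most significant digits of the index.
\<close>

definition kron :: "complex mat \<Rightarrow> complex mat \<Rightarrow> complex mat" (infixr \<open>\<otimes>\<^sub>K\<close> 72) where
  "A \<otimes>\<^sub>K B = mat (dim_row A * dim_row B) (dim_col A * dim_col B)
     (\<lambda>(i, j). A $$ (i div dim_row B, j div dim_col B) * B $$ (i mod dim_row B, j mod dim_col B))"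

definition mat_exp :: "complex mat \<Rightarrow> complex mat" where
  "mat_exp A = mat (dim_row A) (dim_row A) (\<lambda>(i, j). \<Sum>m. (A ^\<^sub>m m) $$ (i, j) / fact m)"

primrec mat_sum :: "nat \<Rightarrow> (nat \<Rightarrow> complex mat) \<Rightarrow> nat \<Rightarrow> complex mat" where
  "mat_sum n f 0 = 0\<^sub>m n n"
| "mat_sum n f (Suc l) = mat_sum n f l + f (Suc l)"

definition is_state :: "nat \<Rightarrow> (complex mat \<Rightarrow> complex) \<Rightarrow> bool" where
  "is_state n \<rho> \<longleftrightarrow>
     (\<forall>A \<in> carrier_mat n n. \<forall>B \<in> carrier_mat n n. \<rho> (A + B) = \<rho> A + \<rho> B) \<and>
     (\<forall>A \<in> carrier_mat n n. \<forall>c. \<rho> (c \<cdot>\<^sub>m A) = c * \<rho> A) \<and>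
     (\<forall>A \<in> carrier_mat n n. \<rho> (mat_adjoint A * A) \<in> \<real>\<^sub>\<ge>\<^sub>0) \<and>
     \<rho> (1\<^sub>m n) = 1"

text \<open>
  The tensor product of linear functionals \<open>f\<close> on \<open>M\<^sub>n(\<complex>)\<close> and \<open>g\<close> on \<open>M\<^sub>m(\<complex>)\<close>, as
  \<open>f \<circ> (id \<otimes> g)\<close>: the functional \<open>g\<close> is applied to each \<open>m \<times> m\<close> block.  It is the
  linear functional on \<open>M\<^sub>n\<^sub>m(\<complex>)\<close> with value \<open>f A * g B\<close> at \<open>A \<otimes>\<^sub>K B\<close>.
\<close>

definition tensor_functional ::
  "nat \<Rightarrow> nat \<Rightarrow> (complex mat \<Rightarrow> complex) \<Rightarrow> (complex mat \<Rightarrow> complex) \<Rightarrow> complex mat \<Rightarrow> complex" where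
  "tensor_functional n m f g B =
     f (mat n n (\<lambda>(a, b). g (mat m m (\<lambda>(i, j). B $$ (a * m + i, b * m + j)))))"

section \<open>Commutative \<open>*\<close>-algebras and conditional expectations\<close>

inductive_set star_algebra :: "nat \<Rightarrow> complex mat set \<Rightarrow> complex mat set"
  for n :: nat and S :: "complex mat set" where
  one: "1\<^sub>m n \<in> star_algebra n S"
| gen: "A \<in> S \<Longrightarrow> A \<in> star_algebra n S"
| add: "A \<in> star_algebra n S \<Longrightarrow> B \<in> star_algebra n S \<Longrightarrow> A + B \<in> star_algebra n S"
| scale: "A \<in> star_algebra n S \<Longrightarrow> c \<cdot>\<^sub>m A \<in> star_algebra n S"
| mult: "A \<in> star_algebra n S \<Longrightarrow> B \<in> star_algebra n S \<Longrightarrow> A * B \<in> star_algebra n S"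
| adjoint: "A \<in> star_algebra n S \<Longrightarrow> mat_adjoint A \<in> star_algebra n S"

definition commutant :: "nat \<Rightarrow> complex mat set \<Rightarrow> complex mat set" where
  "commutant n \<C> = {B \<in> carrier_mat n n. \<forall>C \<in> \<C>. B * C = C * B}"

text \<open>\<open>E\<close> is a version of the conditional expectation of \<open>B\<close> given \<open>\<C>\<close> in the state \<open>P\<close>.\<close>

definition is_cond_exp ::
  "nat \<Rightarrow> (complex mat \<Rightarrow> complex) \<Rightarrow> complex mat set \<Rightarrow> complex mat \<Rightarrow> complex mat \<Rightarrow> bool" where
  "is_cond_exp n P \<C> B E \<longleftrightarrow>
     B \<in> commutant n \<C> \<and> E \<in> \<C> \<and> (\<forall>C \<in> \<C>. P (E * C) = P (B * C))"

definition equal_wp1 :: "(complex mat \<Rightarrow> complex) \<Rightarrow> complex mat \<Rightarrow> complex mat \<Rightarrow> bool" where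
  "equal_wp1 P A B \<longleftrightarrow> P (mat_adjoint (A - B) * (A - B)) = 0"

text \<open>
  \<open>\<iota>\<close> is a \<open>*\<close>-isomorphism of \<open>\<C>\<close> onto the algebra of all complex functions on the finite
  set \<open>\<Omega>\<close>.
\<close>

definition function_rep ::
  "complex mat set \<Rightarrow> nat set \<Rightarrow> (complex mat \<Rightarrow> nat \<Rightarrow> complex) \<Rightarrow> bool" where
  "function_rep \<C> \<Omega> \<iota> \<longleftrightarrow>
     finite \<Omega> \<and> bij_betw \<iota> \<C> (\<Omega> \<rightarrow>\<^sub>E UNIV) \<and>
     (\<forall>A \<in> \<C>. \<forall>B \<in> \<C>. \<forall>\<omega> \<in> \<Omega>. \<iota> (A + B) \<omega> = \<iota> A \<omega> + \<iota> B \<omega>) \<and>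
     (\<forall>A \<in> \<C>. \<forall>c. \<forall>\<omega> \<in> \<Omega>. \<iota> (c \<cdot>\<^sub>m A) \<omega> = c * \<iota> A \<omega>) \<and>
     (\<forall>A \<in> \<C>. \<forall>B \<in> \<C>. \<forall>\<omega> \<in> \<Omega>. \<iota> (A * B) \<omega> = \<iota> A \<omega> * \<iota> B \<omega>) \<and>
     (\<forall>A \<in> \<C>. \<forall>\<omega> \<in> \<Omega>. \<iota> (mat_adjoint A) \<omega> = cnj (\<iota> A \<omega>))"

text \<open>
  \<open>D\<close> is a version of the pointwise quotient \<open>A / B\<close> in \<open>\<C>\<close>.  Its values are left arbitrary at
  the points where \<open>B\<close> vanishes, so a statement that every version equals a given element with
  probability one can only hold if \<open>B\<close> is nonzero with probability one.
\<close>

definition is_quotient ::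
  "complex mat set \<Rightarrow> complex mat \<Rightarrow> complex mat \<Rightarrow> complex mat \<Rightarrow> bool" where
  "is_quotient \<C> A B D \<longleftrightarrow> A \<in> \<C> \<and> B \<in> \<C> \<and> D \<in> \<C> \<and>
     (\<exists>\<Omega> \<iota>. function_rep \<C> \<Omega> \<iota> \<and> (\<forall>\<omega> \<in> \<Omega>. \<iota> B \<omega> \<noteq> 0 \<longrightarrow> \<iota> D \<omega> = \<iota> A \<omega> / \<iota> B \<omega>))"

section \<open>The repeated interaction model\<close>

definition sigma_minus :: "complex mat" where
  "sigma_minus = mat_of_rows_list 2 [[0, 0], [1, 0]]"

definition sigma_plus :: "complex mat" where
  "sigma_plus = mat_adjoint sigma_minus"

definition Phi :: "complex vec" where
  "Phi = vec_of_list [0, 1]"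

definition vacuum :: "complex mat \<Rightarrow> complex" where
  "vacuum X = (X *\<^sub>v Phi) \<bullet>c Phi"

primrec vacuum_power :: "nat \<Rightarrow> complex mat \<Rightarrow> complex" where
  "vacuum_power 0 W = W $$ (0, 0)"
| "vacuum_power (Suc k) W = tensor_functional 2 (2 ^ k) vacuum (vacuum_power k) W"

text \<open>
  The algebra \<open>\<M> \<otimes> \<W>\<^sub>k = M\<^sub>2(\<complex>) \<otimes> M\<^sub>2(\<complex>)\<^sup>\<otimes>\<^sup>k\<close> consists of the matrices of dimension
  \<^term>\<open>tdim k\<close>.
\<close>

definition tdim :: "nat \<Rightarrow> nat" where
  "tdim k = 2 * 2 ^ k"

definition joint_state :: "nat \<Rightarrow> (complex mat \<Rightarrow> complex) \<Rightarrow> complex mat \<Rightarrow> complex" where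
  "joint_state k \<rho> = tensor_functional 2 (2 ^ k) \<rho> (vacuum_power k)"

definition sys :: "nat \<Rightarrow> complex mat \<Rightarrow> complex mat" where
  "sys k X = X \<otimes>\<^sub>K 1\<^sub>m (2 ^ k)"

text \<open>
  \<open>X\<^sub>i\<close> for \<open>1 \<le> i \<le> k\<close>.  To the left of the \<open>i\<close>-th field factor stand the system factor and
  \<open>i - 1\<close> field factors, which together have dimension \<open>2\<^sup>i\<close>.
\<close>

definition fld :: "nat \<Rightarrow> nat \<Rightarrow> complex mat \<Rightarrow> complex mat" where
  "fld k i X = 1\<^sub>m (2 ^ i) \<otimes>\<^sub>K X \<otimes>\<^sub>K 1\<^sub>m (2 ^ (k - i))"

text \<open>In the following, \<open>h\<close> stands for the parameter \<open>\<lambda>\<close>.\<close>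

definition dA :: "nat \<Rightarrow> real \<Rightarrow> nat \<Rightarrow> complex mat" where
  "dA k h i = complex_of_real h \<cdot>\<^sub>m fld k i sigma_minus"

definition dAs :: "nat \<Rightarrow> real \<Rightarrow> nat \<Rightarrow> complex mat" where
  "dAs k h i = complex_of_real h \<cdot>\<^sub>m fld k i sigma_plus"

definition dLam :: "nat \<Rightarrow> nat \<Rightarrow> complex mat" where
  "dLam k i = fld k i (sigma_plus * sigma_minus)"

text \<open>\<open>\<Delta>t(i)\<close> does not depend on \<open>i\<close>.\<close>

definition dt :: "nat \<Rightarrow> real \<Rightarrow> complex mat" where
  "dt k h = complex_of_real (h\<^sup>2) \<cdot>\<^sub>m 1\<^sub>m (tdim k)"

definition M_step ::
  "nat \<Rightarrow> real \<Rightarrow> complex mat \<Rightarrow> complex mat \<Rightarrow> complex mat \<Rightarrow> nat \<Rightarrow> complex mat" where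
  "M_step k h L1 L2 L3 l = mat_exp ((- \<i>) \<cdot>\<^sub>m
     (sys k L1 * dLam k l + sys k L2 * dAs k h l + sys k (mat_adjoint L2) * dA k h l
      + sys k L3 * dt k h))"

primrec U ::
  "nat \<Rightarrow> real \<Rightarrow> complex mat \<Rightarrow> complex mat \<Rightarrow> complex mat \<Rightarrow> nat \<Rightarrow> complex mat" where
  "U k h L1 L2 L3 0 = 1\<^sub>m (tdim k)"
| "U k h L1 L2 L3 (Suc l) = M_step k h L1 L2 L3 (Suc l) * U k h L1 L2 L3 l"

text \<open>\<open>j\<^sub>l(X)\<close>; \<open>u\<close> stands for the unitary \<open>U(l)\<close>.\<close>

definition flow :: "nat \<Rightarrow> complex mat \<Rightarrow> complex mat \<Rightarrow> complex mat" where
  "flow k u X = mat_adjoint u * sys k X * u"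

definition dY ::
  "nat \<Rightarrow> real \<Rightarrow> complex mat \<Rightarrow> complex mat \<Rightarrow> complex mat \<Rightarrow> nat \<Rightarrow> complex mat" where
  "dY k h L1 L2 L3 l =
     mat_adjoint (U k h L1 L2 L3 l) * dLam k l * U k h L1 L2 L3 l"

definition C_alg :: "nat \<Rightarrow> nat \<Rightarrow> complex mat set" where
  "C_alg k l = star_algebra (tdim k) (dLam k ` {1..l})"

definition Y_alg ::
  "nat \<Rightarrow> real \<Rightarrow> complex mat \<Rightarrow> complex mat \<Rightarrow> complex mat \<Rightarrow> nat \<Rightarrow> complex mat set" where
  "Y_alg k h L1 L2 L3 l = star_algebra (tdim k) (dY k h L1 L2 L3 ` {1..l})"

definition R :: "nat \<Rightarrow> real \<Rightarrow> nat \<Rightarrow> complex mat" where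
  "R k h l = mat_exp (mat_sum (tdim k) (dA k h) l - mat_sum (tdim k) (dAs k h) l)"

definition R_alg :: "nat \<Rightarrow> real \<Rightarrow> nat \<Rightarrow> complex mat set" where
  "R_alg k h l = (\<lambda>C. R k h l * C * mat_adjoint (R k h l)) ` C_alg k l"

definition dZ :: "nat \<Rightarrow> real \<Rightarrow> nat \<Rightarrow> complex mat" where
  "dZ k h l = R k h l * dLam k l * mat_adjoint (R k h l)"

text \<open>The arguments \<open>Mp\<close> and \<open>Mo\<close> stand for \<open>M\<^sup>+\<close> and \<open>M\<^sup>\<circ>\<close>.\<close>

primrec V :: "nat \<Rightarrow> real \<Rightarrow> complex mat \<Rightarrow> complex mat \<Rightarrow> nat \<Rightarrow> complex mat" where
  "V k h Mp Mo 0 = 1\<^sub>m (tdim k)"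
| "V k h Mp Mo (Suc l) = V k h Mp Mo l +
     (sys k (complex_of_real (h / sin h) \<cdot>\<^sub>m Mp - complex_of_real (h\<^sup>2 / cos h) \<cdot>\<^sub>m Mo
             - complex_of_real (1 / cos h) \<cdot>\<^sub>m 1\<^sub>m 2)
        * (dZ k h (Suc l) - complex_of_real ((sin h)\<^sup>2 / h\<^sup>2) \<cdot>\<^sub>m dt k h)
      + sys k (complex_of_real (sin h / h) \<cdot>\<^sub>m Mp + complex_of_real (cos h) \<cdot>\<^sub>m Mo
             + complex_of_real ((cos h - 1) / h\<^sup>2) \<cdot>\<^sub>m 1\<^sub>m 2)
        * dt k h) * V k h Mp Mo l"

text \<open>
  \<open>S\<close> is \<open>\<sigma>\<^sub>l(X)\<close>, computed from some version of \<open>\<P>(V(l)\<^sup>* X V(l) | \<R>\<^sub>l)\<close>.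
\<close>

definition is_unnormalized ::
  "nat \<Rightarrow> real \<Rightarrow> (complex mat \<Rightarrow> complex) \<Rightarrow> complex mat \<Rightarrow> complex mat \<Rightarrow> complex mat \<Rightarrow>
   complex mat \<Rightarrow> complex mat \<Rightarrow> nat \<Rightarrow> complex mat \<Rightarrow> complex mat \<Rightarrow> bool" where
  "is_unnormalized k h \<rho> L1 L2 L3 Mp Mo l X S \<longleftrightarrow>
     (\<exists>E. is_cond_exp (tdim k) (joint_state k \<rho>) (R_alg k h l)
            (mat_adjoint (V k h Mp Mo l) * sys k X * V k h Mp Mo l) E \<and>
          S = mat_adjoint (U k h L1 L2 L3 l) * mat_adjoint (R k h l) * E
                * R k h l * U k h L1 L2 L3 l)"

definition gen_L :: "real \<Rightarrow> complex mat \<Rightarrow> complex mat \<Rightarrow> complex mat \<Rightarrow> complex mat" where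
  "gen_L h Mp Mo X =
     mat_adjoint Mp * X * Mp + complex_of_real (h\<^sup>2) \<cdot>\<^sub>m (mat_adjoint Mo * X * Mo)
     + mat_adjoint Mo * X + X * Mo"

definition gen_T :: "real \<Rightarrow> complex mat \<Rightarrow> complex mat \<Rightarrow> complex mat \<Rightarrow> complex mat" where
  "gen_T h Mp Mo X = complex_of_real (1 / (cos h)\<^sup>2) \<cdot>\<^sub>m
     (complex_of_real (h\<^sup>2 / (sin h)\<^sup>2) \<cdot>\<^sub>m (mat_adjoint Mp * X * Mp) - X
      - complex_of_real (h\<^sup>2) \<cdot>\<^sub>m gen_L h Mp Mo X)"

end

theory Submission
  imports Defs
begin

text \<open>
  On the vacuum the operator \<open>V(l)\<close> agrees with \<open>R(l) U(l)\<close>, and \<open>V(l)\<close> has the form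
  \<open>(m\<^sub>1 \<Delta>Z(l) + m\<^sub>0 (1 - \<Delta>Z(l))) V(l-1)\<close> with \<open>m\<^sub>1 = (\<lambda> / sin \<lambda>) M\<^sup>+\<close> and
  \<open>m\<^sub>0 = (1 + \<lambda>\<^sup>2 M\<^sup>\<circ>) / cos \<lambda>\<close>. Since the vacuum gives the commuting projections \<open>\<Delta>Z(i)\<close> the
  law of independent coin flips with success probability \<open>sin\<^sup>2 \<lambda>\<close>, the conditional
  expectation of \<open>V(l)\<^sup>* X V(l)\<close> is computed outcome by outcome: a new outcome 1 replaces \<open>X\<close>
  by \<open>m\<^sub>1\<^sup>* X m\<^sub>1\<close> and a new outcome 0 replaces it by \<open>m\<^sub>0\<^sup>* X m\<^sub>0\<close>. The filtering equation
  merely rewrites these two values as \<open>X + \<lambda>\<^sup>2 \<L>(X) + \<T>(X) (x - sin\<^sup>2 \<lambda>)\<close> for \<open>x = 1, 0\<close>, and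
  the Kallianpur-Striebel formula is Bayes' rule for the density \<open>\<sigma>\<^sub>l(I)\<close>, whose zeros are
  zeros of all \<open>\<sigma>\<^sub>l(X)\<close> by the Cauchy-Schwarz inequality.
\<close>

section \<open>Square matrices and the matrix exponential\<close>

text \<open>\<open>P\<close> of \<open>flow k (UU l) X * EY l g\<close> is \<open>P\<close> of
  \<open>sys k X * EZ l g\<close> sandwiched between \<open>R k h l * UU l\<close> and its adjoint.
  To read off a conditional expectation, \<open>EZ l g\<close> must be moved past the sandwich, but
  \<open>R k h l * UU l\<close> need not commute with the \<open>dZ\<close>. The vacuum supplies the
  freedom to replace it: \<open>sigma_minus\<close> kills the vacuum, so a new field factor
  contributes only two directions, the vacuum and its excitation by \<open>sigma_plus\<close>. Since
  \<open>cos h * sin h\<close> is nonzero, \<open>dZ\<close> and its complement applied to the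
  vacuum span both. Matching the two coefficients of one interaction step is a linear system with
  solution \<open>m1\<close>, \<open>m0\<close>; \<open>Mpm\<close> and \<open>Mm\<close> multiply
  operators that annihilate the vacuum and drop out. Nonzero \<open>sin h\<close> and
  \<open>cos h\<close> also give every outcome sequence positive weight, so conditional expectations
  given \<open>R_alg\<close> are unique as matrices and the filtering equation is an exact identity.
  The density \<open>ev l (1\<^sub>m 2)\<close> may vanish, so conditional expectations given
  \<open>Y_alg\<close> and quotients are fixed only with probability one.\<close>

lemma mat_adjoint_dim [simp]: "dim_row (mat_adjoint A) = dim_col A" "dim_col (mat_adjoint A) = dim_row A"
  by (auto simp: mat_adjoint_def)

lemma mat_adjoint_index [simp]:
  "i < dim_col A \<Longrightarrow> j < dim_row A \<Longrightarrow> mat_adjoint A $$ (i, j) = cnj (A $$ (j, i))"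
  by (simp add: mat_adjoint_def mat_of_rows_def)

lemma adjoint_carrier: "A \<in> carrier_mat nr nc \<Longrightarrow> mat_adjoint A \<in> carrier_mat nc nr"
  by (intro carrier_matI) simp_all

locale square_mats =
  fixes n :: nat
begin

abbreviation (input) MM :: "complex mat set" where "MM \<equiv> carrier_mat n n"

lemma closed [simp, intro]:
  "A \<in> MM \<Longrightarrow> B \<in> MM \<Longrightarrow> A * B \<in> MM"
  "A \<in> MM \<Longrightarrow> B \<in> MM \<Longrightarrow> A + B \<in> MM"
  "A \<in> MM \<Longrightarrow> B \<in> MM \<Longrightarrow> A - B \<in> MM"
  "A \<in> MM \<Longrightarrow> c \<cdot>\<^sub>m A \<in> MM"
  "A \<in> MM \<Longrightarrow> mat_adjoint A \<in> MM"
  "1\<^sub>m n \<in> MM"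
  "0\<^sub>m n n \<in> MM"
  by (simp_all add: mult_carrier_mat[of _ n n] minus_carrier_mat adjoint_carrier)

lemma mult_assoc: "A \<in> MM \<Longrightarrow> B \<in> MM \<Longrightarrow> C \<in> MM \<Longrightarrow> (A * B) * C = A * (B * C)"
  by (rule assoc_mult_mat)

lemma add_assoc: "A \<in> MM \<Longrightarrow> B \<in> MM \<Longrightarrow> C \<in> MM \<Longrightarrow> (A + B) + C = A + (B + C)"
  by (rule assoc_add_mat)

lemma distribs:
  "A \<in> MM \<Longrightarrow> B \<in> MM \<Longrightarrow> C \<in> MM \<Longrightarrow> A * (B + C) = A * B + A * C"
  "A \<in> MM \<Longrightarrow> B \<in> MM \<Longrightarrow> C \<in> MM \<Longrightarrow> (A + B) * C = A * C + B * C"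
  "A \<in> MM \<Longrightarrow> B \<in> MM \<Longrightarrow> C \<in> MM \<Longrightarrow> A * (B - C) = A * B - A * C"
  "A \<in> MM \<Longrightarrow> B \<in> MM \<Longrightarrow> C \<in> MM \<Longrightarrow> (A - B) * C = A * C - B * C"
  "A \<in> MM \<Longrightarrow> B \<in> MM \<Longrightarrow> (c \<cdot>\<^sub>m A) * B = c \<cdot>\<^sub>m (A * B)"
  "A \<in> MM \<Longrightarrow> B \<in> MM \<Longrightarrow> A * (c \<cdot>\<^sub>m B) = c \<cdot>\<^sub>m (A * B)"
  by (rule mult_add_distrib_mat add_mult_distrib_mat mult_minus_distrib_mat minus_mult_distrib_mat
      mult_smult_assoc_mat mult_smult_distrib; assumption)+

lemma smult_distribs:
  fixes A B :: "complex mat"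
  shows "A \<in> MM \<Longrightarrow> B \<in> MM \<Longrightarrow> c \<cdot>\<^sub>m (A + B) = c \<cdot>\<^sub>m A + c \<cdot>\<^sub>m B"
  "A \<in> MM \<Longrightarrow> B \<in> MM \<Longrightarrow> c \<cdot>\<^sub>m (A - B) = c \<cdot>\<^sub>m A - c \<cdot>\<^sub>m B"
  "A \<in> MM \<Longrightarrow> c \<cdot>\<^sub>m (d \<cdot>\<^sub>m A) = (c * d) \<cdot>\<^sub>m A"
  by (rule eq_matI; simp add: algebra_simps)+

lemmas mat_ring = mult_assoc add_assoc distribs smult_distribs

lemma units [simp]:
  fixes A :: "complex mat"
  shows "A \<in> MM \<Longrightarrow> A * 1\<^sub>m n = A"
  "A \<in> MM \<Longrightarrow> 1\<^sub>m n * A = A"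
  "A \<in> MM \<Longrightarrow> A * 0\<^sub>m n n = 0\<^sub>m n n"
  "A \<in> MM \<Longrightarrow> 0\<^sub>m n n * A = 0\<^sub>m n n"
  "A \<in> MM \<Longrightarrow> A + 0\<^sub>m n n = A"
  "A \<in> MM \<Longrightarrow> 0\<^sub>m n n + A = A"
  "A \<in> MM \<Longrightarrow> 1 \<cdot>\<^sub>m A = A"
  "A \<in> MM \<Longrightarrow> 0 \<cdot>\<^sub>m A = 0\<^sub>m n n"
  by auto

lemma adjoint_mult: "A \<in> MM \<Longrightarrow> B \<in> MM \<Longrightarrow> mat_adjoint (A * B) = mat_adjoint B * mat_adjoint A"
  by (rule eq_matI) (auto simp: scalar_prod_def mult.commute)

lemma adjoint_add: "A \<in> MM \<Longrightarrow> B \<in> MM \<Longrightarrow> mat_adjoint (A + B) = mat_adjoint A + mat_adjoint B"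
  by (rule eq_matI) auto

lemma adjoint_minus: "A \<in> MM \<Longrightarrow> B \<in> MM \<Longrightarrow> mat_adjoint (A - B) = mat_adjoint A - mat_adjoint B"
  by (rule eq_matI) auto

lemma adjoint_smult: "A \<in> MM \<Longrightarrow> mat_adjoint (c \<cdot>\<^sub>m A) = cnj c \<cdot>\<^sub>m mat_adjoint A"
  by (rule eq_matI) auto

lemma adjoint_adjoint [simp]: "A \<in> MM \<Longrightarrow> mat_adjoint (mat_adjoint A) = A"
  by (rule eq_matI) auto

lemma adjoint_one [simp]: "mat_adjoint (1\<^sub>m n :: complex mat) = 1\<^sub>m n"
  by (rule eq_matI) auto

lemma adjoint_zero [simp]: "mat_adjoint (0\<^sub>m n n :: complex mat) = 0\<^sub>m n n"
  by (rule eq_matI) auto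

lemmas adjoint_simps = adjoint_mult adjoint_add adjoint_minus adjoint_smult

definition unitary :: "complex mat \<Rightarrow> bool" where
  "unitary W \<longleftrightarrow> W \<in> MM \<and> mat_adjoint W * W = 1\<^sub>m n \<and> W * mat_adjoint W = 1\<^sub>m n"

lemma unitaryD:
  assumes "unitary W"
  shows "W \<in> MM" "mat_adjoint W * W = 1\<^sub>m n" "W * mat_adjoint W = 1\<^sub>m n"
    "A \<in> MM \<Longrightarrow> mat_adjoint W * (W * A) = A" "A \<in> MM \<Longrightarrow> W * (mat_adjoint W * A) = A"
proof -
  show 1: "W \<in> MM" and 2: "mat_adjoint W * W = 1\<^sub>m n" and 3: "W * mat_adjoint W = 1\<^sub>m n"
    using assms by (auto simp: unitary_def)
  show "mat_adjoint W * (W * A) = A" "W * (mat_adjoint W * A) = A" if "A \<in> MM"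
    using 1 2 3 that by (auto simp flip: mult_assoc)
qed

lemma unitary_one: "unitary (1\<^sub>m n)"
  by (simp add: unitary_def)

lemma unitary_mult:
  assumes "unitary A" "unitary B"
  shows "unitary (A * B)"
  using unitaryD[OF assms(1)] unitaryD[OF assms(2)]
  by (simp add: unitary_def adjoint_mult mult_assoc)

lemma unitary_adjoint: "unitary A \<Longrightarrow> unitary (mat_adjoint A)"
  by (simp add: unitary_def)

lemma commute_mult:
  assumes "A \<in> MM" "B \<in> MM" "C \<in> MM" "A * C = C * A" "B * C = C * B"
  shows "A * B * C = C * (A * B)"
proof -
  have "A * B * C = A * (B * C)" by (intro mult_assoc assms)
  also have "\<dots> = A * C * B" unfolding assms(5) by (intro mult_assoc[symmetric] assms)
  also have "\<dots> = C * (A * B)" unfolding assms(4) by (intro mult_assoc assms)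
  finally show ?thesis .
qed

lemma commute_adjoint:
  assumes "A \<in> MM" "C \<in> MM" "A * mat_adjoint C = mat_adjoint C * A"
  shows "mat_adjoint A * C = C * mat_adjoint A"
  using arg_cong[OF assms(3), of mat_adjoint] assms(1,2) by (simp add: adjoint_mult)

section \<open>Matrix powers and the exponential series\<close>

lemma pow_commute:
  assumes "A \<in> MM" "B \<in> MM" "A * B = B * A"
  shows "A ^\<^sub>m m * B = B * A ^\<^sub>m m"
proof (induction m)
  case 0
  then show ?case using assms by simp
next
  case (Suc m)
  then show ?case
    using commute_mult[of "A ^\<^sub>m m" A B] assms by simp
qed

lemma pow_adjoint: "A \<in> MM \<Longrightarrow> mat_adjoint (A ^\<^sub>m m) = mat_adjoint A ^\<^sub>m m"
proof (induction m)
  case 0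
  then show ?case by (auto intro!: eq_matI)
next
  case (Suc m)
  then show ?case
    using pow_commute[of "mat_adjoint A" "mat_adjoint A" m] by (simp add: adjoint_mult)
qed

lemma mult_index:
  "A \<in> MM \<Longrightarrow> B \<in> MM \<Longrightarrow> i < n \<Longrightarrow> j < n \<Longrightarrow> (A * B) $$ (i, j) = (\<Sum>p<n. A $$ (i, p) * B $$ (p, j))"
  by (auto simp: scalar_prod_def atLeast0LessThan)

lemma add_index:
  "A \<in> MM \<Longrightarrow> B \<in> MM \<Longrightarrow> i < n \<Longrightarrow> j < n \<Longrightarrow> (A + B) $$ (i, j) = A $$ (i, j) + B $$ (i, j)"
  by auto

lemma smult_index:
  fixes A :: "complex mat"
  shows "A \<in> MM \<Longrightarrow> i < n \<Longrightarrow> j < n \<Longrightarrow> (c \<cdot>\<^sub>m A) $$ (i, j) = c * A $$ (i, j)"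
  by auto

text \<open>Pascal's rule, carried out entrywise so that all sums are sums of complex numbers. The
  column \<open>j\<close> varies in the induction because right multiplication by
  \<open>A + B\<close> mixes columns.\<close>

lemma mat_binomial:
  assumes A: "A \<in> MM" and B: "B \<in> MM" and AB: "A * B = B * A"
  shows "i < n \<Longrightarrow> j < n \<Longrightarrow> ((A + B) ^\<^sub>m m) $$ (i, j) =
    (\<Sum>q\<le>m. of_nat (m choose q) * (A ^\<^sub>m q * B ^\<^sub>m (m - q)) $$ (i, j))"
proof (induction m arbitrary: j)
  case 0
  then show ?case using A B by simp
next
  case (Suc m)
  define g where "g q r = (A ^\<^sub>m q * B ^\<^sub>m r) $$ (i, j)" for q r
  have "((A + B) ^\<^sub>m Suc m) $$ (i, j) = (\<Sum>p<n. ((A + B) ^\<^sub>m m) $$ (i, p) * (A + B) $$ (p, j))"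
    using A B Suc.prems by (simp add: mult_index del: index_mult_mat index_add_mat)
  also have "\<dots> = (\<Sum>p<n. \<Sum>q\<le>m. of_nat (m choose q) * ((A ^\<^sub>m q * B ^\<^sub>m (m - q)) $$ (i, p) * (A + B) $$ (p, j)))"
    using Suc by (simp add: sum_distrib_right mult.assoc)
  also have "\<dots> = (\<Sum>q\<le>m. of_nat (m choose q) * (A ^\<^sub>m q * B ^\<^sub>m (m - q) * (A + B)) $$ (i, j))"
    using A B Suc.prems
    by (subst sum.swap) (simp add: mult_index[of "_ * _" "_ + _"] sum_distrib_left del: index_mult_mat index_add_mat)
  also have "\<dots> = (\<Sum>q\<le>m. of_nat (m choose q) * (g (Suc q) (m - q) + g q (Suc m - q)))"
  proof (rule sum.cong[OF refl])
    fix q assume "q \<in> {..m}"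
    have "A ^\<^sub>m q * B ^\<^sub>m (m - q) * (A + B) = A ^\<^sub>m Suc q * B ^\<^sub>m (m - q) + A ^\<^sub>m q * B ^\<^sub>m Suc (m - q)"
      using A B pow_commute[OF B A AB[symmetric], of "m - q"] by (simp add: mat_ring)
    moreover have "Suc (m - q) = Suc m - q" using \<open>q \<in> {..m}\<close> by auto
    ultimately show "of_nat (m choose q) * (A ^\<^sub>m q * B ^\<^sub>m (m - q) * (A + B)) $$ (i, j) =
      of_nat (m choose q) * (g (Suc q) (m - q) + g q (Suc m - q))"
      using A B Suc.prems unfolding g_def
      by (simp add: add_index del: index_mult_mat index_add_mat)
  qed
  also have "\<dots> = (\<Sum>q\<le>Suc m. of_nat (Suc m choose q) * g q (Suc m - q))"
  proof -
    have 1: "(\<Sum>q\<le>Suc m. of_nat (Suc m choose q) * g q (Suc m - q)) =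
      g 0 (Suc m) + (\<Sum>q\<le>m. of_nat (m choose Suc q) * g (Suc q) (m - q))
       + (\<Sum>q\<le>m. of_nat (m choose q) * g (Suc q) (m - q))"
      by (subst sum.atMost_Suc_shift) (simp add: sum.distrib algebra_simps)
    \<comment> \<open>With the old coefficient \<open>m choose q\<close> the term at
      \<open>q = Suc m\<close> is zero, so the sum may end at either bound; this absorbs the shifted
      half of Pascal's rule.\<close>
    have "(\<Sum>q\<le>Suc m. of_nat (m choose q) * g q (Suc m - q)) =
      g 0 (Suc m) + (\<Sum>q\<le>m. of_nat (m choose Suc q) * g (Suc q) (m - q))"
      by (subst sum.atMost_Suc_shift) simp
    then have 2: "g 0 (Suc m) + (\<Sum>q\<le>m. of_nat (m choose Suc q) * g (Suc q) (m - q)) =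
      (\<Sum>q\<le>m. of_nat (m choose q) * g q (Suc m - q))"
      by (simp add: binomial_eq_0)
    show ?thesis unfolding 1 2 by (simp add: sum.distrib algebra_simps)
  qed
  finally show ?case by (simp add: g_def)
qed

text \<open>The sum of the moduli of all entries dominates each column sum, so each further factor
  \<open>A\<close> costs at most a factor \<open>c\<close>. This makes the entry series of the
  exponential converge absolutely.\<close>

lemma pow_bound:
  assumes "A \<in> MM"
  obtains c where "c \<ge> 0" "\<And>m i j. i < n \<Longrightarrow> j < n \<Longrightarrow> cmod ((A ^\<^sub>m m) $$ (i, j)) \<le> c ^ m"
proof
  define c where "c = (\<Sum>j<n. \<Sum>p<n. cmod (A $$ (p, j)))"
  show c0: "c \<ge> 0" by (simp add: c_def sum_nonneg)
  have col: "(\<Sum>p<n. cmod (A $$ (p, j))) \<le> c" if "j < n" for j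
    unfolding c_def using that
    by (intro member_le_sum[of j "{..<n}" "\<lambda>j. \<Sum>p<n. cmod (A $$ (p, j))"]) (auto simp: sum_nonneg)
  show "cmod ((A ^\<^sub>m m) $$ (i, j)) \<le> c ^ m" if "i < n" "j < n" for m i j
    using that
  proof (induction m arbitrary: j)
    case 0
    then show ?case using assms by simp
  next
    case (Suc m)
    have "cmod ((A ^\<^sub>m Suc m) $$ (i, j)) \<le> (\<Sum>p<n. cmod ((A ^\<^sub>m m) $$ (i, p) * A $$ (p, j)))"
      using assms Suc.prems by (simp add: mult_index norm_sum del: index_mult_mat)
    also have "\<dots> \<le> (\<Sum>p<n. c ^ m * cmod (A $$ (p, j)))"
      using Suc by (intro sum_mono) (simp add: norm_mult mult_right_mono)
    also have "\<dots> = c ^ m * (\<Sum>p<n. cmod (A $$ (p, j)))"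
      by (simp add: sum_distrib_left)
    also have "\<dots> \<le> c ^ m * c"
      using col[OF Suc.prems(2)] c0 by (intro mult_left_mono) auto
    finally show ?case by (simp add: mult.commute)
  qed
qed

lemma exp_summable:
  assumes "A \<in> MM" "i < n" "j < n"
  shows "summable (\<lambda>m. norm ((A ^\<^sub>m m) $$ (i, j) / fact m))"
proof -
  obtain c where c: "c \<ge> 0" "\<And>m i j. i < n \<Longrightarrow> j < n \<Longrightarrow> cmod ((A ^\<^sub>m m) $$ (i, j)) \<le> c ^ m"
    using pow_bound[OF assms(1)] by blast
  show ?thesis
  proof (rule summable_comparison_test')
    show "summable (\<lambda>m. inverse (fact m) * c ^ m)" by (rule summable_exp)
    show "norm (norm ((A ^\<^sub>m m) $$ (i, j) / fact m)) \<le> inverse (fact m) * c ^ m" if "m \<ge> 0" for m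
      using c(2)[OF assms(2,3), of m]
      by (simp add: norm_divide divide_simps)
  qed
qed

lemma exp_closed [simp, intro]: "A \<in> MM \<Longrightarrow> mat_exp A \<in> MM"
  by (auto simp: mat_exp_def)

lemma exp_dim [simp]: "A \<in> MM \<Longrightarrow> dim_row (mat_exp A) = n" "A \<in> MM \<Longrightarrow> dim_col (mat_exp A) = n"
  by (auto simp: mat_exp_def)

lemma exp_index: "A \<in> MM \<Longrightarrow> i < n \<Longrightarrow> j < n \<Longrightarrow> mat_exp A $$ (i, j) = (\<Sum>m. (A ^\<^sub>m m) $$ (i, j) / fact m)"
  by (auto simp: mat_exp_def)

text \<open>Cauchy product of the absolutely convergent entry series; the factorials turn its terms
  into the binomial theorem for commuting matrices.\<close>

lemma exp_add:
  assumes A: "A \<in> MM" and B: "B \<in> MM" and AB: "A * B = B * A"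
  shows "mat_exp (A + B) = mat_exp A * mat_exp B"
proof (rule eq_matI)
  fix i j assume "i < dim_row (mat_exp A * mat_exp B)" "j < dim_col (mat_exp A * mat_exp B)"
  then have ij: "i < n" "j < n" using A B by (auto simp: mat_exp_def)
  let ?a = "\<lambda>p m. (A ^\<^sub>m m) $$ (i, p) / fact m" and ?b = "\<lambda>p m. (B ^\<^sub>m m) $$ (p, j) / fact m"
  have "(mat_exp A * mat_exp B) $$ (i, j) = (\<Sum>p<n. (\<Sum>m. ?a p m) * (\<Sum>m. ?b p m))"
    using A B ij by (simp add: mult_index exp_index del: index_mult_mat)
  also have "\<dots> = (\<Sum>p<n. \<Sum>m. \<Sum>q\<le>m. ?a p q * ?b p (m - q))"
    using exp_summable[OF A] exp_summable[OF B] ij by (intro sum.cong refl Cauchy_product) auto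
  also have "\<dots> = (\<Sum>m. \<Sum>p<n. \<Sum>q\<le>m. ?a p q * ?b p (m - q))"
    using exp_summable[OF A] exp_summable[OF B] ij
    by (intro suminf_sum[symmetric] summable_Cauchy_product) auto
  also have "\<dots> = (\<Sum>m. ((A + B) ^\<^sub>m m) $$ (i, j) / fact m)"
  proof (rule suminf_cong)
    fix m
    have "((A + B) ^\<^sub>m m) $$ (i, j) / fact m =
      (\<Sum>q\<le>m. of_nat (m choose q) / fact m * (\<Sum>p<n. (A ^\<^sub>m q) $$ (i, p) * (B ^\<^sub>m (m - q)) $$ (p, j)))"
      using A B ij by (simp add: mat_binomial[OF A B AB] mult_index sum_divide_distrib del: index_mult_mat)
    also have "\<dots> = (\<Sum>q\<le>m. \<Sum>p<n. ?a p q * ?b p (m - q))"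
      by (intro sum.cong refl) (simp add: sum_distrib_left binomial_fact divide_simps)
    finally show "(\<Sum>p<n. \<Sum>q\<le>m. ?a p q * ?b p (m - q)) = ((A + B) ^\<^sub>m m) $$ (i, j) / fact m"
      by (simp add: sum.swap[of _ "{..m}"])
  qed
  finally show "mat_exp (A + B) $$ (i, j) = (mat_exp A * mat_exp B) $$ (i, j)"
    using A B ij by (simp add: exp_index)
qed (use A B in \<open>auto simp: mat_exp_def\<close>)

lemma mat_exp_zero: "mat_exp (0\<^sub>m n n) = 1\<^sub>m n"
proof (rule eq_matI)
  fix i j assume ij: "i < dim_row (1\<^sub>m n)" "j < dim_col (1\<^sub>m n :: complex mat)"
  have "(\<Sum>m. ((0\<^sub>m n n :: complex mat) ^\<^sub>m m) $$ (i, j) / fact m) =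
    (\<Sum>m\<in>{0}. ((0\<^sub>m n n :: complex mat) ^\<^sub>m m) $$ (i, j) / fact m)"
  proof (rule suminf_finite)
    fix m :: nat assume "m \<notin> {0}"
    then obtain q where "m = Suc q" by (cases m) auto
    then show "((0\<^sub>m n n :: complex mat) ^\<^sub>m m) $$ (i, j) / fact m = 0"
      using ij by simp
  qed simp
  then show "mat_exp (0\<^sub>m n n) $$ (i, j) = 1\<^sub>m n $$ (i, j)"
    using ij by (simp add: exp_index)
qed (auto simp: mat_exp_def)

lemma exp_adjoint:
  assumes A: "A \<in> MM"
  shows "mat_adjoint (mat_exp A) = mat_exp (mat_adjoint A)"
proof (rule eq_matI)
  fix i j assume "i < dim_row (mat_exp (mat_adjoint A))" "j < dim_col (mat_exp (mat_adjoint A))"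
  then have ij: "i < n" "j < n" using A by simp_all
  have "cnj (\<Sum>m. (A ^\<^sub>m m) $$ (j, i) / fact m) = (\<Sum>m. cnj ((A ^\<^sub>m m) $$ (j, i) / fact m))"
    by (rule bounded_linear.suminf[OF bounded_linear_cnj summable_norm_cancel[OF exp_summable[OF A ij(2,1)]]])
  also have "\<dots> = (\<Sum>m. (mat_adjoint A ^\<^sub>m m) $$ (i, j) / fact m)"
    using A ij by (simp flip: pow_adjoint)
  finally show "mat_adjoint (mat_exp A) $$ (i, j) = mat_exp (mat_adjoint A) $$ (i, j)"
    using A ij by (simp add: exp_index)
qed (use A in simp_all)

lemma exp_skew_unitary:
  assumes A: "A \<in> MM" and skew: "mat_adjoint A = (-1) \<cdot>\<^sub>m A"
  shows "unitary (mat_exp A)"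
proof -
  have "mat_adjoint A * A = A * mat_adjoint A" "mat_adjoint A + A = 0\<^sub>m n n" "A + mat_adjoint A = 0\<^sub>m n n"
    using A by (auto simp: skew mat_ring)
  then show ?thesis
    using A by (auto simp: unitary_def exp_adjoint mat_exp_zero simp flip: exp_add)
qed

text \<open>Euler's formula with \<open>J\<close> in the role of the imaginary unit; it evaluates
  the rotation of one field factor.\<close>

lemma exp_complex_structure:
  assumes J: "J \<in> MM" and JJ: "J * J = (-1) \<cdot>\<^sub>m 1\<^sub>m n"
  shows "mat_exp (complex_of_real x \<cdot>\<^sub>m J) =
    complex_of_real (cos x) \<cdot>\<^sub>m 1\<^sub>m n + complex_of_real (sin x) \<cdot>\<^sub>m J"
proof (rule eq_matI)
  let ?A = "complex_of_real x \<cdot>\<^sub>m J"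
  \<comment> \<open>The factor \<open>fact m\<close> undoes the factorials in the Taylor
    coefficients. The recursions of \<open>cos_coeff\<close> and \<open>sin_coeff\<close> then
    replace a case split on the parity of \<open>m\<close>.\<close>
  let ?c = "\<lambda>m. complex_of_real (fact m * cos_coeff m * x ^ m)"
    and ?s = "\<lambda>m. complex_of_real (fact m * sin_coeff m * x ^ m)"
  have pow: "?A ^\<^sub>m m = ?c m \<cdot>\<^sub>m 1\<^sub>m n + ?s m \<cdot>\<^sub>m J" for m
  proof (induction m)
    case 0
    then show ?case using J by (auto intro!: eq_matI)
  next
    case (Suc m)
    have cc: "?c (Suc m) = - (?s m * complex_of_real x)"
      by (simp add: cos_coeff_Suc)
    have ss: "?s (Suc m) = ?c m * complex_of_real x"
      by (simp add: sin_coeff_Suc)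
    have "?A ^\<^sub>m Suc m = (?c m \<cdot>\<^sub>m 1\<^sub>m n + ?s m \<cdot>\<^sub>m J) * ?A"
      using Suc by simp
    also have "\<dots> = (?c m * complex_of_real x) \<cdot>\<^sub>m J + (- (?s m * complex_of_real x)) \<cdot>\<^sub>m 1\<^sub>m n"
      using J by (simp add: mat_ring JJ mult.commute)
    also have "\<dots> = ?c (Suc m) \<cdot>\<^sub>m 1\<^sub>m n + ?s (Suc m) \<cdot>\<^sub>m J"
      unfolding cc ss using J by (intro comm_add_mat) auto
    finally show ?case .
  qed
  fix i j assume "i < dim_row (complex_of_real (cos x) \<cdot>\<^sub>m 1\<^sub>m n + complex_of_real (sin x) \<cdot>\<^sub>m J)"
    and "j < dim_col (complex_of_real (cos x) \<cdot>\<^sub>m 1\<^sub>m n + complex_of_real (sin x) \<cdot>\<^sub>m J)"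
  then have ij: "i < n" "j < n" using J by auto
  have "(\<lambda>m. complex_of_real (cos_coeff m *\<^sub>R x ^ m) * (1\<^sub>m n $$ (i, j)) +
      complex_of_real (sin_coeff m *\<^sub>R x ^ m) * (J $$ (i, j))) sums
    (complex_of_real (cos x) * (1\<^sub>m n $$ (i, j)) + complex_of_real (sin x) * (J $$ (i, j)))"
    by (intro sums_add sums_mult2 sums_of_real cos_converges sin_converges)
  moreover have "complex_of_real (cos_coeff m *\<^sub>R x ^ m) * (1\<^sub>m n $$ (i, j)) +
      complex_of_real (sin_coeff m *\<^sub>R x ^ m) * (J $$ (i, j)) = (?A ^\<^sub>m m) $$ (i, j) / fact m" for m
    using J ij by (simp add: pow add_divide_distrib)
  ultimately show "mat_exp ?A $$ (i, j) =
    (complex_of_real (cos x) \<cdot>\<^sub>m 1\<^sub>m n + complex_of_real (sin x) \<cdot>\<^sub>m J) $$ (i, j)"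
    using J ij by (simp add: exp_index sums_iff)
qed (use J in \<open>auto simp: mat_exp_def\<close>)

end

section \<open>Kronecker products\<close>

lemma kron_dim [simp]:
  "dim_row (A \<otimes>\<^sub>K B) = dim_row A * dim_row B" "dim_col (A \<otimes>\<^sub>K B) = dim_col A * dim_col B"
  by (auto simp: kron_def)

lemma kron_carrier:
  "A \<in> carrier_mat a b \<Longrightarrow> B \<in> carrier_mat c d \<Longrightarrow> A \<otimes>\<^sub>K B \<in> carrier_mat (a * c) (b * d)"
  by auto

lemma kron_index:
  "i < dim_row A * dim_row B \<Longrightarrow> j < dim_col A * dim_col B \<Longrightarrow>
    (A \<otimes>\<^sub>K B) $$ (i, j) = A $$ (i div dim_row B, j div dim_col B) * B $$ (i mod dim_row B, j mod dim_col B)"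
  by (simp add: kron_def)

lemma div_mod_less:
  fixes a b i :: nat
  assumes "i < a * b"
  shows "i div b < a" "i mod b < b"
proof -
  have "b > 0" using assms by (cases b) auto
  then show "i mod b < b" by simp
  show "i div b < a" using assms by (simp add: less_mult_imp_div_less)
qed

lemma div_mod_lessD: "i < a * b \<Longrightarrow> i div b < a \<and> i mod b < (b::nat)"
  using div_mod_less by blast

text \<open>Indices of a Kronecker product are two-digit numbers in mixed radix; this splits a sum
  over them into the sums over the digits.\<close>

lemma sum_div_mod:
  fixes a b :: nat
  shows "(\<Sum>p<a * b. f (p div b) (p mod b)) = (\<Sum>x<a. \<Sum>y<b. f x y)"
proof -
  have "(\<Sum>p<a * b. f (p div b) (p mod b)) = (\<Sum>(x, y)\<in>{..<a} \<times> {..<b}. f x y)"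
  proof (rule sum.reindex_bij_witness[of _ "\<lambda>(x, y). x * b + y" "\<lambda>p. (p div b, p mod b)"])
    fix xy assume "xy \<in> {..<a} \<times> {..<b}"
    then obtain x y where xy: "xy = (x, y)" "x < a" "y < b" by auto
    have "x * b + y < Suc x * b" using xy by simp
    also have "\<dots> \<le> a * b" using xy by (intro mult_right_mono) auto
    finally show "(case xy of (x, y) \<Rightarrow> x * b + y) \<in> {..<a * b}" using xy by simp
    show "((case xy of (x, y) \<Rightarrow> x * b + y) div b, (case xy of (x, y) \<Rightarrow> x * b + y) mod b) = xy"
      using xy by simp
  qed (auto dest!: div_mod_lessD)
  also have "\<dots> = (\<Sum>x<a. \<Sum>y<b. f x y)"
    by (rule sum.cartesian_product[symmetric])
  finally show ?thesis .
qed

lemma kron_mult: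
  assumes "dim_col A = dim_row C" "dim_col B = dim_row D"
  shows "(A \<otimes>\<^sub>K B) * (C \<otimes>\<^sub>K D) = (A * C) \<otimes>\<^sub>K (B * D)"
proof (rule eq_matI)
  fix i j assume "i < dim_row ((A * C) \<otimes>\<^sub>K (B * D))" "j < dim_col ((A * C) \<otimes>\<^sub>K (B * D))"
  then have i: "i < dim_row A * dim_row B" and j: "j < dim_col C * dim_col D" by auto
  let ?f = "\<lambda>x y. A $$ (i div dim_row B, x) * B $$ (i mod dim_row B, y) *
    (C $$ (x, j div dim_col D) * D $$ (y, j mod dim_col D))"
  have "((A \<otimes>\<^sub>K B) * (C \<otimes>\<^sub>K D)) $$ (i, j) =
    (\<Sum>p<dim_row C * dim_row D. ?f (p div dim_row D) (p mod dim_row D))"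
    using i j assms by (simp add: scalar_prod_def kron_index atLeast0LessThan)
  also have "\<dots> = (\<Sum>x<dim_row C. \<Sum>y<dim_row D. ?f x y)"
    by (rule sum_div_mod)
  also have "\<dots> = ((A * C) \<otimes>\<^sub>K (B * D)) $$ (i, j)"
    using i j assms div_mod_less[OF i] div_mod_less[OF j]
    by (simp add: scalar_prod_def kron_index atLeast0LessThan sum_product mult.assoc mult.left_commute)
  finally show "((A \<otimes>\<^sub>K B) * (C \<otimes>\<^sub>K D)) $$ (i, j) = ((A * C) \<otimes>\<^sub>K (B * D)) $$ (i, j)" .
qed simp_all

lemma mod_mult_div:
  fixes i b c :: nat
  shows "i mod (b * c) div c = i div c mod b" "i mod (b * c) mod c = i mod c"
proof -
  have "i mod (b * c) = c * (i div c mod b) + i mod c"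
    by (metis mod_mult2_eq mult.commute)
  then show "i mod (b * c) div c = i div c mod b"
    by (cases "c = 0") simp_all
  show "i mod (b * c) mod c = i mod c"
    by (simp add: mod_mod_cancel)
qed

lemma kron_assoc: "(A \<otimes>\<^sub>K B) \<otimes>\<^sub>K C = A \<otimes>\<^sub>K (B \<otimes>\<^sub>K C)"
proof (rule eq_matI)
  fix i j assume "i < dim_row (A \<otimes>\<^sub>K (B \<otimes>\<^sub>K C))" "j < dim_col (A \<otimes>\<^sub>K (B \<otimes>\<^sub>K C))"
  then have i: "i < dim_row A * dim_row B * dim_row C" and j: "j < dim_col A * dim_col B * dim_col C"
    by (simp_all add: mult.assoc)
  note i' = div_mod_less[OF i] and j' = div_mod_less[OF j]
  have i2: "i mod (dim_row B * dim_row C) < dim_row B * dim_row C"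
    using i by (intro mod_less_divisor) (auto intro!: Nat.gr0I)
  have j2: "j mod (dim_col B * dim_col C) < dim_col B * dim_col C"
    using j by (intro mod_less_divisor) (auto intro!: Nat.gr0I)
  show "((A \<otimes>\<^sub>K B) \<otimes>\<^sub>K C) $$ (i, j) = (A \<otimes>\<^sub>K (B \<otimes>\<^sub>K C)) $$ (i, j)"
    using i j i' j' i2 j2
    by (simp add: kron_index mult.assoc mod_mult_div div_mult2_eq[symmetric] mult.commute[of "dim_row C"]
        mult.commute[of "dim_col C"])
qed (simp_all add: mult.assoc)

lemma kron_adjoint: "mat_adjoint (A \<otimes>\<^sub>K B) = mat_adjoint A \<otimes>\<^sub>K mat_adjoint B"
  by (rule eq_matI) (auto simp: kron_index dest!: div_mod_lessD)

lemma kron_add_left: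
  "dim_row A = dim_row B \<Longrightarrow> dim_col A = dim_col B \<Longrightarrow> (A + B) \<otimes>\<^sub>K C = (A \<otimes>\<^sub>K C) + (B \<otimes>\<^sub>K C)"
  by (rule eq_matI) (auto simp: kron_index algebra_simps dest!: div_mod_lessD)

lemma kron_add_right:
  "dim_row B = dim_row C \<Longrightarrow> dim_col B = dim_col C \<Longrightarrow> A \<otimes>\<^sub>K (B + C) = (A \<otimes>\<^sub>K B) + (A \<otimes>\<^sub>K C)"
  by (rule eq_matI) (auto simp: kron_index algebra_simps dest!: div_mod_lessD)

lemma kron_smult_left: "(c \<cdot>\<^sub>m A) \<otimes>\<^sub>K B = c \<cdot>\<^sub>m (A \<otimes>\<^sub>K B)"
  by (rule eq_matI) (auto simp: kron_index dest!: div_mod_lessD)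

lemma kron_smult_right: "A \<otimes>\<^sub>K (c \<cdot>\<^sub>m B) = c \<cdot>\<^sub>m (A \<otimes>\<^sub>K B)"
  by (rule eq_matI) (auto simp: kron_index dest!: div_mod_lessD)

lemma kron_one: "1\<^sub>m a \<otimes>\<^sub>K 1\<^sub>m b = 1\<^sub>m (a * b)"
proof (rule eq_matI)
  fix i j assume "i < dim_row (1\<^sub>m (a * b) :: complex mat)" "j < dim_col (1\<^sub>m (a * b) :: complex mat)"
  then have ij: "i < a * b" "j < a * b" by auto
  have "i = j \<longleftrightarrow> i div b = j div b \<and> i mod b = j mod b"
    by (metis div_mult_mod_eq)
  then show "(1\<^sub>m a \<otimes>\<^sub>K 1\<^sub>m b) $$ (i, j) = 1\<^sub>m (a * b) $$ (i, j)"
    using ij div_mod_less[OF ij(1)] div_mod_less[OF ij(2)] by (auto simp: kron_index)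
qed auto

lemma kron_commute:
  assumes "A \<in> carrier_mat a a" "B \<in> carrier_mat b b"
  shows "(A \<otimes>\<^sub>K 1\<^sub>m b) * (1\<^sub>m a \<otimes>\<^sub>K B) = (1\<^sub>m a \<otimes>\<^sub>K B) * (A \<otimes>\<^sub>K 1\<^sub>m b)"
  using assms by (simp add: kron_mult carrier_matD[OF assms(1)] carrier_matD[OF assms(2)])

lemma kron_one_commute:
  assumes "A \<in> carrier_mat b b" "B \<in> carrier_mat b b" "A * B = B * A"
  shows "(1\<^sub>m a \<otimes>\<^sub>K A) * (1\<^sub>m a \<otimes>\<^sub>K B) = (1\<^sub>m a \<otimes>\<^sub>K B) * (1\<^sub>m a \<otimes>\<^sub>K A)"
  using assms(3) by (simp add: kron_mult carrier_matD[OF assms(1)] carrier_matD[OF assms(2)])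

text \<open>For \<open>m = 2\<^sup>k\<close> the last basis vector is the vacuum \<open>\<Phi>\<^sup>\<otimes>\<^sup>k\<close>.\<close>

definition last_proj :: "nat \<Rightarrow> complex mat" where
  "last_proj m = mat m m (\<lambda>(i, j). if i = m - 1 \<and> j = m - 1 then 1 else 0)"

lemma last_proj_dim [simp]: "dim_row (last_proj m) = m" "dim_col (last_proj m) = m"
  by (auto simp: last_proj_def)

text \<open>The reason for last basis vectors being multiplicative under tensor products: the
  largest two-digit number has both digits largest.\<close>

lemma last_index_iff:
  fixes a b i :: nat
  assumes "i < a * b"
  shows "i = a * b - 1 \<longleftrightarrow> i div b = a - 1 \<and> i mod b = b - 1"
proof -
  obtain a' b' where ab: "a = Suc a'" "b = Suc b'"
    using assms by (cases a; cases b) auto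
  have *: "a * b - 1 = a' * b + b'" by (simp add: ab)
  have "(a' * b + b') div b = a'" "(a' * b + b') mod b = b'" by (simp_all add: ab del: mult_Suc_right)
  then show ?thesis unfolding * using ab by (metis diff_Suc_1 div_mult_mod_eq)
qed

lemma last_proj_kron: "last_proj (a * b) = last_proj a \<otimes>\<^sub>K last_proj b"
proof (rule eq_matI)
  fix i j assume "i < dim_row (last_proj a \<otimes>\<^sub>K last_proj b)" "j < dim_col (last_proj a \<otimes>\<^sub>K last_proj b)"
  then have ij: "i < a * b" "j < a * b" by auto
  show "last_proj (a * b) $$ (i, j) = (last_proj a \<otimes>\<^sub>K last_proj b) $$ (i, j)"
    using ij div_mod_less[OF ij(1)] div_mod_less[OF ij(2)] last_index_iff[OF ij(1)] last_index_iff[OF ij(2)]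
    by (auto simp: kron_index last_proj_def)
qed auto

lemma last_proj_adjoint [simp]: "mat_adjoint (last_proj m) = last_proj m"
  by (rule eq_matI) (auto simp: last_proj_def)

section \<open>The joint state\<close>

lemma vacuum_eq: "X \<in> carrier_mat 2 2 \<Longrightarrow> vacuum X = X $$ (1, 1)"
  by (simp add: vacuum_def Phi_def scalar_prod_def vec_of_list_index numeral_2_eq_2)

text \<open>\<open>Phi\<close> is the second basis vector, so each \<open>vacuum\<close> selects the
  lower right block and the iteration ends at the last diagonal entry.\<close>

lemma vacuum_power_eq:
  "W \<in> carrier_mat (2 ^ k) (2 ^ k) \<Longrightarrow> vacuum_power k W = W $$ (2 ^ k - 1, 2 ^ k - 1)"
proof (induction k arbitrary: W)
  case 0
  then show ?case by simp
next
  case (Suc k)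
  have "(0::nat) < 2 ^ k" by simp
  then show ?case
    using Suc.IH by (simp add: tensor_functional_def vacuum_eq mult_2)
qed

text \<open>Index of a system basis vector tensored with the vacuum: system digit \<open>a\<close>
  in front, followed by \<open>k\<close> binary digits 1.\<close>

definition vac_pos :: "nat \<Rightarrow> nat \<Rightarrow> nat" where
  "vac_pos k a = a * 2 ^ k + (2 ^ k - 1)"

text \<open>The partial vacuum expectation over the field, an operator of the system;
  \<open>joint_state\<close> is \<open>\<rho>\<close> of it.\<close>

definition vac_block :: "nat \<Rightarrow> complex mat \<Rightarrow> complex mat" where
  "vac_block k B = mat 2 2 (\<lambda>(a, b). B $$ (vac_pos k a, vac_pos k b))"

lemma vac_block_closed [simp]: "vac_block k B \<in> carrier_mat 2 2"
  by (simp add: vac_block_def)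

lemma joint_state_eq: "joint_state k \<rho> B = \<rho> (vac_block k B)"
  by (simp add: joint_state_def tensor_functional_def vacuum_power_eq vac_block_def vac_pos_def)

lemma vac_pos:
  fixes a k :: nat
  assumes "a < 2"
  shows "vac_pos k a < tdim k" "vac_pos k a div 2 ^ k = a"
    "vac_pos k a mod 2 ^ k = (2::nat) ^ k - 1"
proof -
  have *: "(2::nat) ^ k - 1 < 2 ^ k" by simp
  have aux: "(a * m + r) div m = a \<and> (a * m + r) mod m = r" if "r < m" for r m :: nat
    using that by simp
  show "vac_pos k a div 2 ^ k = a" "vac_pos k a mod 2 ^ k = (2::nat) ^ k - 1"
    unfolding vac_pos_def using aux[OF *] by blast+
  have "a * 2 ^ k \<le> 1 * 2 ^ k" using assms by (intro mult_right_mono) auto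
  then show "vac_pos k a < tdim k"
    using * unfolding vac_pos_def tdim_def by linarith
qed

section \<open>The system, the field and the vacuum\<close>

lemma mat2_eqI:
  assumes "A \<in> carrier_mat 2 2" "B \<in> carrier_mat 2 2"
    "A $$ (0, 0) = B $$ (0, 0)" "A $$ (0, 1) = B $$ (0, 1)"
    "A $$ (1, 0) = B $$ (1, 0)" "A $$ (1, 1) = B $$ (1, 1)"
  shows "A = B"
proof (rule eq_matI)
  fix i j assume "i < dim_row B" "j < dim_col B"
  then have "i = 0 \<or> i = 1" "j = 0 \<or> j = 1" using assms(2) by auto
  then show "A $$ (i, j) = B $$ (i, j)" using assms by auto
qed (use assms in auto)

lemma mult2_index:
  assumes "A \<in> carrier_mat 2 2" "B \<in> carrier_mat 2 2" "i < 2" "j < 2"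
  shows "(A * B :: complex mat) $$ (i, j) = A $$ (i, 0) * B $$ (0, j) + A $$ (i, 1) * B $$ (1, j)"
  using assms by (simp add: scalar_prod_def numeral_2_eq_2)

lemma sigma_closed [simp]: "sigma_minus \<in> carrier_mat 2 2" "sigma_plus \<in> carrier_mat 2 2"
  by (auto simp: sigma_minus_def sigma_plus_def mat_of_rows_list_def)

lemma sigma_index [simp]:
  "sigma_minus $$ (0, 0) = 0" "sigma_minus $$ (0, Suc 0) = 0" "sigma_minus $$ (Suc 0, 0) = 1" "sigma_minus $$ (Suc 0, Suc 0) = 0"
  "sigma_plus $$ (0, 0) = 0" "sigma_plus $$ (0, Suc 0) = 1" "sigma_plus $$ (Suc 0, 0) = 0" "sigma_plus $$ (Suc 0, Suc 0) = 0"
  by (auto simp: sigma_minus_def sigma_plus_def mat_of_rows_list_def)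

interpretation two: square_mats 2 .

lemma adjoint_sigma [simp]: "mat_adjoint sigma_minus = sigma_plus" "mat_adjoint sigma_plus = sigma_minus"
  by (auto simp: sigma_plus_def)

text \<open>Normally ordered expansion: the last two terms end in \<open>sigma_minus\<close> and so
  annihilate the vacuum.\<close>

lemma mat2_vacuum_expansion:
  assumes "Y \<in> carrier_mat 2 2"
  shows "Y = Y $$ (1, 1) \<cdot>\<^sub>m 1\<^sub>m 2 + Y $$ (0, 1) \<cdot>\<^sub>m sigma_plus + Y $$ (1, 0) \<cdot>\<^sub>m sigma_minus
    + (Y $$ (0, 0) - Y $$ (1, 1)) \<cdot>\<^sub>m (sigma_plus * sigma_minus)"
  by (rule mat2_eqI) (use assms in \<open>auto simp: mult2_index two.add_index two.smult_index simp del: index_mult_mat(1) index_add_mat(1) index_smult_mat(1)\<close>)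

lemma pow2_split: "c = Suc (a + b) \<Longrightarrow> 2 ^ c = 2 ^ a * (2 * 2 ^ b :: nat)"
  by (simp add: power_add)

locale fock =
  fixes k :: nat
begin

sublocale square_mats "tdim k" .

lemma tdim_split: "i \<le> k \<Longrightarrow> 2 ^ i * (2 * 2 ^ (k - i)) = tdim k"
  unfolding tdim_def by (metis le_add_diff_inverse mult.left_commute power_add)

lemma sys_closed [simp]: "X \<in> carrier_mat 2 2 \<Longrightarrow> sys k X \<in> MM"
  by (auto simp: sys_def tdim_def)

lemma fld_closed [simp]: "i \<le> k \<Longrightarrow> Y \<in> carrier_mat 2 2 \<Longrightarrow> fld k i Y \<in> MM"
  using tdim_split[of i] by (auto simp: fld_def)

lemma sys_mult: "X \<in> carrier_mat 2 2 \<Longrightarrow> Y \<in> carrier_mat 2 2 \<Longrightarrow> sys k (X * Y) = sys k X * sys k Y"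
  by (auto simp: sys_def kron_mult)

lemma sys_add: "X \<in> carrier_mat 2 2 \<Longrightarrow> Y \<in> carrier_mat 2 2 \<Longrightarrow> sys k (X + Y) = sys k X + sys k Y"
  by (auto simp: sys_def kron_add_left)

lemma sys_smult: "sys k (c \<cdot>\<^sub>m X) = c \<cdot>\<^sub>m sys k X"
  by (simp add: sys_def kron_smult_left)

lemma sys_one: "sys k (1\<^sub>m 2) = 1\<^sub>m (tdim k)"
  by (simp add: sys_def kron_one tdim_def)

lemma sys_adjoint: "sys k (mat_adjoint X) = mat_adjoint (sys k X)"
  by (simp add: sys_def kron_adjoint square_mats.adjoint_one)

lemma fld_mult:
  "X \<in> carrier_mat 2 2 \<Longrightarrow> Y \<in> carrier_mat 2 2 \<Longrightarrow> fld k i (X * Y) = fld k i X * fld k i Y"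
  by (auto simp: fld_def kron_mult)

lemma fld_add:
  "X \<in> carrier_mat 2 2 \<Longrightarrow> Y \<in> carrier_mat 2 2 \<Longrightarrow> fld k i (X + Y) = fld k i X + fld k i Y"
  by (auto simp: fld_def kron_add_left kron_add_right)

lemma fld_smult: "fld k i (c \<cdot>\<^sub>m X) = c \<cdot>\<^sub>m fld k i X"
  by (simp add: fld_def kron_smult_left kron_smult_right)

lemma fld_one: "i \<le> k \<Longrightarrow> fld k i (1\<^sub>m 2) = 1\<^sub>m (tdim k)"
  using tdim_split[of i] by (simp add: fld_def kron_one)

lemma fld_adjoint: "fld k i (mat_adjoint X) = mat_adjoint (fld k i X)"
  by (simp add: fld_def kron_adjoint square_mats.adjoint_one)

lemma sys_fld_commute:
  assumes "X \<in> carrier_mat 2 2" "Y \<in> carrier_mat 2 2" "i \<in> {1..k}"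
  shows "sys k X * fld k i Y = fld k i Y * sys k X"
proof -
  have "2 ^ i = 2 * (2 ^ (i - 1) :: nat)" using assms(3) by (cases i) auto
  then have *: "fld k i Y = 1\<^sub>m 2 \<otimes>\<^sub>K (1\<^sub>m (2 ^ (i - 1)) \<otimes>\<^sub>K Y \<otimes>\<^sub>K 1\<^sub>m (2 ^ (k - i)))" (is "_ = _ \<otimes>\<^sub>K ?W")
    unfolding fld_def by (simp only: flip: kron_one kron_assoc)
  have "2 ^ k = 2 ^ (i - 1) * (2 * 2 ^ (k - i) :: nat)"
    using assms(3) by (intro pow2_split) auto
  then have "?W \<in> carrier_mat (2 ^ k) (2 ^ k)"
    using assms(2) by auto
  then show ?thesis
    unfolding * sys_def by (intro kron_commute assms)
qed

text \<open>Once the identity on the first \<open>2 ^ i\<close> dimensions is split off from both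
  operators, \<open>X\<close> acts on the first remaining factor and \<open>Y\<close> on a later
  one.\<close>

lemma fld_fld_commute_less:
  assumes "X \<in> carrier_mat 2 2" "Y \<in> carrier_mat 2 2" "i < j" "j \<le> k"
  shows "fld k i X * fld k j Y = fld k j Y * fld k i X"
proof -
  have "2 ^ j = 2 ^ i * (2 * 2 ^ (j - i - 1) :: nat)"
    using assms(3) by (intro pow2_split) auto
  then have *: "fld k j Y = 1\<^sub>m (2 ^ i) \<otimes>\<^sub>K (1\<^sub>m 2 \<otimes>\<^sub>K (1\<^sub>m (2 ^ (j - i - 1)) \<otimes>\<^sub>K Y \<otimes>\<^sub>K 1\<^sub>m (2 ^ (k - j))))"
    (is "_ = _ \<otimes>\<^sub>K (_ \<otimes>\<^sub>K ?W)")
    unfolding fld_def by (simp only: flip: kron_one kron_assoc)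
  have "2 ^ (k - i) = 2 ^ (j - i - 1) * (2 * 2 ^ (k - j) :: nat)"
    using assms(3,4) by (intro pow2_split) auto
  then have "?W \<in> carrier_mat (2 ^ (k - i)) (2 ^ (k - i))"
    using assms(2) by auto
  then have "(X \<otimes>\<^sub>K 1\<^sub>m (2 ^ (k - i))) * (1\<^sub>m 2 \<otimes>\<^sub>K ?W) = (1\<^sub>m 2 \<otimes>\<^sub>K ?W) * (X \<otimes>\<^sub>K 1\<^sub>m (2 ^ (k - i)))"
    by (intro kron_commute assms)
  moreover have "X \<otimes>\<^sub>K 1\<^sub>m (2 ^ (k - i)) \<in> carrier_mat (2 * 2 ^ (k - i)) (2 * 2 ^ (k - i))"
    "1\<^sub>m 2 \<otimes>\<^sub>K ?W \<in> carrier_mat (2 * 2 ^ (k - i)) (2 * 2 ^ (k - i))"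
    using \<open>?W \<in> _\<close> by (intro kron_carrier assms one_carrier_mat; simp)+
  ultimately show ?thesis
    unfolding * unfolding fld_def by (intro kron_one_commute)
qed

lemma fld_fld_commute:
  assumes "X \<in> carrier_mat 2 2" "Y \<in> carrier_mat 2 2" "i \<noteq> j" "i \<le> k" "j \<le> k"
  shows "fld k i X * fld k j Y = fld k j Y * fld k i X"
  using fld_fld_commute_less[of X Y i j] fld_fld_commute_less[of Y X j i] assms
  by (cases "i < j") auto

text \<open>Projection onto system tensor vacuum. An equation \<open>A * vac = B * vac\<close>
  expresses that \<open>A\<close> and \<open>B\<close> agree on all vectors with the field in the
  vacuum, the system vector being free.\<close>

definition vac :: "complex mat" where
  "vac = 1\<^sub>m 2 \<otimes>\<^sub>K last_proj (2 ^ k)"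

lemma vac_closed [simp]: "vac \<in> MM"
  by (auto simp: vac_def tdim_def)

lemma vac_adjoint [simp]: "mat_adjoint vac = vac"
  by (simp add: vac_def kron_adjoint)

lemma vac_fld:
  assumes "i \<in> {1..k}"
  shows "fld k i sigma_minus * vac = 0\<^sub>m (tdim k) (tdim k)"
proof -
  have "2 ^ k = 2 ^ (i - 1) * (2 * 2 ^ (k - i) :: nat)"
    using assms by (intro pow2_split) auto
  then have "vac = (1\<^sub>m 2 \<otimes>\<^sub>K last_proj (2 ^ (i - 1))) \<otimes>\<^sub>K last_proj 2 \<otimes>\<^sub>K last_proj (2 ^ (k - i))"
    unfolding vac_def kron_assoc by (simp only: flip: last_proj_kron)
  moreover have "2 ^ i = 2 * (2 ^ (i - 1) :: nat)" using assms by (cases i) auto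
  ultimately have eq: "fld k i sigma_minus * vac =
    (1\<^sub>m (2 ^ i) * (1\<^sub>m 2 \<otimes>\<^sub>K last_proj (2 ^ (i - 1)))) \<otimes>\<^sub>K (sigma_minus * last_proj 2) \<otimes>\<^sub>K (1\<^sub>m (2 ^ (k - i)) * last_proj (2 ^ (k - i)))"
    (is "_ = ?A \<otimes>\<^sub>K ?B \<otimes>\<^sub>K ?C")
    unfolding fld_def using sigma_closed by (simp add: kron_mult carrier_matD[OF sigma_closed(1)])
  \<comment> \<open>\<open>sigma_minus\<close> kills the vacuum of the \<open>i\<close>-th factor.
    Stated as a multiple by 0, this lets the scalar be pulled out of the Kronecker products.\<close>
  also have "?B = 0 \<cdot>\<^sub>m ?B"
    by (rule mat2_eqI) (auto simp: last_proj_def mult2_index simp del: index_mult_mat(1) intro!: mult_carrier_mat[of _ 2 2])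
  finally have "fld k i sigma_minus * vac = 0 \<cdot>\<^sub>m (?A \<otimes>\<^sub>K ?B \<otimes>\<^sub>K ?C)"
    by (simp add: kron_smult_left kron_smult_right)
  also have "?A \<otimes>\<^sub>K ?B \<otimes>\<^sub>K ?C = fld k i sigma_minus * vac" by (rule eq[symmetric])
  finally show ?thesis using assms by simp
qed

lemma vac_index:
  "i < tdim k \<Longrightarrow> j < tdim k \<Longrightarrow> vac $$ (i, j) = (if i = j \<and> i mod 2 ^ k = 2 ^ k - 1 then 1 else 0)"
proof -
  assume ij: "i < tdim k" "j < tdim k"
  have "i = j \<longleftrightarrow> i div 2 ^ k = j div 2 ^ k \<and> i mod 2 ^ k = j mod 2 ^ k"
    by (metis div_mult_mod_eq)
  then show ?thesis
    using ij[unfolded tdim_def] div_mod_less[OF ij(1)[unfolded tdim_def]] div_mod_less[OF ij(2)[unfolded tdim_def]]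
    by (auto simp: vac_def kron_index last_proj_def)
qed

text \<open>\<open>vac\<close> is diagonal, with entry 1 at the positions \<open>vac_pos\<close>,
  the only ones that \<open>vac_block\<close> reads.\<close>

lemma vac_block_compress:
  assumes "B \<in> MM"
  shows "vac_block k (vac * (B * vac)) = vac_block k B"
proof -
  have "(vac * (B * vac)) $$ (i, j) = B $$ (i, j)"
    if "i < tdim k" "j < tdim k" "i mod 2 ^ k = 2 ^ k - 1" "j mod 2 ^ k = 2 ^ k - 1" for i j
  proof -
    have row: "(vac * C) $$ (i, j) = C $$ (i, j)" if "C \<in> MM" for C
    proof -
      have "(vac * C) $$ (i, j) = (\<Sum>p<tdim k. vac $$ (i, p) * C $$ (p, j))"
        using that \<open>i < tdim k\<close> \<open>j < tdim k\<close> by (intro mult_index) auto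
      also have "\<dots> = (\<Sum>p<tdim k. if i = p then C $$ (p, j) else 0)"
        using \<open>i < tdim k\<close> \<open>i mod 2 ^ k = _\<close> by (intro sum.cong) (auto simp: vac_index)
      finally show ?thesis using \<open>i < tdim k\<close> by simp
    qed
    have "(B * vac) $$ (i, j) = (\<Sum>p<tdim k. B $$ (i, p) * vac $$ (p, j))"
      using that assms by (intro mult_index) auto
    also have "\<dots> = (\<Sum>p<tdim k. if p = j then B $$ (i, p) else 0)"
      using that by (intro sum.cong) (auto simp: vac_index)
    finally show ?thesis using that assms by (simp add: row del: index_mult_mat(1))
  qed
  then show ?thesis
    unfolding vac_block_def
    by (intro cong_mat refl) (simp add: vac_pos del: index_mult_mat(1))
qed

end

locale fock_state = fock +
  fixes \<rho> :: "complex mat \<Rightarrow> complex"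
  assumes state: "is_state 2 \<rho>"
begin

abbreviation P :: "complex mat \<Rightarrow> complex" where "P \<equiv> joint_state k \<rho>"

lemma rho_add: "A \<in> carrier_mat 2 2 \<Longrightarrow> B \<in> carrier_mat 2 2 \<Longrightarrow> \<rho> (A + B) = \<rho> A + \<rho> B"
  and rho_smult: "A \<in> carrier_mat 2 2 \<Longrightarrow> \<rho> (c \<cdot>\<^sub>m A) = c * \<rho> A"
  and rho_pos: "A \<in> carrier_mat 2 2 \<Longrightarrow> \<rho> (mat_adjoint A * A) \<in> \<real>\<^sub>\<ge>\<^sub>0"
  and rho_one: "\<rho> (1\<^sub>m 2) = 1"
  using state by (auto simp: is_state_def)

lemma P_add:
  assumes "A \<in> MM" "B \<in> MM"
  shows "P (A + B) = P A + P B"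
proof -
  have "vac_block k (A + B) = vac_block k A + vac_block k B"
    by (rule eq_matI)
      (use assms in \<open>auto simp: vac_block_def vac_pos add_index[OF assms]\<close>)
  then show ?thesis by (simp add: joint_state_eq rho_add)
qed

lemma P_smult:
  assumes "A \<in> MM"
  shows "P (c \<cdot>\<^sub>m A) = c * P A"
proof -
  have "vac_block k (c \<cdot>\<^sub>m A) = c \<cdot>\<^sub>m vac_block k A"
    by (rule eq_matI) (use assms vac_pos(1)[of _ k] in \<open>auto simp: vac_block_def\<close>)
  then show ?thesis by (simp add: joint_state_eq rho_smult)
qed

lemma P_zero [simp]: "P (0\<^sub>m (tdim k) (tdim k)) = 0"
  using P_smult[of "0\<^sub>m (tdim k) (tdim k)" 0] by simp

lemma P_sys:
  assumes "X \<in> carrier_mat 2 2"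
  shows "P (sys k X) = \<rho> X"
proof -
  have "vac_block k (sys k X) = X"
    by (rule eq_matI)
      (use assms vac_pos[of _ k] in \<open>auto simp: vac_block_def sys_def kron_index tdim_def simp del: One_nat_def\<close>)
  then show ?thesis by (simp add: joint_state_eq)
qed

lemma P_compress: "B \<in> MM \<Longrightarrow> P (vac * (B * vac)) = P B"
  by (simp add: joint_state_eq vac_block_compress)

text \<open>\<open>P\<close> sees only the compression by \<open>vac\<close>, so a factor at the far
  right may be exchanged for any operator with the same action on the vacuum;
  \<open>P_left_vac\<close> is the adjoint form.\<close>

lemma P_right_vac:
  assumes "B \<in> MM" "C \<in> MM" "D \<in> MM" "C * vac = D * vac"
  shows "P (B * C) = P (B * D)"
  using P_compress[of "B * C"] P_compress[of "B * D"] assms by (simp add: mult_assoc)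

lemma P_left_vac:
  assumes "B \<in> MM" "C \<in> MM" "D \<in> MM" "C * vac = D * vac"
  shows "P (mat_adjoint C * B) = P (mat_adjoint D * B)"
proof -
  have "vac * mat_adjoint C = vac * mat_adjoint D"
    using arg_cong[OF assms(4), of mat_adjoint] assms(1-3) by (simp add: adjoint_mult)
  then have "vac * (mat_adjoint C * B * vac) = vac * (mat_adjoint D * B * vac)"
    using assms by (simp flip: mult_assoc)
  then show ?thesis
    using P_compress[of "mat_adjoint C * B"] P_compress[of "mat_adjoint D * B"] assms by simp
qed

end

section \<open>Algebras generated by commuting projections\<close>

text \<open>
  The algebra generated by commuting projections \<open>z 1, \<dots>, z l\<close> consists of functions of
  their joint values. These are encoded in the binary digits of \<open>m < 2\<^sup>l\<close>, with the value of
  \<open>z l\<close> in the lowest digit; \<open>el n z l f\<close> is the element with value \<open>f m\<close> at \<open>m\<close>.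
\<close>

primrec el :: "nat \<Rightarrow> (nat \<Rightarrow> complex mat) \<Rightarrow> nat \<Rightarrow> (nat \<Rightarrow> complex) \<Rightarrow> complex mat" where
  "el n z 0 f = f 0 \<cdot>\<^sub>m 1\<^sub>m n"
| "el n z (Suc l) f =
     el n z l (\<lambda>m. f (2 * m + 1)) * z (Suc l) + el n z l (\<lambda>m. f (2 * m)) * (1\<^sub>m n - z (Suc l))"

lemma el_cong:
  assumes "\<And>i. i \<in> {1..l} \<Longrightarrow> z i = z' i" "\<And>m. m < 2 ^ l \<Longrightarrow> f m = g m"
  shows "el n z l f = el n z' l g"
  using assms
proof (induction l arbitrary: f g)
  case 0
  then show ?case by simp
next
  case (Suc l)
  have "el n z l (\<lambda>m. f (2 * m + 1)) = el n z' l (\<lambda>m. g (2 * m + 1))"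
    "el n z l (\<lambda>m. f (2 * m)) = el n z' l (\<lambda>m. g (2 * m))"
    by (intro Suc.IH Suc.prems; auto)+
  then show ?case using Suc.prems(1)[of "Suc l"] by simp
qed

context square_mats
begin

lemma left_commute:
  assumes "A \<in> MM" "B \<in> MM" "C \<in> MM" "A * B = B * A"
  shows "A * (B * C) = B * (A * C)"
proof -
  have "A * (B * C) = A * B * C" by (intro mult_assoc[symmetric] assms)
  also have "\<dots> = B * (A * C)" unfolding assms(4) by (intro mult_assoc assms)
  finally show ?thesis .
qed

definition proj_pair :: "complex mat \<Rightarrow> complex mat \<Rightarrow> bool" where
  "proj_pair p q \<longleftrightarrow> p \<in> MM \<and> q \<in> MM \<and> p * p = p \<and> q * q = q \<and> p * q = 0\<^sub>m n n \<and> q * p = 0\<^sub>m n n"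

text \<open>Moving \<open>B\<close> and \<open>B'\<close> to the left of the projections leaves
  cross terms containing \<open>p * q\<close> or \<open>q * p\<close>, which are zero:
  multiplication is blockwise.\<close>

lemma proj_pair_mult:
  assumes "proj_pair p q" "A \<in> MM" "A' \<in> MM" "B \<in> MM" "B' \<in> MM"
    and comm: "p * B = B * p" "q * B = B * q" "p * B' = B' * p" "q * B' = B' * q"
  shows "(A * p + A' * q) * (B * p + B' * q) = A * B * p + A' * B' * q"
proof -
  have pq: "p \<in> MM" "q \<in> MM" "p * p = p" "q * q = q" "p * q = 0\<^sub>m n n" "q * p = 0\<^sub>m n n"
    using assms(1) by (auto simp: proj_pair_def)
  note lc = left_commute[OF pq(1) assms(4) _ comm(1)] left_commute[OF pq(2) assms(4) _ comm(2)]
    left_commute[OF pq(1) assms(5) _ comm(3)] left_commute[OF pq(2) assms(5) _ comm(4)]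
  show ?thesis using assms(2-5) pq by (simp add: mat_ring lc)
qed

lemma proj_pair_complement:
  assumes "p \<in> MM" "p * p = p"
  shows "proj_pair p (1\<^sub>m n - p)"
proof -
  have "p - p = 0\<^sub>m n n" using assms by auto
  moreover have "1\<^sub>m n - p - 0\<^sub>m n n = 1\<^sub>m n - p" using assms by auto
  ultimately show ?thesis using assms by (auto simp: proj_pair_def mat_ring)
qed

lemma complement_commute:
  "p \<in> MM \<Longrightarrow> B \<in> MM \<Longrightarrow> p * B = B * p \<Longrightarrow> (1\<^sub>m n - p) * B = B * (1\<^sub>m n - p)"
  by (simp add: mat_ring)

lemma split_complement: "p \<in> MM \<Longrightarrow> A \<in> MM \<Longrightarrow> A * p + A * (1\<^sub>m n - p) = A"
  by (rule eq_matI) (auto simp: mat_ring)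

lemma el_conj:
  assumes W: "unitary W" and z: "\<And>i. i \<in> {1..l} \<Longrightarrow> z i \<in> MM"
  shows "el n z l f \<in> MM \<and> el n (\<lambda>i. W * z i * mat_adjoint W) l f = W * el n z l f * mat_adjoint W"
  using z
proof (induction l arbitrary: f)
  case 0
  then show ?case using unitaryD[OF W] by (simp add: mat_ring)
next
  case (Suc l)
  have z: "z (Suc l) \<in> MM" and IH: "el n z l f \<in> MM"
    "el n (\<lambda>i. W * z i * mat_adjoint W) l f = W * el n z l f * mat_adjoint W" for f
    using Suc by auto
  show ?case
    using z IH unitaryD[OF W] by (simp add: mat_ring)
qed

end

text \<open>Common frame for \<open>dLam\<close>, \<open>dZ\<close> and \<open>dY\<close>, which up
  to time \<open>k\<close> are unitary conjugates of one another.\<close>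

locale commuting_projs = square_mats n for n :: nat +
  fixes z :: "nat \<Rightarrow> complex mat" and K :: nat
  assumes z_closed: "i \<in> {1..K} \<Longrightarrow> z i \<in> MM"
    and z_idem: "i \<in> {1..K} \<Longrightarrow> z i * z i = z i"
    and z_adjoint: "i \<in> {1..K} \<Longrightarrow> mat_adjoint (z i) = z i"
    and z_commute: "i \<in> {1..K} \<Longrightarrow> j \<in> {1..K} \<Longrightarrow> z i * z j = z j * z i"
begin

abbreviation E :: "nat \<Rightarrow> (nat \<Rightarrow> complex) \<Rightarrow> complex mat" where "E \<equiv> el n z"

lemma E_closed [simp]: "l \<le> K \<Longrightarrow> E l f \<in> MM"
  using el_conj[OF unitary_one, of l z f] z_closed by auto

lemma z_Suc:
  assumes "Suc l \<le> K"
  shows "z (Suc l) \<in> MM" "proj_pair (z (Suc l)) (1\<^sub>m n - z (Suc l))"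
    "mat_adjoint (z (Suc l)) = z (Suc l)"
  using assms z_closed z_idem z_adjoint by (auto intro!: proj_pair_complement)

lemma E_commute:
  assumes "l \<le> K" "B \<in> MM" "\<And>i. i \<in> {1..l} \<Longrightarrow> z i * B = B * z i"
  shows "E l f * B = B * E l f"
  using assms
proof (induction l arbitrary: f)
  case 0
  then show ?case by (simp add: mat_ring)
next
  case (Suc l)
  have IH: "E l f * B = B * E l f" for f using Suc by auto
  have z: "z (Suc l) \<in> MM" "z (Suc l) * B = B * z (Suc l)" using Suc.prems z_Suc by auto
  have "E l f * z (Suc l) * B = B * (E l f * z (Suc l))"
    "E l f * (1\<^sub>m n - z (Suc l)) * B = B * (E l f * (1\<^sub>m n - z (Suc l)))" for f
    using z Suc.prems IH by (intro commute_mult complement_commute; simp)+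
  then show ?case using z Suc.prems by (simp add: distribs)
qed

lemma E_z_commute: "Suc l \<le> K \<Longrightarrow> z (Suc l) * E l f = E l f * z (Suc l)"
  using E_commute[of l "z (Suc l)" f] z_closed z_commute by auto

lemma E_zc_commute: "Suc l \<le> K \<Longrightarrow> (1\<^sub>m n - z (Suc l)) * E l f = E l f * (1\<^sub>m n - z (Suc l))"
  by (intro complement_commute E_z_commute) (auto simp: z_Suc)

lemma E_mult: "l \<le> K \<Longrightarrow> E l (\<lambda>m. f m * g m) = E l f * E l g"
proof (induction l arbitrary: f g)
  case 0
  then show ?case by (simp add: mat_ring mult.commute)
next
  case (Suc l)
  have IH: "E l (\<lambda>m. f m * g m) = E l f * E l g" for f g using Suc by auto
  show ?case
    using Suc.prems z_Suc[of l]
    by (simp add: IH proj_pair_mult E_z_commute E_zc_commute del: mult_Suc mult_Suc_right)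
qed

lemma E_add: "l \<le> K \<Longrightarrow> E l (\<lambda>m. f m + g m) = E l f + E l g"
proof (induction l arbitrary: f g)
  case 0
  then show ?case by (auto intro!: eq_matI simp: algebra_simps)
next
  case (Suc l)
  have IH: "E l (\<lambda>m. f m + g m) = E l f + E l g" for f g using Suc by auto
  have *: "(a + b) * p + (c + d) * q = a * p + c * q + (b * p + d * q)"
    if "a \<in> MM" "b \<in> MM" "c \<in> MM" "d \<in> MM" "p \<in> MM" "q \<in> MM" for a b c d p q
    using that by (intro eq_matI) (auto simp: distribs)
  show ?case
    using Suc.prems z_Suc[of l] by (simp add: IH *)
qed

lemma E_smult: "l \<le> K \<Longrightarrow> E l (\<lambda>m. c * f m) = c \<cdot>\<^sub>m E l f"
proof (induction l arbitrary: f)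
  case 0
  then show ?case by (simp add: mat_ring)
next
  case (Suc l)
  have IH: "E l (\<lambda>m. c * f m) = c \<cdot>\<^sub>m E l f" for f using Suc by auto
  show ?case using Suc.prems z_Suc[of l] by (simp add: IH distribs smult_distribs)
qed

lemma E_const: "l \<le> K \<Longrightarrow> E l (\<lambda>m. c) = c \<cdot>\<^sub>m 1\<^sub>m n"
proof (induction l)
  case (Suc l)
  then show ?case using z_Suc[of l] by (simp add: split_complement)
qed simp

lemma E_adjoint: "l \<le> K \<Longrightarrow> mat_adjoint (E l f) = E l (\<lambda>m. cnj (f m))"
proof (induction l arbitrary: f)
  case 0
  then show ?case by (simp add: adjoint_smult)
next
  case (Suc l)
  have IH: "mat_adjoint (E l f) = E l (\<lambda>m. cnj (f m))" for f using Suc by auto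
  show ?case
    using Suc.prems z_Suc[of l]
    by (simp add: adjoint_simps IH E_z_commute E_zc_commute)
qed

text \<open>\<open>m div 2\<close> forgets the newest outcome, the lowest digit; so the algebra at
  time \<open>l\<close> embeds into the next one.\<close>

lemma E_lift: "Suc l \<le> K \<Longrightarrow> E (Suc l) (\<lambda>m. f (m div 2)) = E l f"
  using z_Suc[of l] by (simp add: split_complement)

lemma E_last: "Suc l \<le> K \<Longrightarrow> E (Suc l) (\<lambda>m. of_bool (odd m)) = z (Suc l)"
  using z_Suc[of l] E_const[of l] by simp

lemma in_range: "A = E l f \<Longrightarrow> A \<in> range (E l)"
  by auto

lemma z_in_range: "i \<in> {1..l} \<Longrightarrow> l \<le> K \<Longrightarrow> z i \<in> range (E l)"
proof (induction l)
  case (Suc l)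
  show ?case
  proof (cases "i = Suc l")
    case True
    then show ?thesis using in_range[OF E_last[symmetric]] Suc.prems by blast
  next
    case False
    then have "z i \<in> range (E l)" using Suc by auto
    then show ?thesis using in_range[OF E_lift[symmetric]] Suc.prems by auto
  qed
qed simp

lemma star_algebra_mono: "S \<subseteq> S' \<Longrightarrow> A \<in> star_algebra n S \<Longrightarrow> A \<in> star_algebra n S'"
  by (rotate_tac, induction rule: star_algebra.induct) (auto intro: star_algebra.intros)

text \<open>Functions of the joint values include the generators and are closed under the
  operations; conversely the recursion of \<open>el\<close> writes each of them as a polynomial in
  the projections.\<close>

lemma star_algebra_eq:
  assumes "l \<le> K"
  shows "star_algebra n (z ` {1..l}) = range (E l)"
proof
  show "star_algebra n (z ` {1..l}) \<subseteq> range (E l)"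
  proof
    fix A assume "A \<in> star_algebra n (z ` {1..l})"
    then show "A \<in> range (E l)"
    proof induction
      case one
      then show ?case using in_range[OF E_const[OF assms, of 1, symmetric]] by simp
    next
      case (gen A)
      then show ?case using z_in_range assms by auto
    next
      case (add A B)
      then show ?case by (auto simp flip: E_add[OF assms])
    next
      case (scale A c)
      then show ?case by (auto simp flip: E_smult[OF assms])
    next
      case (mult A B)
      then show ?case by (auto simp flip: E_mult[OF assms])
    next
      case (adjoint A)
      then show ?case by (auto simp: E_adjoint[OF assms])
    qed
  qed
  have "E l f \<in> star_algebra n (z ` {1..l})" for f
    using assms
  proof (induction l arbitrary: f)
    case 0
    then show ?case by (auto intro: star_algebra.intros)
  next
    case (Suc l)
    have IH: "E l f \<in> star_algebra n (z ` {1..Suc l})" for f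
      using star_algebra_mono[OF _ Suc.IH, of "z ` {1..Suc l}"] Suc.prems by force
    have z: "z (Suc l) \<in> star_algebra n (z ` {1..Suc l})" by (intro star_algebra.gen) auto
    have "1\<^sub>m n - z (Suc l) = 1\<^sub>m n + (-1) \<cdot>\<^sub>m z (Suc l)"
      using z_Suc[OF Suc.prems] by (intro eq_matI) auto
    then have "1\<^sub>m n - z (Suc l) \<in> star_algebra n (z ` {1..Suc l})"
      using z by (auto intro: star_algebra.intros)
    then show ?case using IH z by (auto intro!: star_algebra.add star_algebra.mult)
  qed
  then show "range (E l) \<subseteq> star_algebra n (z ` {1..l})" by auto
qed

text \<open>Injectivity says that all \<open>2 ^ l\<close> joint outcomes really occur, so that the
  spectrum is the full set of outcome sequences.\<close>

lemma function_rep_E: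
  assumes l: "l \<le> K" and inj: "\<And>f g m. E l f = E l g \<Longrightarrow> m < 2 ^ l \<Longrightarrow> f m = g m"
  obtains \<iota> where "function_rep (range (E l)) {..<2 ^ l} \<iota>" "\<And>f m. m < 2 ^ l \<Longrightarrow> \<iota> (E l f) m = f m"
proof
  \<comment> \<open>\<open>SOME\<close> picks the function behind \<open>A\<close>, unique below
    \<open>2 ^ l\<close> by \<open>inj\<close>; \<open>restrict\<close> makes it extensional, as the
    target set demands.\<close>
  define \<iota> where "\<iota> A = restrict (SOME f. E l f = A) {..<2 ^ l}" for A
  show \<iota>: "\<iota> (E l f) m = f m" if "m < 2 ^ l" for f m
  proof -
    have "E l (SOME g. E l g = E l f) = E l f" by (rule someI[of "\<lambda>g. E l g = E l f" f]) (rule refl)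
    then show ?thesis using inj that by (auto simp: \<iota>_def)
  qed
  have "bij_betw \<iota> (range (E l)) ({..<2 ^ l} \<rightarrow>\<^sub>E UNIV)"
  proof (rule bij_betw_imageI)
    show "inj_on \<iota> (range (E l))"
      using \<iota> by (intro inj_onI) (auto intro!: el_cong, metis)
    have "f \<in> \<iota> ` range (E l)" if "f \<in> {..<2 ^ l} \<rightarrow>\<^sub>E UNIV" for f
    proof -
      have "\<iota> (E l f) = f"
      proof
        fix m show "\<iota> (E l f) m = f m"
          using \<iota>[of m f] that by (cases "m < 2 ^ l") (auto simp: \<iota>_def PiE_def extensional_def)
      qed
      then show ?thesis by (metis rangeI imageI)
    qed
    moreover have "\<iota> A \<in> {..<2 ^ l} \<rightarrow>\<^sub>E UNIV" for A by (auto simp: \<iota>_def)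
    ultimately show "\<iota> ` range (E l) = {..<2 ^ l} \<rightarrow>\<^sub>E UNIV" by blast
  qed
  then show "function_rep (range (E l)) {..<2 ^ l} \<iota>"
    by (auto simp: function_rep_def \<iota> E_adjoint[OF l] simp flip: E_add[OF l] E_mult[OF l] E_smult[OF l])
qed

end

section \<open>Rules for commutation and unitary conjugation\<close>

context square_mats
begin

lemma commute_add:
  assumes "A \<in> MM" "B \<in> MM" "C \<in> MM" "A * C = C * A" "B * C = C * B"
  shows "(A + B) * C = C * (A + B)"
  using assms by (simp add: distribs)

lemma commute_minus:
  assumes "A \<in> MM" "B \<in> MM" "C \<in> MM" "A * C = C * A" "B * C = C * B"
  shows "(A - B) * C = C * (A - B)"
  using assms by (simp add: distribs)

lemma commute_smult:
  assumes "A \<in> MM" "C \<in> MM" "A * C = C * A"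
  shows "(c \<cdot>\<^sub>m A) * C = C * (c \<cdot>\<^sub>m A)"
  using assms by (simp add: distribs)

lemma commute_one: "C \<in> MM \<Longrightarrow> 1\<^sub>m n * C = C * 1\<^sub>m n"
  by simp

lemma conj_invariant:
  assumes "unitary W" "B \<in> MM" "W * B = B * W"
  shows "W * B * mat_adjoint W = B" "mat_adjoint W * B * W = B"
proof -
  note W = unitaryD[OF assms(1)]
  show "W * B * mat_adjoint W = B"
    unfolding assms(3) using W(1,3) assms(2) by (simp add: mult_assoc)
  have "mat_adjoint W * B * W = mat_adjoint W * (B * W)" using W(1) assms(2) by (simp add: mult_assoc)
  also have "\<dots> = B" unfolding assms(3)[symmetric] using W assms(2) by simp
  finally show "mat_adjoint W * B * W = B" .
qed

end

lemma (in commuting_projs) commuting_projs_conj: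
  assumes W: "unitary W"
  shows "commuting_projs n (\<lambda>i. W * z i * mat_adjoint W) K"
proof -
  note u = unitaryD[OF W]
  show ?thesis
  proof
    fix i j assume ij: "i \<in> {1..K}" "j \<in> {1..K}"
    show "W * z i * mat_adjoint W * (W * z j * mat_adjoint W) = W * z j * mat_adjoint W * (W * z i * mat_adjoint W)"
      using u(1-4) z_closed[OF ij(1)] z_closed[OF ij(2)] z_commute[OF ij]
      by (simp add: mult_assoc left_commute[of "z i" "z j"])
  next
    fix i assume i: "i \<in> {1..K}"
    have "z i * (z i * A) = z i * A" if "A \<in> MM" for A
      using z_closed[OF i] z_idem[OF i] that by (simp flip: mult_assoc)
    then show "W * z i * mat_adjoint W * (W * z i * mat_adjoint W) = W * z i * mat_adjoint W"
      using u(1-4) z_closed[OF i] by (simp add: mult_assoc)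
    show "mat_adjoint (W * z i * mat_adjoint W) = W * z i * mat_adjoint W"
      using u(1) z_closed[OF i] z_adjoint[OF i] by (simp add: adjoint_mult mult_assoc)
    show "W * z i * mat_adjoint W \<in> MM" using u(1) z_closed[OF i] by simp
  qed
qed

lemma commuting_projs_cong:
  assumes "commuting_projs n z K" "\<And>i. i \<in> {1..K} \<Longrightarrow> z i = z' i"
  shows "commuting_projs n z' K"
  using assms unfolding commuting_projs_def by auto

section \<open>Locality\<close>

context fock
begin

text \<open>Adapted operators, acting on the system and the first \<open>l\<close> field factors.
  Encoding them as a commutant gives closure under products and adjoints without a tensor
  decomposition.\<close>

definition local_ops :: "nat \<Rightarrow> complex mat set" where
  "local_ops l = {A \<in> MM. \<forall>j \<in> {l<..k}. \<forall>Y \<in> carrier_mat 2 2. A * fld k j Y = fld k j Y * A}"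

lemma local_closed [simp]: "A \<in> local_ops l \<Longrightarrow> A \<in> MM"
  by (simp add: local_ops_def)

lemma local_opsI:
  assumes "A \<in> MM"
    "\<And>j Y. l < j \<Longrightarrow> j \<le> k \<Longrightarrow> Y \<in> carrier_mat 2 2 \<Longrightarrow> A * fld k j Y = fld k j Y * A"
  shows "A \<in> local_ops l"
  unfolding local_ops_def by (intro CollectI conjI ballI assms) simp_all

lemma local_commute:
  "A \<in> local_ops l \<Longrightarrow> l < j \<Longrightarrow> j \<le> k \<Longrightarrow> Y \<in> carrier_mat 2 2 \<Longrightarrow> A * fld k j Y = fld k j Y * A"
  unfolding local_ops_def mem_Collect_eq by (metis greaterThanAtMost_iff)

lemma local_mono:
  assumes "A \<in> local_ops l" "l \<le> l'"
  shows "A \<in> local_ops l'"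
  using assms(2) by (intro local_opsI local_commute[OF assms(1)] local_closed[OF assms(1)]) auto

lemma local_intros [intro]:
  "A \<in> local_ops l \<Longrightarrow> B \<in> local_ops l \<Longrightarrow> A * B \<in> local_ops l"
  "A \<in> local_ops l \<Longrightarrow> B \<in> local_ops l \<Longrightarrow> A + B \<in> local_ops l"
  "A \<in> local_ops l \<Longrightarrow> B \<in> local_ops l \<Longrightarrow> A - B \<in> local_ops l"
  "A \<in> local_ops l \<Longrightarrow> c \<cdot>\<^sub>m A \<in> local_ops l"
  "1\<^sub>m (tdim k) \<in> local_ops l"
  by (rule local_opsI, simp,
      ((rule commute_mult commute_add commute_minus commute_smult commute_one)?;
        ((erule local_commute; assumption) | simp)))+

lemma local_adjoint [intro]:
  assumes "A \<in> local_ops l"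
  shows "mat_adjoint A \<in> local_ops l"
proof -
  have "mat_adjoint A * fld k j Y = fld k j Y * mat_adjoint A"
    if "l < j" "j \<le> k" "Y \<in> carrier_mat 2 2" for j Y
    using that assms local_commute[OF assms that(1,2), of "mat_adjoint Y"]
    by (intro commute_adjoint) (auto simp: fld_adjoint)
  then show ?thesis using assms by (intro local_opsI) auto
qed

lemma local_sys [intro]: "X \<in> carrier_mat 2 2 \<Longrightarrow> sys k X \<in> local_ops l"
  by (intro local_opsI sys_fld_commute) auto

lemma local_fld [intro]: "Y \<in> carrier_mat 2 2 \<Longrightarrow> i \<le> l \<Longrightarrow> l \<le> k \<Longrightarrow> fld k i Y \<in> local_ops l"
  by (intro local_opsI fld_fld_commute) auto

lemma local_el:
  assumes "\<And>i. i \<in> {1..l} \<Longrightarrow> z i \<in> local_ops l'"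
  shows "el (tdim k) z l f \<in> local_ops l'"
  using assms by (induction l arbitrary: f) (auto intro!: local_intros)

text \<open>Modulo operators annihilating the vacuum, a one-particle operator is determined by its
  column at the vacuum vector.\<close>

lemma fld_vac:
  assumes i: "i \<in> {1..k}" and Y: "Y \<in> carrier_mat 2 2"
  shows "fld k i Y * vac = Y $$ (1, 1) \<cdot>\<^sub>m vac + Y $$ (0, 1) \<cdot>\<^sub>m (fld k i sigma_plus * vac)"
proof -
  have ik: "i \<le> k" using i by simp
  have zero: "fld k i sigma_minus * vac = 0\<^sub>m (tdim k) (tdim k)" by (rule vac_fld[OF i])
  have eq: "fld k i Y = Y $$ (1, 1) \<cdot>\<^sub>m 1\<^sub>m (tdim k) + Y $$ (0, 1) \<cdot>\<^sub>m fld k i sigma_plus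
    + Y $$ (1, 0) \<cdot>\<^sub>m fld k i sigma_minus
    + (Y $$ (0, 0) - Y $$ (1, 1)) \<cdot>\<^sub>m (fld k i sigma_plus * fld k i sigma_minus)"
    by (subst mat2_vacuum_expansion[OF Y]) (simp add: fld_add fld_smult fld_mult fld_one[OF ik])
  show ?thesis unfolding eq using ik zero by (simp add: mat_ring)
qed

text \<open>An operator of the past commutes with the next field factor, which is therefore still in
  the vacuum when \<open>fld\<close> acts on it.\<close>

lemma local_fld_vac:
  assumes W: "W \<in> local_ops l" and l: "Suc l \<le> k" and Y: "Y \<in> carrier_mat 2 2"
  shows "fld k (Suc l) Y * (W * vac) =
    Y $$ (1, 1) \<cdot>\<^sub>m (W * vac) + Y $$ (0, 1) \<cdot>\<^sub>m (fld k (Suc l) sigma_plus * (W * vac))"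
proof -
  have comm: "fld k (Suc l) Z * (W * vac) = W * (fld k (Suc l) Z * vac)" if "Z \<in> carrier_mat 2 2" for Z
    using W l that local_commute[OF W _ l, of Z] by (intro left_commute) auto
  show ?thesis
    using W l Y fld_vac[of "Suc l" Y] by (simp add: comm distribs)
qed

end

text \<open>Independence of the past and the next field factor, whose vacuum expectation is the
  entry of \<open>Y\<close> at \<open>(1, 1)\<close>.\<close>

lemma (in fock_state) P_local_fld:
  assumes B: "B \<in> local_ops l" and l: "Suc l \<le> k" and Y: "Y \<in> carrier_mat 2 2"
  shows "P (B * fld k (Suc l) Y) = Y $$ (1, 1) * P B"
proof -
  let ?a = "fld k (Suc l)"
  have "P (B * ?a Y) = P (B * (Y $$ (1, 1) \<cdot>\<^sub>m 1\<^sub>m (tdim k) + Y $$ (0, 1) \<cdot>\<^sub>m ?a sigma_plus))"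
    using B l Y fld_vac[of "Suc l" Y] by (intro P_right_vac) (auto simp: distribs)
  also have "\<dots> = Y $$ (1, 1) * P B + Y $$ (0, 1) * P (B * ?a sigma_plus)"
    using B l by (simp add: distribs P_add P_smult)
  \<comment> \<open>Moved to the front, \<open>sigma_plus\<close> is the adjoint of
    \<open>sigma_minus\<close>; as \<open>sigma_minus\<close> kills the vacuum,
    \<open>P_left_vac\<close> then replaces it by zero.\<close>
  also have "P (B * ?a sigma_plus) = P (mat_adjoint (?a sigma_minus) * B)"
    using local_commute[OF B _ l, of sigma_plus] by (simp flip: fld_adjoint)
  also have "\<dots> = P (mat_adjoint (0\<^sub>m (tdim k) (tdim k)) * B)"
    using B l by (intro P_left_vac) (auto simp: vac_fld)
  also have "\<dots> = 0" using B by simp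
  finally show ?thesis by simp
qed

section \<open>The rotation\<close>

text \<open>The exponential of \<open>h\<close> times \<open>sigma_minus - sigma_plus\<close>, a
  real rotation.\<close>

definition rot2 :: "real \<Rightarrow> complex mat" where
  "rot2 h = complex_of_real (cos h) \<cdot>\<^sub>m 1\<^sub>m 2 + complex_of_real (sin h) \<cdot>\<^sub>m (sigma_minus - sigma_plus)"

lemma rot2_closed [simp]: "rot2 h \<in> carrier_mat 2 2"
  by (simp add: rot2_def)

lemma minus2_index: "A \<in> carrier_mat 2 2 \<Longrightarrow> B \<in> carrier_mat 2 2 \<Longrightarrow> i < 2 \<Longrightarrow> j < 2 \<Longrightarrow>
    (A - B :: complex mat) $$ (i, j) = A $$ (i, j) - B $$ (i, j)"
  by auto

lemma adjoint2_index: "A \<in> carrier_mat 2 2 \<Longrightarrow> i < 2 \<Longrightarrow> j < 2 \<Longrightarrow>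
    mat_adjoint A $$ (i, j) = cnj (A $$ (j, i))"
  by auto

lemmas index2 = two.add_index two.smult_index mult2_index minus2_index adjoint2_index

lemma rot2_index [simp]:
  "rot2 h $$ (0, 0) = cos (complex_of_real h)" "rot2 h $$ (0, Suc 0) = - sin (complex_of_real h)"
  "rot2 h $$ (Suc 0, 0) = sin (complex_of_real h)" "rot2 h $$ (Suc 0, Suc 0) = cos (complex_of_real h)"
  by (simp_all add: rot2_def index2 cos_of_real sin_of_real del: index_smult_mat(1) index_add_mat(1) index_minus_mat(1))

lemma cnj_trig [simp]:
  "cnj (cos (complex_of_real x)) = cos (complex_of_real x)"
  "cnj (sin (complex_of_real x)) = sin (complex_of_real x)"
  by (simp_all only: cos_of_real sin_of_real complex_cnj_complex_of_real)

lemma rot2_unitary: "two.unitary (rot2 h)"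
proof -
  have "mat_adjoint (rot2 h) * rot2 h = 1\<^sub>m 2" "rot2 h * mat_adjoint (rot2 h) = 1\<^sub>m 2"
    by (rule mat2_eqI; simp add: index2 sin_squared_eq algebra_simps flip: power2_eq_square del: index_mult_mat(1))+
  then show ?thesis by (simp add: two.unitary_def)
qed

definition rot_proj2 :: "real \<Rightarrow> complex mat" where
  "rot_proj2 h = rot2 h * (sigma_plus * sigma_minus) * mat_adjoint (rot2 h)"

lemma rot_proj2_closed [simp]: "rot_proj2 h \<in> carrier_mat 2 2"
  by (auto simp: rot_proj2_def)

text \<open>The vacuum column of the rotated projection: its diagonal entry becomes the probability
  of outcome 1, the other one the amplitude of the excitation.\<close>

lemma rot_proj2_index:
  "rot_proj2 h $$ (0, 1) = complex_of_real (cos h * sin h)"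
  "rot_proj2 h $$ (1, 1) = complex_of_real ((sin h)\<^sup>2)"
  by (simp_all add: rot_proj2_def index2 sin_of_real cos_of_real power2_eq_square del: index_mult_mat(1) flip: cos_of_real sin_of_real)

context fock
begin

lemma dLam_closed [simp]: "i \<le> k \<Longrightarrow> dLam k i \<in> MM"
  by (simp add: dLam_def)

abbreviation rot :: "real \<Rightarrow> nat \<Rightarrow> complex mat" where
  "rot h i \<equiv> fld k i (rot2 h)"

lemma unitary_fld: "i \<le> k \<Longrightarrow> two.unitary Y \<Longrightarrow> unitary (fld k i Y)"
  unfolding unitary_def two.unitary_def
  by (simp add: fld_one flip: fld_adjoint fld_mult)

lemma rot_exp:
  assumes "i \<le> k"
  shows "mat_exp (dA k h i - dAs k h i) = rot h i"
proof -
  let ?J = "sigma_minus - sigma_plus"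
  have J: "?J * ?J = (-1) \<cdot>\<^sub>m 1\<^sub>m 2"
    by (rule mat2_eqI) (auto simp: index2 simp del: index_mult_mat(1) index_minus_mat(1))
  have "?J = sigma_minus + (-1) \<cdot>\<^sub>m sigma_plus"
    by (rule mat2_eqI) (auto simp: index2 simp del: index_add_mat(1) index_minus_mat(1) index_smult_mat(1))
  then have "fld k i ?J = fld k i sigma_minus + (-1) \<cdot>\<^sub>m fld k i sigma_plus"
    by (simp add: fld_add fld_smult)
  moreover have diff: "c \<cdot>\<^sub>m A - c \<cdot>\<^sub>m B = c \<cdot>\<^sub>m (A + (-1) \<cdot>\<^sub>m B)" if "A \<in> MM" "B \<in> MM" for A B :: "complex mat" and c
    using that by (intro eq_matI) (auto simp: algebra_simps)
  ultimately have "dA k h i - dAs k h i = complex_of_real h \<cdot>\<^sub>m fld k i ?J"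
    using assms by (simp add: dA_def dAs_def diff)
  moreover have "fld k i ?J * fld k i ?J = (-1) \<cdot>\<^sub>m 1\<^sub>m (tdim k)"
    using assms by (simp add: J fld_smult fld_one flip: fld_mult)
  ultimately show ?thesis
    using assms by (simp add: exp_complex_structure rot2_def fld_add fld_smult fld_one)
qed

lemma mat_sum_local:
  assumes "\<And>i. i \<in> {1..l} \<Longrightarrow> f i \<in> local_ops l'"
  shows "mat_sum (tdim k) f l \<in> local_ops l'"
  using assms
proof (induction l)
  case 0
  have "0\<^sub>m (tdim k) (tdim k) = 0 \<cdot>\<^sub>m (1\<^sub>m (tdim k) :: complex mat)" by simp
  then show ?case by (metis local_intros(4,5) mat_sum.simps(1))
qed auto

lemma R_0: "R k h 0 = 1\<^sub>m (tdim k)"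
proof -
  have "0\<^sub>m (tdim k) (tdim k) - 0\<^sub>m (tdim k) (tdim k) = (0\<^sub>m (tdim k) (tdim k) :: complex mat)" by auto
  then show ?thesis unfolding R_def mat_sum.simps by (simp only: mat_exp_zero)
qed

text \<open>The exponent up to \<open>l\<close> is local, hence commutes with the next increment,
  and the exponential factorises.\<close>

lemma R_Suc:
  assumes l: "Suc l \<le> k"
  shows "R k h (Suc l) = R k h l * rot h (Suc l)"
proof -
  let ?S = "\<lambda>l. mat_sum (tdim k) (dA k h) l - mat_sum (tdim k) (dAs k h) l"
  have S1: "mat_sum (tdim k) (dA k h) l \<in> local_ops l" and S2: "mat_sum (tdim k) (dAs k h) l \<in> local_ops l"
    unfolding dA_def dAs_def using l by (intro mat_sum_local local_intros(4) local_fld; simp)+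
  have d: "dA k h (Suc l) \<in> MM" "dAs k h (Suc l) \<in> MM" using l by (auto simp: dA_def dAs_def)
  have S: "?S l \<in> local_ops l" using S1 S2 by auto
  have "?S (Suc l) = ?S l + (dA k h (Suc l) - dAs k h (Suc l))"
    using local_closed[OF S1] local_closed[OF S2] d by (intro eq_matI) auto
  moreover have "?S l * (dA k h (Suc l) - dAs k h (Suc l)) = (dA k h (Suc l) - dAs k h (Suc l)) * ?S l"
  proof -
    have comm: "fld k (Suc l) Y * ?S l = ?S l * fld k (Suc l) Y" if "Y \<in> carrier_mat 2 2" for Y
      using local_commute[OF S _ l that] by simp
    have "dA k h (Suc l) * ?S l = ?S l * dA k h (Suc l)"
      unfolding dA_def[of k h "Suc l"] by (intro commute_smult comm fld_closed l local_closed[OF S]) simp_all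
    moreover have "dAs k h (Suc l) * ?S l = ?S l * dAs k h (Suc l)"
      unfolding dAs_def[of k h "Suc l"] by (intro commute_smult comm fld_closed l local_closed[OF S]) simp_all
    ultimately show ?thesis
      by (rule commute_minus[OF d local_closed[OF S], symmetric])
  qed
  ultimately show ?thesis
    using l S d by (simp add: R_def exp_add rot_exp)
qed

lemma R_local: "l \<le> k \<Longrightarrow> R k h l \<in> local_ops l"
proof (induction l)
  case 0
  then show ?case by (auto simp: R_0)
next
  case (Suc l)
  then have "R k h l \<in> local_ops (Suc l)" by (auto intro: local_mono)
  then show ?case
    unfolding R_Suc[OF Suc.prems] using Suc.prems by (intro local_intros(1) local_fld) auto
qed

lemma R_closed [simp]: "l \<le> k \<Longrightarrow> R k h l \<in> MM"
  using R_local local_closed by blast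

lemma R_unitary: "l \<le> k \<Longrightarrow> unitary (R k h l)"
proof (induction l)
  case 0
  then show ?case by (simp add: R_0 unitary_one)
next
  case (Suc l)
  then show ?case by (simp add: R_Suc unitary_mult unitary_fld rot2_unitary)
qed

lemma R_sys_commute: "l \<le> k \<Longrightarrow> X \<in> carrier_mat 2 2 \<Longrightarrow> R k h l * sys k X = sys k X * R k h l"
proof (induction l)
  case 0
  then show ?case by (simp add: R_0)
next
  case (Suc l)
  then show ?case by (simp add: R_Suc commute_mult sys_fld_commute)
qed

text \<open>Rotations of earlier factors cancel in the conjugation, so \<open>dZ\<close> acts on a
  single factor.\<close>

lemma dZ_eq:
  assumes "i \<in> {1..k}"
  shows "dZ k h i = fld k i (rot_proj2 h)"
proof -
  obtain j where i: "i = Suc j" using assms by (cases i) auto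
  have j: "Suc j \<le> k" using assms i by simp
  have "dZ k h i = R k h j * fld k i (rot_proj2 h) * mat_adjoint (R k h j)"
    using j unfolding dZ_def dLam_def rot_proj2_def i R_Suc[OF j]
    by (simp add: adjoint_mult mult_assoc fld_mult fld_adjoint)
  also have "\<dots> = fld k i (rot_proj2 h)"
    using j local_commute[OF R_local, of j i "rot_proj2 h" h] i
    by (intro conj_invariant R_unitary) auto
  finally show ?thesis .
qed

text \<open>Rotations of factors after \<open>i\<close> cancel too; hence the same
  \<open>R k h l\<close> carries all \<open>dLam\<close> up to time \<open>l\<close> to the
  \<open>dZ\<close>.\<close>

lemma R_conj_dLam:
  assumes "i \<in> {1..l}" "l \<le> k"
  shows "R k h l * dLam k i * mat_adjoint (R k h l) = dZ k h i"
  using assms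
proof (induction l)
  case (Suc l)
  show ?case
  proof (cases "i = Suc l")
    case True
    then show ?thesis by (simp add: dZ_def)
  next
    case False
    then have il: "i \<in> {1..l}" using Suc.prems by auto
    have "rot h (Suc l) * dLam k i * mat_adjoint (rot h (Suc l)) = dLam k i"
      using il Suc.prems unfolding dLam_def
      by (intro conj_invariant unitary_fld rot2_unitary fld_fld_commute) auto
    then have "R k h (Suc l) * dLam k i * mat_adjoint (R k h (Suc l)) = R k h l * dLam k i * mat_adjoint (R k h l)"
      using il Suc.prems by (simp add: R_Suc adjoint_mult mult_assoc) (simp flip: mult_assoc)
    then show ?thesis using Suc il by simp
  qed
qed simp

sublocale Lam: commuting_projs "tdim k" "dLam k" k
proof -
  let ?p = "sigma_plus * sigma_minus"
  have p: "?p * ?p = ?p" "mat_adjoint ?p = ?p"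
    by (rule mat2_eqI; simp add: index2 del: index_mult_mat(1))+
  show "commuting_projs (tdim k) (dLam k) k"
  proof
    fix i j assume "i \<in> {1..k}" "j \<in> {1..k}"
    then show "dLam k i * dLam k j = dLam k j * dLam k i"
      by (cases "i = j") (auto simp: dLam_def intro!: fld_fld_commute)
  next
    fix i assume i: "i \<in> {1..k}"
    show "dLam k i * dLam k i = dLam k i" by (simp add: dLam_def p flip: fld_mult)
    show "mat_adjoint (dLam k i) = dLam k i" unfolding dLam_def fld_adjoint[symmetric] p ..
  qed simp
qed

lemma dZ_projs: "commuting_projs (tdim k) (dZ k h) k"
  by (rule commuting_projs_cong[OF Lam.commuting_projs_conj[OF R_unitary[of k h]]]) (auto simp: R_conj_dLam)

lemma el_dZ:
  assumes "l \<le> k"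
  shows "el (tdim k) (dZ k h) l f = R k h l * el (tdim k) (dLam k) l f * mat_adjoint (R k h l)"
proof -
  have "el (tdim k) (dZ k h) l f = el (tdim k) (\<lambda>i. R k h l * dLam k i * mat_adjoint (R k h l)) l f"
    using assms by (intro el_cong) (auto simp: R_conj_dLam)
  then show ?thesis using el_conj[OF R_unitary[OF assms, of h], of l "dLam k" f] assms by auto
qed

end

section \<open>The repeated interaction\<close>

locale repeated_interaction = fock_state +
  fixes h :: real and L1 L2 L3 Mpm Mp Mm Mo :: "complex mat"
  assumes sin_nz: "sin h \<noteq> 0" and cos_nz: "cos h \<noteq> 0"
    and L_closed: "L1 \<in> carrier_mat 2 2" "L2 \<in> carrier_mat 2 2" "L3 \<in> carrier_mat 2 2"
    and L_adjoint: "mat_adjoint L1 = L1" "mat_adjoint L3 = L3"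
    and M_closed [simp]: "Mpm \<in> carrier_mat 2 2" "Mp \<in> carrier_mat 2 2"
      "Mm \<in> carrier_mat 2 2" "Mo \<in> carrier_mat 2 2"
    and M_step_eq: "\<And>l. l \<in> {1..k} \<Longrightarrow> M_step k h L1 L2 L3 l - 1\<^sub>m (tdim k) =
      sys k Mpm * dLam k l + sys k Mp * dAs k h l + sys k Mm * dA k h l + sys k Mo * dt k h"
begin

lemma h_nz: "h \<noteq> 0"
  using sin_nz by auto

abbreviation M :: "nat \<Rightarrow> complex mat" where "M \<equiv> M_step k h L1 L2 L3"
abbreviation UU :: "nat \<Rightarrow> complex mat" where "UU \<equiv> U k h L1 L2 L3"
abbreviation VV :: "nat \<Rightarrow> complex mat" where "VV \<equiv> V k h Mp Mo"
abbreviation EL :: "nat \<Rightarrow> (nat \<Rightarrow> complex) \<Rightarrow> complex mat" where "EL \<equiv> el (tdim k) (dLam k)"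
abbreviation EZ :: "nat \<Rightarrow> (nat \<Rightarrow> complex) \<Rightarrow> complex mat" where "EZ \<equiv> el (tdim k) (dZ k h)"
abbreviation EY :: "nat \<Rightarrow> (nat \<Rightarrow> complex) \<Rightarrow> complex mat" where "EY \<equiv> el (tdim k) (dY k h L1 L2 L3)"

lemma dA_closed [simp]: "l \<le> k \<Longrightarrow> dA k h l \<in> MM" "l \<le> k \<Longrightarrow> dAs k h l \<in> MM" "dt k h \<in> MM"
  by (simp_all add: dA_def dAs_def dt_def)

text \<open>The exponent is \<open>-\<i>\<close> times a self-adjoint matrix: the \<open>L1\<close>
  and \<open>L3\<close> terms are self-adjoint because system and field commute, and the two
  \<open>L2\<close> terms are adjoint to each other.\<close>

lemma M_unitary:
  assumes l: "l \<in> {1..k}"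
  shows "unitary (M l)"
proof -
  have lk: "l \<le> k" using l by simp
  define a where "a = sys k L1 * dLam k l"
  define b where "b = sys k L2 * dAs k h l"
  define c where "c = sys k (mat_adjoint L2) * dA k h l"
  define d where "d = sys k L3 * dt k h"
  have mm: "a \<in> MM" "b \<in> MM" "c \<in> MM" "d \<in> MM"
    using lk L_closed by (simp_all add: a_def b_def c_def d_def)
  have "mat_adjoint a = a"
    using lk L_closed(1) Lam.z_adjoint[OF l] sys_fld_commute[OF L_closed(1) _ l, of "sigma_plus * sigma_minus"]
    by (simp add: a_def adjoint_mult L_adjoint flip: sys_adjoint) (simp add: dLam_def)
  moreover have "mat_adjoint d = d"
    using L_closed(3) by (simp add: d_def dt_def adjoint_mult adjoint_smult L_adjoint distribs flip: sys_adjoint)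
  moreover have bc: "mat_adjoint b = c"
    using lk L_closed(2) sys_fld_commute[OF _ _ l, of "mat_adjoint L2" sigma_minus]
    by (simp add: b_def c_def dA_def dAs_def adjoint_mult adjoint_smult distribs flip: sys_adjoint fld_adjoint)
  moreover have "mat_adjoint c = b" using bc mm by (metis adjoint_adjoint)
  ultimately have "mat_adjoint (a + b + c + d) = a + c + b + d"
    using mm by (simp add: adjoint_add)
  also have "\<dots> = a + b + c + d" using mm by (intro eq_matI) auto
  finally have H: "mat_adjoint (a + b + c + d) = a + b + c + d" .
  have "a + b + c + d \<in> MM" using mm by simp
  then show ?thesis
    unfolding M_step_def a_def[symmetric] b_def[symmetric] c_def[symmetric] d_def[symmetric]
    by (intro exp_skew_unitary) (simp_all only: adjoint_smult H smult_distribs(3) closed, simp)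
qed

lemma M_mem [simp]: "l \<in> {1..k} \<Longrightarrow> M l \<in> MM"
  using M_unitary unitaryD(1) by blast

lemma M_eq:
  assumes "l \<in> {1..k}"
  shows "M l = sys k Mpm * dLam k l + sys k Mp * dAs k h l + sys k Mm * dA k h l + sys k Mo * dt k h + 1\<^sub>m (tdim k)"
  unfolding M_step_eq[OF assms, symmetric] using M_mem[OF assms] by (intro eq_matI) auto

text \<open>The expansion \<open>M_eq\<close> exhibits the exponential as a polynomial in system
  operators and operators of the \<open>l\<close>-th factor, so commuting with these
  suffices.\<close>

lemma M_commute:
  assumes l: "l \<in> {1..k}" and B: "B \<in> MM"
    and "\<And>X. X \<in> carrier_mat 2 2 \<Longrightarrow> sys k X * B = B * sys k X"
    and "\<And>Y. Y \<in> carrier_mat 2 2 \<Longrightarrow> fld k l Y * B = B * fld k l Y"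
  shows "M l * B = B * M l"
  unfolding M_eq[OF l] dLam_def dA_def dAs_def dt_def using l B
  by (intro commute_add commute_mult commute_smult commute_one assms) simp_all

lemma M_local: "l \<in> {1..k} \<Longrightarrow> M l \<in> local_ops l"
  by (intro local_opsI M_commute M_mem) (auto intro!: sys_fld_commute fld_fld_commute)

lemma U_local: "l \<le> k \<Longrightarrow> UU l \<in> local_ops l"
proof (induction l)
  case 0
  then show ?case by auto
next
  case (Suc l)
  then have "UU l \<in> local_ops (Suc l)" by (auto intro: local_mono)
  then show ?case using M_local[of "Suc l"] Suc.prems by auto
qed

lemma U_unitary: "l \<le> k \<Longrightarrow> unitary (UU l)"
proof (induction l)
  case (Suc l)
  then show ?case using M_unitary[of "Suc l"] by (auto intro!: unitary_mult)
qed (simp add: unitary_one)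

lemma U_closed [simp]: "l \<le> k \<Longrightarrow> UU l \<in> MM"
  using U_unitary unitaryD(1) by blast

text \<open>Later interactions do not touch the \<open>i\<close>-th factor. So one unitary
  \<open>UU l\<close> produces all observations up to time \<open>l\<close>, which is why they
  commute.\<close>

lemma U_conj_dLam:
  assumes "i \<in> {1..l}" "l \<le> k"
  shows "mat_adjoint (UU l) * dLam k i * UU l = dY k h L1 L2 L3 i"
  using assms
proof (induction l)
  case (Suc l)
  show ?case
  proof (cases "i = Suc l")
    case True
    then show ?thesis by (simp add: dY_def)
  next
    case False
    then have il: "i \<in> {1..l}" and ik: "i \<in> {1..k}" and Mk: "Suc l \<in> {1..k}" using Suc.prems by auto
    have "M (Suc l) * dLam k i = dLam k i * M (Suc l)"
      using il Suc.prems unfolding dLam_def by (intro M_commute sys_fld_commute fld_fld_commute) auto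
    then have "mat_adjoint (M (Suc l)) * dLam k i * M (Suc l) = dLam k i"
      using ik by (intro conj_invariant M_unitary Mk) auto
    moreover have "mat_adjoint (UU (Suc l)) * dLam k i * UU (Suc l) =
      mat_adjoint (UU l) * (mat_adjoint (M (Suc l)) * dLam k i * M (Suc l)) * UU l"
      using il Suc.prems M_mem[OF Mk] by (simp add: adjoint_mult mult_assoc)
    ultimately show ?thesis using Suc il by simp
  qed
qed simp

lemma dY_projs: "commuting_projs (tdim k) (dY k h L1 L2 L3) k"
  by (rule commuting_projs_cong[OF Lam.commuting_projs_conj[OF unitary_adjoint[OF U_unitary[of k]]]])
    (auto simp: U_conj_dLam)

sublocale Z: commuting_projs "tdim k" "dZ k h" k
  by (rule dZ_projs)

sublocale Y: commuting_projs "tdim k" "dY k h L1 L2 L3" k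
  by (rule dY_projs)

lemma el_dY:
  assumes "l \<le> k"
  shows "EY l f = mat_adjoint (UU l) * EL l f * UU l"
proof -
  have "EY l f = el (tdim k) (\<lambda>i. mat_adjoint (UU l) * dLam k i * mat_adjoint (mat_adjoint (UU l))) l f"
    using assms by (intro el_cong) (auto simp: U_conj_dLam)
  then show ?thesis
    using el_conj[OF unitary_adjoint[OF U_unitary[OF assms]], of l "dLam k" f] assms by auto
qed

section \<open>The change of measure\<close>

text \<open>With \<open>c = cos h\<close> and \<open>s = sin h\<close>, the pair \<open>m1\<close>,
  \<open>m0\<close> solves \<open>s^2 m1 + c^2 m0 = c (1 + h^2 Mo) + s h Mp\<close> and
  \<open>c s (m1 - m0) = c h Mp - s (1 + h^2 Mo)\<close>. The right sides are the coefficients of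
  vacuum and excitation after one rotated interaction step.\<close>

definition m1 :: "complex mat" where
  "m1 = complex_of_real (h / sin h) \<cdot>\<^sub>m Mp"

definition m0 :: "complex mat" where
  "m0 = complex_of_real (1 / cos h) \<cdot>\<^sub>m (1\<^sub>m 2 + complex_of_real (h\<^sup>2) \<cdot>\<^sub>m Mo)"

lemma m_closed [simp]: "m1 \<in> carrier_mat 2 2" "m0 \<in> carrier_mat 2 2"
  by (simp_all add: m1_def m0_def)

lemma V_Suc:
  assumes l: "Suc l \<le> k" and V: "VV l \<in> MM"
  shows "VV (Suc l) =
    (sys k m1 * dZ k h (Suc l) + sys k m0 * (1\<^sub>m (tdim k) - dZ k h (Suc l))) * VV l"
proof -
  let ?z = "dZ k h (Suc l)" and ?s = "complex_of_real ((sin h)\<^sup>2)" and ?h = "complex_of_real (h\<^sup>2)"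
  let ?A = "complex_of_real (h / sin h) \<cdot>\<^sub>m Mp - complex_of_real (h\<^sup>2 / cos h) \<cdot>\<^sub>m Mo
             - complex_of_real (1 / cos h) \<cdot>\<^sub>m 1\<^sub>m 2"
  let ?B = "complex_of_real (sin h / h) \<cdot>\<^sub>m Mp + complex_of_real (cos h) \<cdot>\<^sub>m Mo
             + complex_of_real ((cos h - 1) / h\<^sup>2) \<cdot>\<^sub>m 1\<^sub>m 2"
  have z: "?z \<in> MM" using Z.z_Suc[OF l] by simp
  \<comment> \<open>The recursion multiplies by \<open>1 + ?A (dZ - sin^2 h) + h^2 ?B\<close>. At
    outcome 0 this is \<open>1 + h^2 ?B - sin^2 h ?A\<close>, which has to be \<open>m0\<close>; at
    outcome 1 it is larger by \<open>?A\<close>, which has to give \<open>m1\<close>.\<close>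
  have m1_eq: "m1 = ?A + m0"
    unfolding m1_def m0_def by (intro eq_matI) (auto simp: carrier_matD[OF M_closed(2)] carrier_matD[OF M_closed(4)] algebra_simps)
  have m0_eq: "m0 = 1\<^sub>m 2 + ?h \<cdot>\<^sub>m ?B + (- ?s) \<cdot>\<^sub>m ?A"
  proof (intro eq_matI)
    fix i j assume "i < dim_row (1\<^sub>m 2 + ?h \<cdot>\<^sub>m ?B + (- ?s) \<cdot>\<^sub>m ?A)" "j < dim_col (1\<^sub>m 2 + ?h \<cdot>\<^sub>m ?B + (- ?s) \<cdot>\<^sub>m ?A)"
    then have ij: "i < 2" "j < 2" by auto
    have c2: "complex_of_real (cos h) * complex_of_real (cos h) = 1 - complex_of_real (sin h) * complex_of_real (sin h)"
    proof -
      have "cos h * cos h = 1 - sin h * sin h" by (simp add: cos_squared_eq flip: power2_eq_square)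
      then show ?thesis by (metis of_real_mult of_real_1 of_real_diff)
    qed
    have nz: "complex_of_real (cos h) \<noteq> 0" "complex_of_real (sin h) \<noteq> 0" "complex_of_real h \<noteq> 0"
      using sin_nz cos_nz h_nz by (simp_all only: of_real_eq_0_iff not_False_eq_True)
    \<comment> \<open>One matrix entry: \<open>\<delta>\<close>, \<open>u\<close>, \<open>p\<close>
      stand for entries of the identity, \<open>Mo\<close> and \<open>Mp\<close>. The
      \<open>p\<close> terms cancel, and \<open>s^2 / c = 1 / c - c\<close> settles the
      rest.\<close>
    have alg: "1 / c * (\<delta> + x\<^sup>2 * u) = \<delta> + x\<^sup>2 * (s / x * p + c * u + (c - 1) / x\<^sup>2 * \<delta>) +
        - s\<^sup>2 * (x / s * p - x\<^sup>2 / c * u - 1 / c * \<delta>)"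
      if "c * c = 1 - s * s" "c \<noteq> 0" "s \<noteq> 0" "x \<noteq> 0" for c s x \<delta> u p :: complex
    proof -
      have "x\<^sup>2 * (s / x * p + c * u + (c - 1) / x\<^sup>2 * \<delta>) = x * s * p + x\<^sup>2 * c * u + (c - 1) * \<delta>"
        using that by (simp add: field_simps power2_eq_square)
      moreover have "- s\<^sup>2 * (x / s * p - x\<^sup>2 / c * u - 1 / c * \<delta>) = - s * x * p + s\<^sup>2 / c * (x\<^sup>2 * u + \<delta>)"
        using that by (simp add: field_simps power2_eq_square)
      moreover have "s\<^sup>2 / c = 1 / c - c"
        using that by (simp add: field_simps power2_eq_square)
      ultimately have "\<delta> + x\<^sup>2 * (s / x * p + c * u + (c - 1) / x\<^sup>2 * \<delta>) +
          - s\<^sup>2 * (x / s * p - x\<^sup>2 / c * u - 1 / c * \<delta>) =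
        \<delta> + (x * s * p + x\<^sup>2 * c * u + (c - 1) * \<delta>) + (- s * x * p + (1 / c - c) * (x\<^sup>2 * u + \<delta>))"
        by (simp only:)
      also have "\<dots> = 1 / c * (\<delta> + x\<^sup>2 * u)" by (simp add: algebra_simps)
      finally show ?thesis by (rule sym)
    qed
    show "m0 $$ (i, j) = (1\<^sub>m 2 + ?h \<cdot>\<^sub>m ?B + (- ?s) \<cdot>\<^sub>m ?A) $$ (i, j)"
      unfolding m0_def using ij alg[OF c2 nz, of "1\<^sub>m 2 $$ (i, j)" "Mo $$ (i, j)" "Mp $$ (i, j)"]
      by (simp add: index2 del: index_one_mat index_add_mat(1) index_smult_mat(1) index_minus_mat(1))
  qed (simp_all add: m0_def carrier_matD[OF M_closed(4)])
  have sAB: "sys k m1 = sys k ?A + sys k m0"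
    "sys k m0 = 1\<^sub>m (tdim k) + ?h \<cdot>\<^sub>m sys k ?B + (- ?s) \<cdot>\<^sub>m sys k ?A"
    unfolding m1_eq by (simp_all add: sys_add) (subst m0_eq, simp add: sys_add sys_smult sys_one)
  define a b f where "a = sys k ?A" and "b = sys k ?B" and "f = sys k m0"
  have mm: "a \<in> MM" "b \<in> MM" "f \<in> MM" by (simp_all add: a_def b_def f_def)
  have f: "f = 1\<^sub>m (tdim k) + ?h \<cdot>\<^sub>m b + (- ?s) \<cdot>\<^sub>m a" using sAB by (simp add: a_def b_def f_def)
  have dt': "complex_of_real ((sin h)\<^sup>2 / h\<^sup>2) \<cdot>\<^sub>m dt k h = ?s \<cdot>\<^sub>m 1\<^sub>m (tdim k)"
    using h_nz by (simp add: dt_def smult_distribs)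
  have "(a + f) * ?z + f * (1\<^sub>m (tdim k) - ?z) = a * ?z + f"
    using mm z by (simp add: distribs) (intro eq_matI; simp)
  also have "\<dots> = 1\<^sub>m (tdim k) + (a * (?z - ?s \<cdot>\<^sub>m 1\<^sub>m (tdim k)) + b * dt k h)"
    using mm z by (subst f) (simp add: distribs dt_def, intro eq_matI; simp)
  finally have "VV l + (a * (?z - ?s \<cdot>\<^sub>m 1\<^sub>m (tdim k)) + b * dt k h) * VV l =
    ((a + f) * ?z + f * (1\<^sub>m (tdim k) - ?z)) * VV l"
    using V mm z by (simp add: distribs)
  then show ?thesis
    unfolding V.simps dt' sAB(1) a_def b_def f_def .
qed

lemma dZ_local: "i \<in> {1..k} \<Longrightarrow> i \<le> l \<Longrightarrow> l \<le> k \<Longrightarrow> dZ k h i \<in> local_ops l"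
  by (auto simp: dZ_eq)

lemma V_local: "l \<le> k \<Longrightarrow> VV l \<in> local_ops l"
proof (induction l)
  case 0
  then show ?case by auto
next
  case (Suc l)
  then have V: "VV l \<in> local_ops (Suc l)" and V0: "VV l \<in> MM" by (auto intro: local_mono)
  show ?case
    unfolding V_Suc[OF Suc.prems V0] using Suc.prems
    by (intro local_intros V dZ_local local_sys m_closed) auto
qed

lemma V_closed [simp]: "l \<le> k \<Longrightarrow> VV l \<in> MM"
  using V_local local_closed by blast

lemma dZ_sys_commute: "i \<in> {1..k} \<Longrightarrow> X \<in> carrier_mat 2 2 \<Longrightarrow> dZ k h i * sys k X = sys k X * dZ k h i"
  by (simp add: dZ_eq sys_fld_commute)

text \<open>\<open>VV l\<close> is built from system operators and the \<open>dZ\<close> alone; this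
  is the property for which it replaces \<open>R k h l * UU l\<close>.\<close>

lemma V_dZ_commute:
  assumes "l \<le> k" "i \<in> {1..k}"
  shows "VV l * dZ k h i = dZ k h i * VV l"
  using assms(1)
proof (induction l)
  case 0
  then show ?case using Z.z_closed[OF assms(2)] by simp
next
  case (Suc l)
  have k: "Suc l \<in> {1..k}" using Suc.prems by auto
  have z: "dZ k h i \<in> MM" "dZ k h (Suc l) \<in> MM" using assms(2) k Z.z_closed by auto
  show ?case
    unfolding V_Suc[OF Suc.prems V_closed[OF Suc_leD[OF Suc.prems]]]
    using Suc z assms(2) k
    by (intro commute_mult commute_add commute_minus commute_one Z.z_commute dZ_sys_commute[symmetric]) auto
qed

text \<open>Let \<open>x\<close> be the image of the vacuum so far and \<open>y\<close> be
  \<open>x\<close> with the next factor excited. The interaction followed by the rotation, and the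
  step of \<open>VV\<close>, both map \<open>x\<close> to combinations of \<open>x\<close> and
  \<open>y\<close> with system coefficients; \<open>m1\<close> and \<open>m0\<close> make these
  agree.\<close>

lemma V_vac: "l \<le> k \<Longrightarrow> VV l * vac = R k h l * (UU l * vac)"
proof (induction l)
  case 0
  then show ?case by (simp add: R_0)
next
  case (Suc l)
  note k = Suc.prems
  have lk: "l \<le> k" and k1: "Suc l \<in> {1..k}" using k by auto
  let ?W = "R k h l * UU l" and ?i = "Suc l"
  have W: "?W \<in> local_ops l" using R_local[OF lk] U_local[OF lk] by auto
  define x where "x = ?W * vac"
  define y where "y = fld k ?i sigma_plus * x"
  have xy: "x \<in> MM" "y \<in> MM" using W k by (auto simp: x_def y_def)
  have fx: "fld k ?i Y * x = Y $$ (1, 1) \<cdot>\<^sub>m x + Y $$ (0, 1) \<cdot>\<^sub>m y" if "Y \<in> carrier_mat 2 2" for Y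
    unfolding x_def y_def using local_fld_vac[OF W k that] .
  have Vx: "VV l * vac = x" using Suc lk by (simp add: x_def mult_assoc)
  have z: "dZ k h ?i \<in> MM" using Z.z_Suc[OF k] by simp
  have zx: "dZ k h ?i * x = complex_of_real ((sin h)\<^sup>2) \<cdot>\<^sub>m x + complex_of_real (cos h * sin h) \<cdot>\<^sub>m y"
    unfolding dZ_eq[OF k1] by (subst fx) (simp_all only: rot_proj2_closed rot_proj2_index)
  have L: "VV ?i * vac = sys k m1 * (dZ k h ?i * x) + sys k m0 * (x - dZ k h ?i * x)"
    unfolding V_Suc[OF k V_closed[OF lk]] using z xy(1) lk Vx by (simp add: mat_ring)
  have Mx: "M ?i * x = x + complex_of_real h \<cdot>\<^sub>m (sys k Mp * y) + complex_of_real (h\<^sup>2) \<cdot>\<^sub>m (sys k Mo * x)"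
  proof -
    have "fld k ?i (sigma_plus * sigma_minus) * x = 0\<^sub>m (tdim k) (tdim k)"
      "fld k ?i sigma_minus * x = 0\<^sub>m (tdim k) (tdim k)" "fld k ?i sigma_plus * x = y"
      using xy by (simp_all add: fx index2 del: index_mult_mat(1))
    then have "M ?i * x = complex_of_real h \<cdot>\<^sub>m (sys k Mp * y) + complex_of_real (h\<^sup>2) \<cdot>\<^sub>m (sys k Mo * x) + x"
      unfolding M_eq[OF k1] dLam_def dA_def dAs_def dt_def using k xy by (simp add: mat_ring)
    also have "\<dots> = x + complex_of_real h \<cdot>\<^sub>m (sys k Mp * y) + complex_of_real (h\<^sup>2) \<cdot>\<^sub>m (sys k Mo * x)"
    proof -
      have "A + B + x = x + A + B" if "A \<in> MM" "B \<in> MM" for A B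
        using that xy by (intro eq_matI) auto
      then show ?thesis by this (use xy in simp_all)
    qed
    finally show ?thesis .
  qed
  have rx: "rot h ?i * x = complex_of_real (cos h) \<cdot>\<^sub>m x + (- complex_of_real (sin h)) \<cdot>\<^sub>m y"
    using fx[of "rot2 h"] by (simp add: cos_of_real sin_of_real)
  have ry: "rot h ?i * y = complex_of_real (sin h) \<cdot>\<^sub>m x + complex_of_real (cos h) \<cdot>\<^sub>m y"
  proof -
    have "rot h ?i * y = fld k ?i (rot2 h * sigma_plus) * x"
      using k xy by (simp add: y_def fld_mult mult_assoc)
    then show ?thesis
      using fx[of "rot2 h * sigma_plus"] by (simp add: index2 cos_of_real sin_of_real del: index_mult_mat(1))
  qed
  have "R k h ?i * (UU ?i * vac) = R k h l * (rot h ?i * (M ?i * (UU l * vac)))"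
    using k lk M_mem[OF k1] by (simp add: R_Suc mult_assoc)
  \<comment> \<open>\<open>R k h l\<close> acts on earlier field factors only, so it moves inwards
    past the new rotation and \<open>M\<close> until it meets \<open>UU l * vac\<close>.\<close>
  also have "\<dots> = rot h ?i * (M ?i * (R k h l * (UU l * vac)))"
  proof -
    have 1: "R k h l * rot h ?i = rot h ?i * R k h l"
      by (rule local_commute[OF R_local[OF lk] _ k]) simp_all
    have 2: "R k h l * M ?i = M ?i * R k h l"
      using lk k by (intro M_commute[symmetric] k1 R_closed R_sys_commute[symmetric]
          local_commute[OF R_local, symmetric]) auto
    show ?thesis using lk k M_mem[OF k1]
      by (simp add: left_commute[OF _ _ _ 1] left_commute[OF _ _ _ 2])
  qed
  also have "R k h l * (UU l * vac) = x" using lk by (simp add: x_def mult_assoc)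
  also have "rot h ?i * (M ?i * x) = rot h ?i * x + complex_of_real h \<cdot>\<^sub>m (sys k Mp * (rot h ?i * y))
      + complex_of_real (h\<^sup>2) \<cdot>\<^sub>m (sys k Mo * (rot h ?i * x))"
  proof -
    have "rot h ?i * (sys k X * u) = sys k X * (rot h ?i * u)" if "X \<in> carrier_mat 2 2" "u \<in> MM" for X u
      using that k k1 by (intro left_commute sys_fld_commute[symmetric]) auto
    then show ?thesis unfolding Mx using k xy by (simp add: mat_ring)
  qed
  also have "\<dots> = sys k m1 * (dZ k h ?i * x) + sys k m0 * (x - dZ k h ?i * x)"
  proof -
    define p1 p2 o1 o2 where "p1 = sys k Mp * x" and "p2 = sys k Mp * y"
      and "o1 = sys k Mo * x" and "o2 = sys k Mo * y"
    have mm: "p1 \<in> MM" "p2 \<in> MM" "o1 \<in> MM" "o2 \<in> MM"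
      using xy by (simp_all add: p1_def p2_def o1_def o2_def)
    let ?c = "complex_of_real (cos h)" and ?s = "complex_of_real (sin h)" and ?h = "complex_of_real h"
    have x2: "x - dZ k h ?i * x = (?c\<^sup>2) \<cdot>\<^sub>m x + (- (?c * ?s)) \<cdot>\<^sub>m y"
      unfolding zx using xy
      by (intro eq_matI) (auto simp: cos_squared_eq algebra_simps simp flip: of_real_power)
    have m1x: "sys k m1 * (dZ k h ?i * x) = (?h * ?s) \<cdot>\<^sub>m p1 + (?h * ?c) \<cdot>\<^sub>m p2"
      unfolding zx m1_def sys_smult p1_def p2_def using xy sin_nz
      by (simp add: distribs smult_distribs power2_eq_square mult.commute del: of_real_power)
    have m0x: "sys k m0 * (x - dZ k h ?i * x) =
      ?c \<cdot>\<^sub>m x + (- ?s) \<cdot>\<^sub>m y + ((?c * ?h\<^sup>2) \<cdot>\<^sub>m o1 + (- ?s * ?h\<^sup>2) \<cdot>\<^sub>m o2)"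
    proof -
      have "sys k m0 = (1 / ?c) \<cdot>\<^sub>m (1\<^sub>m (tdim k) + ?h\<^sup>2 \<cdot>\<^sub>m sys k Mo)"
        by (simp add: m0_def sys_smult sys_add sys_one)
      then show ?thesis
        unfolding x2 using xy mm(3,4) cos_nz
        by (simp add: distribs smult_distribs o1_def[symmetric] o2_def[symmetric])
          (intro eq_matI; simp add: power2_eq_square field_simps)
    qed
    have "sys k Mp * (?s \<cdot>\<^sub>m x + ?c \<cdot>\<^sub>m y) = ?s \<cdot>\<^sub>m p1 + ?c \<cdot>\<^sub>m p2"
      "sys k Mo * (?c \<cdot>\<^sub>m x + (- ?s) \<cdot>\<^sub>m y) = ?c \<cdot>\<^sub>m o1 + (- ?s) \<cdot>\<^sub>m o2"
      using xy by (simp_all add: p1_def p2_def o1_def o2_def distribs)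
    then show ?thesis
      unfolding m1x m0x rx ry using xy mm
      by (intro eq_matI) (simp_all add: algebra_simps)
  qed
  finally show ?case unfolding L by simp
qed

end

section \<open>Likelihood weights\<close>

text \<open>Expectation over \<open>l\<close> independent coin flips with success probability
  \<open>sin^2 h\<close>, the outcomes being binary digits; \<open>weight\<close> below is the
  probability of one sequence.\<close>

primrec weighted :: "real \<Rightarrow> nat \<Rightarrow> (nat \<Rightarrow> complex) \<Rightarrow> complex" where
  "weighted h 0 f = f 0"
| "weighted h (Suc l) f = complex_of_real ((sin h)\<^sup>2) * weighted h l (\<lambda>m. f (2 * m + 1))
     + complex_of_real ((cos h)\<^sup>2) * weighted h l (\<lambda>m. f (2 * m))"

primrec weight :: "real \<Rightarrow> nat \<Rightarrow> nat \<Rightarrow> real" where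
  "weight h 0 m = 1"
| "weight h (Suc l) m = (if odd m then (sin h)\<^sup>2 else (cos h)\<^sup>2) * weight h l (m div 2)"

lemma weight_nz: "sin h \<noteq> 0 \<Longrightarrow> cos h \<noteq> 0 \<Longrightarrow> weight h l m \<noteq> 0"
  by (induction l arbitrary: m) auto

lemma sum_double: "(\<Sum>m<2 * N. f m) = (\<Sum>m<N. f (2 * m + 1)) + (\<Sum>m<N. f (2 * m :: nat) :: complex)"
  by (induction N) auto

lemma weighted_sum: "weighted h l f = (\<Sum>m<2 ^ l. complex_of_real (weight h l m) * f m)"
proof (induction l arbitrary: f)
  case (Suc l)
  then show ?case by (simp add: sum_double sum_distrib_left mult.assoc)
qed simp

text \<open>Testing against the indicator of \<open>m\<close> isolates one outcome sequence, whose
  weight is nonzero.\<close>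

lemma weighted_eqI:
  assumes "sin h \<noteq> 0" "cos h \<noteq> 0" "m < 2 ^ l"
    and eq: "\<And>g. weighted h l (\<lambda>m. f m * g m) = weighted h l (\<lambda>m. f' m * g m)"
  shows "f m = f' m"
proof -
  have "weighted h l (\<lambda>i. F i * of_bool (i = m)) = complex_of_real (weight h l m) * F m" for F
    unfolding weighted_sum using assms(3) by (subst sum.remove[of _ m]) (auto intro!: sum.neutral)
  then show ?thesis
    using eq[of "\<lambda>i. of_bool (i = m)"] weight_nz[OF assms(1,2)] by simp
qed

lemma weighted_cong: "(\<And>m. m < 2 ^ l \<Longrightarrow> f m = g m) \<Longrightarrow> weighted h l f = weighted h l g"
  unfolding weighted_sum by (auto intro: sum.cong)

text \<open>Along real and along imaginary \<open>c\<close> the expression is affine in a real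
  parameter. A nonnegative affine function on the line is constant, so both \<open>a + b\<close> and
  \<open>b - a\<close> vanish.\<close>

lemma nonneg_linear_zero:
  fixes a b r :: complex
  assumes "\<And>c. cnj c * a + c * b + r \<in> \<real>\<^sub>\<ge>\<^sub>0"
  shows "a = 0"
proof -
  have zero: "u = 0" if "\<And>t::real. complex_of_real t * u + r \<in> \<real>\<^sub>\<ge>\<^sub>0" for u
  proof -
    have r: "t * Re u + Re r \<ge> 0" "t * Im u + Im r = 0" for t
      using that[of t] by (auto simp: complex_nonneg_Reals_iff)
    have "Im u = 0" using r(2)[of 0] r(2)[of 1] by simp
    moreover have "Re u = 0"
    proof (rule ccontr)
      assume "Re u \<noteq> 0"
      then have "(- (Re r + 1) / Re u) * Re u + Re r = -1" by simp
      then show False using r(1)[of "- (Re r + 1) / Re u"] by simp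
    qed
    ultimately show ?thesis by (simp add: complex_eq_iff)
  qed
  have "a + b = 0"
    using assms[of "complex_of_real _"] by (intro zero) (simp add: algebra_simps)
  moreover have "\<i> * (b - a) = 0"
  proof (rule zero)
    fix t :: real
    show "complex_of_real t * (\<i> * (b - a)) + r \<in> \<real>\<^sub>\<ge>\<^sub>0"
      using assms[of "complex_of_real t * \<i>"] by (simp add: algebra_simps)
  qed
  ultimately show ?thesis by simp
qed

context repeated_interaction
begin

text \<open>\<open>ev l X\<close> is \<open>\<sigma>\<^sub>l(X)\<close> as a function of the outcomes.\<close>

primrec ev :: "nat \<Rightarrow> complex mat \<Rightarrow> nat \<Rightarrow> complex" where
  "ev 0 X m = \<rho> X"
| "ev (Suc l) X m = ev l (if odd m then mat_adjoint m1 * X * m1 else mat_adjoint m0 * X * m0) (m div 2)"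

lemma sandwich_closed [simp]:
  fixes X a :: "complex mat"
  shows "X \<in> carrier_mat 2 2 \<Longrightarrow> a \<in> carrier_mat 2 2 \<Longrightarrow> mat_adjoint a * X * a \<in> carrier_mat 2 2"
  by simp

lemma ev_add:
  "A \<in> carrier_mat 2 2 \<Longrightarrow> B \<in> carrier_mat 2 2 \<Longrightarrow> ev l (A + B) m = ev l A m + ev l B m"
proof (induction l arbitrary: A B m)
  case (Suc l)
  have "mat_adjoint a * (A + B) * a = mat_adjoint a * A * a + mat_adjoint a * B * a"
    if "a \<in> carrier_mat 2 2" for a
    using that Suc.prems by (simp add: two.distribs)
  then show ?case using Suc by simp
qed (simp add: rho_add)

lemma ev_smult: "A \<in> carrier_mat 2 2 \<Longrightarrow> ev l (c \<cdot>\<^sub>m A) m = c * ev l A m"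
proof (induction l arbitrary: A m)
  case (Suc l)
  have "mat_adjoint a * (c \<cdot>\<^sub>m A) * a = c \<cdot>\<^sub>m (mat_adjoint a * A * a)"
    if "a \<in> carrier_mat 2 2" for a
    using that Suc.prems by (simp add: two.distribs)
  then show ?case using Suc by simp
qed (simp add: rho_smult)

lemma ev_pos: "A \<in> carrier_mat 2 2 \<Longrightarrow> ev l (mat_adjoint A * A) m \<in> \<real>\<^sub>\<ge>\<^sub>0"
proof (induction l arbitrary: A m)
  case (Suc l)
  have "mat_adjoint a * (mat_adjoint A * A) * a = mat_adjoint (A * a) * (A * a)"
    if "a \<in> carrier_mat 2 2" for a
    using that Suc.prems by (simp add: two.adjoint_mult two.mult_assoc)
  then show ?case using Suc by simp
qed (simp add: rho_pos)

text \<open>Cauchy-Schwarz in linear form: for \<open>A = c 1 + X\<close> the nonnegative value of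
  \<open>ev\<close> at \<open>mat_adjoint A * A\<close> loses its term quadratic in
  \<open>c\<close>, and then the linear coefficients must vanish.\<close>

lemma ev_zero:
  assumes "ev l (1\<^sub>m 2) m = 0" and X: "X \<in> carrier_mat 2 2"
  shows "ev l X m = 0"
proof (rule nonneg_linear_zero)
  fix c
  let ?A = "c \<cdot>\<^sub>m 1\<^sub>m 2 + X"
  have "mat_adjoint ?A * ?A = (c * cnj c) \<cdot>\<^sub>m 1\<^sub>m 2 + (cnj c \<cdot>\<^sub>m X + (c \<cdot>\<^sub>m mat_adjoint X + mat_adjoint X * X))"
    using X by (simp add: two.adjoint_simps two.mat_ring)
      (intro eq_matI; simp add: algebra_simps)
  then have "ev l (mat_adjoint ?A * ?A) m =
    cnj c * ev l X m + c * ev l (mat_adjoint X) m + ev l (mat_adjoint X * X) m"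
    using X assms(1) by (simp add: ev_add ev_smult)
  moreover have "?A \<in> carrier_mat 2 2" using X by simp
  ultimately show "cnj c * ev l X m + c * ev l (mat_adjoint X) m + ev l (mat_adjoint X * X) m \<in> \<real>\<^sub>\<ge>\<^sub>0"
    using ev_pos by metis
qed

lemma P_dZ:
  assumes B: "B \<in> local_ops l" and l: "Suc l \<le> k"
  shows "P (B * dZ k h (Suc l)) = complex_of_real ((sin h)\<^sup>2) * P B"
    "P (B * (1\<^sub>m (tdim k) - dZ k h (Suc l))) = complex_of_real ((cos h)\<^sup>2) * P B"
proof -
  have z: "dZ k h (Suc l) \<in> MM" using Z.z_Suc[OF l] by simp
  show 1: "P (B * dZ k h (Suc l)) = complex_of_real ((sin h)\<^sup>2) * P B"
    using dZ_eq[of "Suc l" h] P_local_fld[OF B l rot_proj2_closed] l by (simp only: rot_proj2_index) auto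
  have "P B = P (B * dZ k h (Suc l) + B * (1\<^sub>m (tdim k) - dZ k h (Suc l)))"
    using z B by (simp only: split_complement local_closed)
  also have "\<dots> = P (B * dZ k h (Suc l)) + P (B * (1\<^sub>m (tdim k) - dZ k h (Suc l)))"
    using z B by (intro P_add) auto
  finally show "P (B * (1\<^sub>m (tdim k) - dZ k h (Suc l))) = complex_of_real ((cos h)\<^sup>2) * P B"
    unfolding 1 by (simp add: cos_squared_eq algebra_simps)
qed

lemma EZ_local: "l \<le> k \<Longrightarrow> EZ l f \<in> local_ops l"
  by (intro local_el dZ_local) auto

lemma P_dZ_pair:
  assumes "B \<in> local_ops l" "B' \<in> local_ops l" "Suc l \<le> k"
  shows "P (B * dZ k h (Suc l) + B' * (1\<^sub>m (tdim k) - dZ k h (Suc l))) =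
    complex_of_real ((sin h)\<^sup>2) * P B + complex_of_real ((cos h)\<^sup>2) * P B'"
proof -
  have "dZ k h (Suc l) \<in> MM" using Z.z_Suc[OF assms(3)] by simp
  then show ?thesis using assms by (simp add: P_add P_dZ del: of_real_power)
qed

lemma P_EZ: "l \<le> k \<Longrightarrow> P (EZ l f) = weighted h l f"
proof (induction l arbitrary: f)
  case 0
  have "P (1\<^sub>m (tdim k)) = 1" using P_sys[of "1\<^sub>m 2"] by (simp add: sys_one rho_one)
  then show ?case by (simp add: P_smult)
next
  case (Suc l)
  then show ?case by (simp add: P_dZ_pair EZ_local del: of_real_power)
qed

text \<open>All factors are block sums over the newest outcome with coefficients from the past. The
  block products sandwich \<open>X\<close> by \<open>m1\<close> or \<open>m0\<close>, and the new
  coin flip is independent of the past; hence the induction over varying \<open>X\<close> and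
  \<open>g\<close>.\<close>

lemma V_likelihood:
  assumes "l \<le> k" "X \<in> carrier_mat 2 2"
  shows "P (mat_adjoint (VV l) * sys k X * VV l * EZ l g) = weighted h l (\<lambda>m. ev l X m * g m)"
  using assms
proof (induction l arbitrary: X g)
  case 0
  then show ?case by (simp add: distribs P_smult P_sys mult.commute)
next
  case (Suc l)
  note k = Suc.prems(1) and X = Suc.prems(2)
  have lk: "l \<le> k" and k1: "Suc l \<in> {1..k}" using k by auto
  define z q where "z = dZ k h (Suc l)" and "q = 1\<^sub>m (tdim k) - z"
  note zs = Z.z_Suc[OF k, folded z_def]
  have pp: "proj_pair z q" and zM: "z \<in> MM" "q \<in> MM" and adj: "mat_adjoint z = z" "mat_adjoint q = q"
    using zs by (auto simp: q_def adjoint_minus)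
  have comm: "z * B = B * z" "q * B = B * q" if "B \<in> local_ops l" for B
  proof -
    show "z * B = B * z"
      unfolding z_def dZ_eq[OF k1] by (rule local_commute[OF that _ k, symmetric]) auto
    then show "q * B = B * q"
      unfolding q_def using zM that by (intro complement_commute) auto
  qed
  define a a' x g1 g0 where "a = sys k m1 * VV l" and "a' = sys k m0 * VV l" and "x = sys k X"
    and "g1 = EZ l (\<lambda>m. g (2 * m + 1))" and "g0 = EZ l (\<lambda>m. g (2 * m))"
  have loc: "a \<in> local_ops l" "a' \<in> local_ops l" "x \<in> local_ops l" "g1 \<in> local_ops l" "g0 \<in> local_ops l"
    using lk X by (auto simp: a_def a'_def x_def g1_def g0_def intro!: local_intros(1) V_local EZ_local)
  note locM = loc[THEN local_closed]
  have V: "VV (Suc l) = a * z + a' * q"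
    unfolding V_Suc[OF k V_closed[OF lk]] a_def a'_def z_def[symmetric] q_def[symmetric]
    using lk zM comm[OF V_local[OF lk]] by (simp add: mat_ring)
  have VA: "mat_adjoint (VV (Suc l)) = mat_adjoint a * z + mat_adjoint a' * q"
    unfolding V using locM zM loc comm[of "mat_adjoint a"] comm[of "mat_adjoint a'"]
    by (simp add: adjoint_simps adj local_adjoint)
  \<comment> \<open>\<open>x\<close> is split as well, so that all four factors have the shape that
    \<open>proj_pair_mult\<close> needs.\<close>
  have x: "x = x * z + x * q"
    unfolding q_def using locM zM by (simp add: split_complement)
  have G: "EZ (Suc l) g = g1 * z + g0 * q" by (simp add: g1_def g0_def z_def q_def)
  have "mat_adjoint (VV (Suc l)) * x * VV (Suc l) * EZ (Suc l) g =
    (mat_adjoint a * z + mat_adjoint a' * q) * (x * z + x * q) * (a * z + a' * q) * (g1 * z + g0 * q)"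
    by (simp only: VA G x[symmetric]) (simp only: V)
  also have "\<dots> = mat_adjoint a * x * a * g1 * z + mat_adjoint a' * x * a' * g0 * q"
    using locM loc comm by (simp add: proj_pair_mult[OF pp])
  also have "mat_adjoint a * x * a = mat_adjoint (VV l) * sys k (mat_adjoint m1 * X * m1) * VV l"
    unfolding a_def x_def using lk X by (simp add: adjoint_mult sys_mult sys_adjoint mult_assoc two.closed)
  also have "mat_adjoint a' * x * a' = mat_adjoint (VV l) * sys k (mat_adjoint m0 * X * m0) * VV l"
    unfolding a'_def x_def using lk X by (simp add: adjoint_mult sys_mult sys_adjoint mult_assoc two.closed)
  finally have eq: "mat_adjoint (VV (Suc l)) * sys k X * VV (Suc l) * EZ (Suc l) g =
    mat_adjoint (VV l) * sys k (mat_adjoint m1 * X * m1) * VV l * g1 * z +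
    mat_adjoint (VV l) * sys k (mat_adjoint m0 * X * m0) * VV l * g0 * q"
    by (simp add: x_def)
  have "mat_adjoint (VV l) * sys k (mat_adjoint m1 * X * m1) * VV l * g1 \<in> local_ops l"
    "mat_adjoint (VV l) * sys k (mat_adjoint m0 * X * m0) * VV l * g0 \<in> local_ops l"
    using lk X loc by (auto intro!: V_local local_intros(1) local_adjoint local_sys)
  then show ?case
    unfolding eq q_def z_def
    by (subst P_dZ_pair[OF _ _ k]) (simp_all add: Suc.IH[OF lk] g1_def g0_def X del: of_real_power)
qed

section \<open>Conditional expectations\<close>

lemma R_alg_eq:
  assumes "l \<le> k"
  shows "R_alg k h l = range (EZ l)"
  unfolding R_alg_def C_alg_def Lam.star_algebra_eq[OF assms] image_image
  using el_dZ[OF assms, of h] by auto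

lemma Y_alg_eq: "l \<le> k \<Longrightarrow> Y_alg k h L1 L2 L3 l = range (EY l)"
  unfolding Y_alg_def by (rule Y.star_algebra_eq)

lemma EZ_inj:
  assumes "l \<le> k" "EZ l f = EZ l g" "m < 2 ^ l"
  shows "f m = g m"
proof (rule weighted_eqI[OF sin_nz cos_nz assms(3)])
  fix u
  show "weighted h l (\<lambda>m. f m * u m) = weighted h l (\<lambda>m. g m * u m)"
    using assms by (simp add: Z.E_mult flip: P_EZ)
qed

text \<open>Transported from \<open>EZ\<close> by unitary conjugation: testing with \<open>P\<close>
  directly would not do, since the law of the observations may give some outcomes probability
  zero.\<close>

lemma EY_inj:
  assumes "l \<le> k" "EY l f = EY l g" "m < 2 ^ l"
  shows "f m = g m"
proof (rule EZ_inj[OF assms(1) _ assms(3)])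
  note u = unitaryD[OF U_unitary[OF assms(1)]]
  have "EL l f' = UU l * EY l f' * mat_adjoint (UU l)" for f'
    using u assms(1) by (simp add: el_dY mult_assoc)
  then have "EL l f = EL l g" using assms(2) by simp
  then show "EZ l f = EZ l g" using el_dZ[OF assms(1)] by simp
qed

lemma V_sandwich_commutant:
  assumes "l \<le> k" "X \<in> carrier_mat 2 2"
  shows "mat_adjoint (VV l) * sys k X * VV l \<in> commutant (tdim k) (range (EZ l))"
proof -
  let ?B = "mat_adjoint (VV l) * sys k X * VV l"
  have B: "?B \<in> MM" using assms by simp
  have "?B * EZ l f = EZ l f * ?B" for f
  proof (rule Z.E_commute[OF assms(1) B, symmetric])
    fix i assume "i \<in> {1..l}"
    then have i: "i \<in> {1..k}" using assms(1) by auto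
    note z = Z.z_closed[OF i] Z.z_adjoint[OF i]
    have "mat_adjoint (VV l) * dZ k h i = dZ k h i * mat_adjoint (VV l)"
      using V_dZ_commute[OF assms(1) i] z assms(1) by (intro commute_adjoint) auto
    then have "?B * dZ k h i = dZ k h i * ?B"
      using z assms by (intro commute_mult V_dZ_commute dZ_sys_commute[symmetric] i) auto
    then show "dZ k h i * ?B = ?B * dZ k h i" ..
  qed
  then show ?thesis using B by (auto simp: commutant_def)
qed

text \<open>The version is unique as a matrix, not only with probability one, because
  \<open>weighted\<close> charges every outcome.\<close>

lemma cond_exp_V_iff:
  assumes "l \<le> k" "X \<in> carrier_mat 2 2"
  shows "is_cond_exp (tdim k) P (R_alg k h l) (mat_adjoint (VV l) * sys k X * VV l) E \<longleftrightarrow> E = EZ l (ev l X)"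
proof
  assume "is_cond_exp (tdim k) P (R_alg k h l) (mat_adjoint (VV l) * sys k X * VV l) E"
  then obtain a where a: "E = EZ l a"
    and eq: "\<And>g. P (EZ l a * EZ l g) = P (mat_adjoint (VV l) * sys k X * VV l * EZ l g)"
    by (auto simp: is_cond_exp_def R_alg_eq[OF assms(1)])
  have "weighted h l (\<lambda>m. a m * g m) = weighted h l (\<lambda>m. ev l X m * g m)" for g
    using eq[of g] unfolding V_likelihood[OF assms] by (simp add: assms(1) P_EZ flip: Z.E_mult)
  then have "a m = ev l X m" if "m < 2 ^ l" for m
    by (rule weighted_eqI[OF sin_nz cos_nz that])
  then show "E = EZ l (ev l X)" unfolding a by (intro el_cong) auto
next
  assume E: "E = EZ l (ev l X)"
  have "P (E * EZ l g) = P (mat_adjoint (VV l) * sys k X * VV l * EZ l g)" for g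
    unfolding V_likelihood[OF assms] E using assms(1) by (simp flip: P_EZ Z.E_mult)
  then show "is_cond_exp (tdim k) P (R_alg k h l) (mat_adjoint (VV l) * sys k X * VV l) E"
    using V_sandwich_commutant[OF assms] by (auto simp: is_cond_exp_def R_alg_eq[OF assms(1)] E)
qed

lemma is_unnormalized_iff:
  assumes "l \<le> k" "X \<in> carrier_mat 2 2"
  shows "is_unnormalized k h \<rho> L1 L2 L3 Mp Mo l X S \<longleftrightarrow> S = EY l (ev l X)"
proof -
  note u = unitaryD[OF U_unitary[OF assms(1)]] and r = unitaryD[OF R_unitary[OF assms(1), of h]]
  have "mat_adjoint (UU l) * mat_adjoint (R k h l) * EZ l (ev l X) * R k h l * UU l = EY l (ev l X)"
    using u r assms(1) by (simp add: el_dZ el_dY mult_assoc)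
  then show ?thesis
    unfolding is_unnormalized_def cond_exp_V_iff[OF assms] by simp
qed

text \<open>Girsanov's theorem: on the vacuum, \<open>V(l)\<close> and \<open>R(l) U(l)\<close> agree, and
  conjugation by \<open>R(l)\<close> carries the \<open>\<Delta>\<Lambda>(i)\<close> to the
  \<open>\<Delta>Z(i)\<close>, which commute with \<open>V(l)\<close>.\<close>

lemma P_flow:
  assumes l: "l \<le> k" and X: "X \<in> carrier_mat 2 2"
  shows "P (flow k (UU l) X * EY l g) = weighted h l (\<lambda>m. ev l X m * g m)"
proof -
  note u = unitaryD[OF U_unitary[OF l]] and r = unitaryD[OF R_unitary[OF l, of h]]
  let ?RU = "R k h l * UU l"
  have x: "sys k X \<in> MM" using X by simp
  have "?RU * vac = VV l * vac" using V_vac[OF l] l by (simp add: mult_assoc)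
  note RU = this
  have c: "mat_adjoint (R k h l) * (sys k X * A) = sys k X * (mat_adjoint (R k h l) * A)" if "A \<in> MM" for A
    using R_sys_commute[OF l, of "mat_adjoint X" h] l X that
    by (intro left_commute commute_adjoint) (auto simp: sys_adjoint two.closed)
  \<comment> \<open>\<open>EY l g\<close> is \<open>EZ l g\<close> conjugated by the adjoint of
    \<open>?RU\<close>, and \<open>R k h l\<close> commutes with the system; so \<open>?RU\<close>
    and its adjoint are left only at the two ends, where they meet the vacuum.\<close>
  have "flow k (UU l) X * EY l g = mat_adjoint ?RU * (sys k X * EZ l g * ?RU)"
    unfolding flow_def using u r l x by (simp add: el_dY el_dZ adjoint_mult mult_assoc c)
  then have "P (flow k (UU l) X * EY l g) = P (mat_adjoint (VV l) * (sys k X * EZ l g * ?RU))"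
    using l x RU by (simp add: P_left_vac[of _ ?RU "VV l"])
  also have "\<dots> = P (mat_adjoint (VV l) * (sys k X * EZ l g) * VV l)"
    using l x RU P_right_vac[of "mat_adjoint (VV l) * (sys k X * EZ l g)" ?RU "VV l"]
    by (simp add: mult_assoc)
  \<comment> \<open>Here commutation with the \<open>dZ\<close> is used: \<open>EZ l g\<close> moves
    out to the right past \<open>VV l\<close>.\<close>
  also have "mat_adjoint (VV l) * (sys k X * EZ l g) * VV l = mat_adjoint (VV l) * sys k X * VV l * EZ l g"
    using Z.E_commute[OF l V_closed[OF l], of g] V_dZ_commute[OF l] l x by (simp add: mult_assoc)
  finally show ?thesis using V_likelihood[OF l X] by simp
qed

text \<open>The case of the identity in \<open>P_flow\<close>: \<open>ev l (1\<^sub>m 2)\<close> is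
  the density of the law of the observations relative to the coin flips.\<close>

lemma P_EY:
  assumes "l \<le> k"
  shows "P (EY l g) = weighted h l (\<lambda>m. ev l (1\<^sub>m 2) m * g m)"
proof -
  have "flow k (UU l) (1\<^sub>m 2) = 1\<^sub>m (tdim k)"
    using unitaryD[OF U_unitary[OF assms]] by (simp add: flow_def sys_one)
  then show ?thesis using P_flow[OF assms, of "1\<^sub>m 2" g] assms by simp
qed

lemma flow_commutant:
  assumes l: "l \<le> k" and X: "X \<in> carrier_mat 2 2"
  shows "flow k (UU l) X \<in> commutant (tdim k) (range (EY l))"
proof -
  note u = unitaryD[OF U_unitary[OF l]]
  have "sys k X * EL l f = EL l f * sys k X" for f
    using l X by (intro Lam.E_commute[symmetric]) (auto simp: dLam_def intro!: sys_fld_commute[symmetric])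
  then have "flow k (UU l) X * EY l f = EY l f * flow k (UU l) X" for f
    unfolding flow_def using u l X by (simp add: el_dY mult_assoc) (simp flip: mult_assoc)
  then show ?thesis using l X by (auto simp: commutant_def flow_def)
qed

text \<open>Bayes' rule in product form: nothing is divided, and \<open>p\<close> stays free at
  outcomes of density zero.\<close>

lemma cond_exp_flow_iff:
  assumes l: "l \<le> k" and X: "X \<in> carrier_mat 2 2"
  shows "is_cond_exp (tdim k) P (Y_alg k h L1 L2 L3 l) (flow k (UU l) X) E \<longleftrightarrow>
    (\<exists>p. E = EY l p \<and> (\<forall>m < 2 ^ l. p m * ev l (1\<^sub>m 2) m = ev l X m))"
proof -
  have P_EY2: "P (EY l p * EY l g) = weighted h l (\<lambda>m. p m * ev l (1\<^sub>m 2) m * g m)" for p g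
    using l by (simp add: P_EY mult_ac flip: Y.E_mult)
  show ?thesis
  proof (intro iffI; (elim exE conjE)?)
    assume "is_cond_exp (tdim k) P (Y_alg k h L1 L2 L3 l) (flow k (UU l) X) E"
    then obtain p where p: "E = EY l p"
      and eq: "\<And>g. P (EY l p * EY l g) = P (flow k (UU l) X * EY l g)"
      by (auto simp: is_cond_exp_def Y_alg_eq[OF l])
    have "p m * ev l (1\<^sub>m 2) m = ev l X m" if "m < 2 ^ l" for m
      using eq unfolding P_EY2 P_flow[OF l X] by (rule weighted_eqI[OF sin_nz cos_nz that])
    then show "\<exists>p. E = EY l p \<and> (\<forall>m < 2 ^ l. p m * ev l (1\<^sub>m 2) m = ev l X m)" using p by blast
  next
    fix p assume p: "E = EY l p" "\<forall>m < 2 ^ l. p m * ev l (1\<^sub>m 2) m = ev l X m"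
    have "P (E * EY l g) = P (flow k (UU l) X * EY l g)" for g
      unfolding p(1) P_EY2 P_flow[OF l X] using p(2) by (intro weighted_cong) auto
    then show "is_cond_exp (tdim k) P (Y_alg k h L1 L2 L3 l) (flow k (UU l) X) E"
      using flow_commutant[OF l X] p(1) by (auto simp: is_cond_exp_def Y_alg_eq[OF l])
  qed
qed

text \<open>The witness is the quotient, which HOL sets to 0 at zeros of the density; there
  \<open>ev_zero\<close> supplies the required \<open>ev l X m = 0\<close>.\<close>

lemma cond_exp_flow_exists:
  assumes "l \<le> k" "X \<in> carrier_mat 2 2"
  shows "\<exists>\<pi>. is_cond_exp (tdim k) P (Y_alg k h L1 L2 L3 l) (flow k (UU l) X) \<pi>"
proof -
  have "ev l X m / ev l (1\<^sub>m 2) m * ev l (1\<^sub>m 2) m = ev l X m" for m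
    using ev_zero[of l m X] assms(2) by (cases "ev l (1\<^sub>m 2) m = 0") auto
  then show ?thesis
    unfolding cond_exp_flow_iff[OF assms]
    by (intro exI[of _ "EY l (\<lambda>m. ev l X m / ev l (1\<^sub>m 2) m)"]
        exI[of _ "\<lambda>m. ev l X m / ev l (1\<^sub>m 2) m"]) blast
qed

section \<open>Pointwise quotients and Bayes' rule\<close>

lemma quotient_exists:
  assumes l: "l \<le> k"
  shows "\<exists>Q. is_quotient (Y_alg k h L1 L2 L3 l) (EY l f) (EY l g) Q"
proof -
  obtain \<iota> where "function_rep (range (EY l)) {..<2 ^ l} \<iota>" "\<And>f m. m < 2 ^ l \<Longrightarrow> \<iota> (EY l f) m = f m"
  proof (rule Y.function_rep_E[OF l])
    fix f g and m :: nat assume "EY l f = EY l g" "m < 2 ^ l"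
    then show "f m = g m" by (rule EY_inj[OF l])
  next
    fix \<iota> assume "function_rep (range (EY l)) {..<2 ^ l} \<iota>" "\<And>f m. m < 2 ^ l \<Longrightarrow> \<iota> (EY l f) m = f m"
    then show thesis by (rule that)
  qed
  then have "is_quotient (Y_alg k h L1 L2 L3 l) (EY l f) (EY l g) (EY l (\<lambda>m. f m / g m))"
    unfolding is_quotient_def Y_alg_eq[OF l] by (intro conjI rangeI exI[of _ "{..<2 ^ l}"] exI[of _ \<iota>]) auto
  then show ?thesis ..
qed

text \<open>Unlike \<open>q m * g m = f m\<close>, the identity with an extra factor
  \<open>g m\<close> survives at zeros of \<open>g\<close>. Being an equation between products, it
  carries over from an arbitrary representation to the algebra.\<close>

lemma quotientD:
  assumes l: "l \<le> k" and Q: "is_quotient (Y_alg k h L1 L2 L3 l) (EY l f) (EY l g) Q"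
  obtains q where "Q = EY l q" "\<And>m. m < 2 ^ l \<Longrightarrow> q m * g m * g m = f m * g m"
proof -
  obtain q \<Omega> \<iota> where q: "Q = EY l q" and rep: "function_rep (range (EY l)) \<Omega> \<iota>"
    and div: "\<And>\<omega>. \<omega> \<in> \<Omega> \<Longrightarrow> \<iota> (EY l g) \<omega> \<noteq> 0 \<Longrightarrow> \<iota> (EY l q) \<omega> = \<iota> (EY l f) \<omega> / \<iota> (EY l g) \<omega>"
    using Q unfolding is_quotient_def Y_alg_eq[OF l] by auto
  have bij: "bij_betw \<iota> (range (EY l)) (\<Omega> \<rightarrow>\<^sub>E UNIV)"
    using rep by (simp add: function_rep_def)
  have mult: "\<iota> (EY l u * EY l v) \<omega> = \<iota> (EY l u) \<omega> * \<iota> (EY l v) \<omega>" if "\<omega> \<in> \<Omega>" for u v \<omega>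
    using rep that unfolding function_rep_def by blast
  have "\<iota> (EY l q * EY l g * EY l g) = \<iota> (EY l f * EY l g)"
  proof
    fix \<omega>
    show "\<iota> (EY l q * EY l g * EY l g) \<omega> = \<iota> (EY l f * EY l g) \<omega>"
    proof (cases "\<omega> \<in> \<Omega>")
      case True
      then show ?thesis
        using div[OF True] mult[OF True, of "\<lambda>m. q m * g m" g] mult[OF True] l
        by (cases "\<iota> (EY l g) \<omega> = 0") (simp_all add: Y.E_mult)
    next
      case False
      \<comment> \<open>Outside \<open>\<Omega>\<close> both sides are \<open>undefined\<close>; so
        the two functions agree everywhere and injectivity of \<open>\<iota>\<close>
        applies.\<close>
      have "\<iota> (EY l u) \<in> \<Omega> \<rightarrow>\<^sub>E UNIV" for u
        using bij_betwE[OF bij] by simp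
      then have "\<iota> (EY l u) \<omega> = undefined" for u by (rule PiE_arb[OF _ False])
      then show ?thesis using l by (simp flip: Y.E_mult)
    qed
  qed
  then have "\<iota> (EY l (\<lambda>m. q m * g m * g m)) = \<iota> (EY l (\<lambda>m. f m * g m))"
    using l by (simp add: Y.E_mult)
  then have "EY l (\<lambda>m. q m * g m * g m) = EY l (\<lambda>m. f m * g m)"
    by (rule inj_onD[OF bij_betw_imp_inj_on[OF bij]]) auto
  then show ?thesis using EY_inj[OF l] q that by blast
qed

lemma kallianpur_striebel:
  assumes l: "l \<le> k" and X: "X \<in> carrier_mat 2 2"
    and \<pi>: "is_cond_exp (tdim k) P (Y_alg k h L1 L2 L3 l) (flow k (UU l) X) \<pi>"
    and Q: "is_quotient (Y_alg k h L1 L2 L3 l) (EY l (ev l X)) (EY l (ev l (1\<^sub>m 2))) Q"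
  shows "equal_wp1 P \<pi> Q"
proof -
  let ?e = "ev l (1\<^sub>m 2)"
  obtain p where p: "\<pi> = EY l p" "\<And>m. m < 2 ^ l \<Longrightarrow> p m * ?e m = ev l X m"
    using \<pi> unfolding cond_exp_flow_iff[OF l X] by blast
  obtain q where q: "Q = EY l q" "\<And>m. m < 2 ^ l \<Longrightarrow> q m * ?e m * ?e m = ev l X m * ?e m"
    using quotientD[OF l Q] by blast
  let ?d = "\<lambda>m. p m + (-1) * q m"
  have "\<pi> - Q = EY l ?d"
    unfolding p(1) q(1) using l Y.E_closed[OF l, of p] Y.E_closed[OF l, of q]
    by (subst Y.E_add[OF l], subst Y.E_smult[OF l]) (intro eq_matI; auto)
  then have "P (mat_adjoint (\<pi> - Q) * (\<pi> - Q)) = weighted h l (\<lambda>m. ?e m * (cnj (?d m) * ?d m))"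
    using l by (simp only: Y.E_adjoint P_EY flip: Y.E_mult)
  also have "\<dots> = weighted h l (\<lambda>m. 0)"
  proof (rule weighted_cong)
    fix m :: nat assume m: "m < 2 ^ l"
    \<comment> \<open>Where \<open>p\<close> and \<open>q\<close> may differ the density vanishes,
      and the density weights the squared difference.\<close>
    have "?e m = 0 \<or> p m = q m" using p(2)[OF m] q(2)[OF m] by (metis mult_cancel_right)
    then show "?e m * (cnj (?d m) * ?d m) = 0" by auto
  qed
  also have "\<dots> = 0" by (simp add: weighted_sum)
  finally show ?thesis by (simp add: equal_wp1_def)
qed

section \<open>The filtering equation\<close>

lemma gen_closed [simp]:
  assumes "X \<in> carrier_mat 2 2"
  shows "gen_L h Mp Mo X \<in> carrier_mat 2 2" "gen_T h Mp Mo X \<in> carrier_mat 2 2"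
  using assms by (auto simp: gen_L_def gen_T_def intro!: two.closed)

text \<open>The right side of the filtering equation at outcome 1:
  \<open>1 - sin^2 h = cos^2 h\<close> multiplies \<open>gen_T\<close> and cancels its
  prefactor.\<close>

lemma m1_sandwich:
  assumes X: "X \<in> carrier_mat 2 2"
  shows "mat_adjoint m1 * X * m1 = X + (complex_of_real (h\<^sup>2) \<cdot>\<^sub>m gen_L h Mp Mo X
    + complex_of_real ((cos h)\<^sup>2) \<cdot>\<^sub>m gen_T h Mp Mo X)"
proof -
  have "mat_adjoint m1 * X * m1 = complex_of_real (h\<^sup>2 / (sin h)\<^sup>2) \<cdot>\<^sub>m (mat_adjoint Mp * X * Mp)"
    using X by (simp add: m1_def two.adjoint_smult two.distribs two.smult_distribs power2_eq_square)
  moreover have G: "mat_adjoint Mp * X * Mp \<in> carrier_mat 2 2" "gen_L h Mp Mo X \<in> carrier_mat 2 2"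
    using X by (auto intro!: two.closed)
  ultimately show ?thesis
    unfolding gen_T_def using X cos_nz
    by (intro eq_matI) (simp_all add: two.add_index two.smult_index minus2_index carrier_matD[OF G(1)]
        carrier_matD[OF G(2)] field_simps del: index_mult_mat index_add_mat(1) index_smult_mat(1) index_minus_mat(1))
qed

text \<open>The same at outcome 0. With \<open>W = X + h^2 gen_L\<close>, both sides are
  \<open>W\<close> minus the \<open>Mp\<close> sandwich times \<open>h^2\<close>, divided by
  \<open>cos^2 h\<close>: \<open>gen_T\<close> removes the \<open>Mp\<close> term that
  \<open>gen_L\<close> contains.\<close>

lemma m0_sandwich:
  assumes X: "X \<in> carrier_mat 2 2"
  shows "mat_adjoint m0 * X * m0 = X + (complex_of_real (h\<^sup>2) \<cdot>\<^sub>m gen_L h Mp Mo X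
    + (- complex_of_real ((sin h)\<^sup>2)) \<cdot>\<^sub>m gen_T h Mp Mo X)"
proof -
  define G1 G2 G3 G4 where "G1 = mat_adjoint Mp * X * Mp" and "G2 = mat_adjoint Mo * X * Mo"
    and "G3 = mat_adjoint Mo * X" and "G4 = X * Mo"
  have G: "G1 \<in> carrier_mat 2 2" "G2 \<in> carrier_mat 2 2" "G3 \<in> carrier_mat 2 2" "G4 \<in> carrier_mat 2 2"
    using X by (auto simp: G1_def G2_def G3_def G4_def intro!: two.closed)
  have m0: "mat_adjoint m0 * X * m0 = complex_of_real (1 / (cos h)\<^sup>2) \<cdot>\<^sub>m
    (X + (complex_of_real (h\<^sup>2) \<cdot>\<^sub>m G3 + (complex_of_real (h\<^sup>2) \<cdot>\<^sub>m G4
      + complex_of_real (h\<^sup>2 * h\<^sup>2) \<cdot>\<^sub>m G2)))"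
    using X unfolding G2_def G3_def G4_def
    by (simp add: m0_def two.adjoint_simps two.mat_ring power2_eq_square)
  have alg: "1 / c\<^sup>2 * (x + (y * g3 + (y * g4 + y * y * g2))) =
      x + (y * (g1 + y * g2 + g3 + g4) + - s\<^sup>2 * (1 / c\<^sup>2 * (y / s\<^sup>2 * g1 - x - y * (g1 + y * g2 + g3 + g4))))"
    if "c \<noteq> 0" "s \<noteq> 0" "s\<^sup>2 = 1 - c\<^sup>2" for c s x y g1 g2 g3 g4 :: complex
  proof -
    define w where "w = x + y * (g1 + y * g2 + g3 + g4)"
    have "- s\<^sup>2 * (1 / c\<^sup>2 * (y / s\<^sup>2 * g1 - x - y * (g1 + y * g2 + g3 + g4))) = s\<^sup>2 / c\<^sup>2 * w - 1 / c\<^sup>2 * (y * g1)"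
      using that(1,2) by (simp add: w_def field_simps)
    moreover have "s\<^sup>2 / c\<^sup>2 = 1 / c\<^sup>2 - 1" using that by (simp add: field_simps)
    ultimately show ?thesis by (simp add: w_def algebra_simps)
  qed
  have nz: "complex_of_real (cos h) \<noteq> 0" "complex_of_real (sin h) \<noteq> 0"
    using sin_nz cos_nz by (simp_all only: of_real_eq_0_iff not_False_eq_True)
  have sc: "(complex_of_real (sin h))\<^sup>2 = 1 - (complex_of_real (cos h))\<^sup>2"
    by (metis of_real_1 of_real_diff of_real_power sin_squared_eq)
  show ?thesis
    unfolding m0 gen_T_def gen_L_def G1_def[symmetric] G2_def[symmetric]
    unfolding G3_def[symmetric] G4_def[symmetric]
  proof (intro eq_matI)
    let ?y = "complex_of_real (h\<^sup>2)"
    let ?rhs = "X + (?y \<cdot>\<^sub>m (G1 + ?y \<cdot>\<^sub>m G2 + G3 + G4) + (- complex_of_real ((sin h)\<^sup>2)) \<cdot>\<^sub>m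
      (complex_of_real (1 / (cos h)\<^sup>2) \<cdot>\<^sub>m (complex_of_real (h\<^sup>2 / (sin h)\<^sup>2) \<cdot>\<^sub>m G1 - X
        - ?y \<cdot>\<^sub>m (G1 + ?y \<cdot>\<^sub>m G2 + G3 + G4))))"
    fix i j assume "i < dim_row ?rhs" "j < dim_col ?rhs"
    then have ij: "i < 2" "j < 2" using G by auto
    show "(complex_of_real (1 / (cos h)\<^sup>2) \<cdot>\<^sub>m (X + (?y \<cdot>\<^sub>m G3 + (?y \<cdot>\<^sub>m G4
      + complex_of_real (h\<^sup>2 * h\<^sup>2) \<cdot>\<^sub>m G2)))) $$ (i, j) = ?rhs $$ (i, j)"
      using X G ij alg[OF nz sc, of "X $$ (i, j)" ?y "G3 $$ (i, j)" "G4 $$ (i, j)" "G2 $$ (i, j)" "G1 $$ (i, j)"]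
      by (simp add: two.add_index two.smult_index minus2_index add.assoc
          del: index_add_mat(1) index_smult_mat(1) index_minus_mat(1))
  qed (use X G in auto)
qed

text \<open>The element at time \<open>Suc l\<close> is the value at 1 times \<open>dY\<close> plus
  the value at 0 times its complement. Inserting the two sandwich values and
  \<open>cos^2 h = 1 - sin^2 h\<close> makes this affine in \<open>dY\<close>.\<close>

lemma filtering_equation:
  assumes l: "Suc l \<le> k" and X: "X \<in> carrier_mat 2 2"
  shows "EY (Suc l) (ev (Suc l) X) - EY l (ev l X) =
    EY l (ev l (gen_L h Mp Mo X)) * dt k h
    + EY l (ev l (gen_T h Mp Mo X)) * (dY k h L1 L2 L3 (Suc l) - complex_of_real ((sin h)\<^sup>2 / h\<^sup>2) \<cdot>\<^sub>m dt k h)"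
proof -
  let ?y = "dY k h L1 L2 L3 (Suc l)" and ?h = "complex_of_real (h\<^sup>2)"
  let ?c = "complex_of_real ((cos h)\<^sup>2)" and ?s = "complex_of_real ((sin h)\<^sup>2)"
  have lk: "l \<le> k" using l by simp
  define x g t where "x = EY l (ev l X)" and "g = EY l (ev l (gen_L h Mp Mo X))"
    and "t = EY l (ev l (gen_T h Mp Mo X))"
  have mm: "x \<in> MM" "g \<in> MM" "t \<in> MM" "?y \<in> MM"
    using lk Y.z_Suc[OF l] by (auto simp: x_def g_def t_def)
  have "ev l (mat_adjoint m1 * X * m1) = (\<lambda>m. ev l X m + (?h * ev l (gen_L h Mp Mo X) m + ?c * ev l (gen_T h Mp Mo X) m))"
    "ev l (mat_adjoint m0 * X * m0) = (\<lambda>m. ev l X m + (?h * ev l (gen_L h Mp Mo X) m + (- ?s) * ev l (gen_T h Mp Mo X) m))"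
    unfolding m1_sandwich[OF X] m0_sandwich[OF X] using X by (simp_all add: ev_add ev_smult fun_eq_iff)
  moreover have "EY (Suc l) (ev (Suc l) X) =
    EY l (ev l (mat_adjoint m1 * X * m1)) * ?y + EY l (ev l (mat_adjoint m0 * X * m0)) * (1\<^sub>m (tdim k) - ?y)"
    by simp
  ultimately have "EY (Suc l) (ev (Suc l) X) =
    (x + (?h \<cdot>\<^sub>m g + ?c \<cdot>\<^sub>m t)) * ?y + (x + (?h \<cdot>\<^sub>m g + (- ?s) \<cdot>\<^sub>m t)) * (1\<^sub>m (tdim k) - ?y)"
    by (simp only: Y.E_add[OF lk] Y.E_smult[OF lk] x_def g_def t_def)
  moreover have "complex_of_real ((sin h)\<^sup>2 / h\<^sup>2) \<cdot>\<^sub>m dt k h = ?s \<cdot>\<^sub>m 1\<^sub>m (tdim k)"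
    using h_nz by (simp add: dt_def smult_distribs)
  moreover have "?c = 1 - ?s"
    by (simp add: cos_squared_eq flip: of_real_power)
  ultimately show ?thesis
    unfolding x_def[symmetric] g_def[symmetric] t_def[symmetric] using mm
    by (simp only: dt_def) (simp add: distribs, intro eq_matI;
        simp add: algebra_simps del: index_mult_mat(1))
qed

end

theorem theorem6p7:
  fixes k :: nat and T h :: real and \<rho> :: "complex mat \<Rightarrow> complex"
    and L1 L2 L3 Mpm Mp Mm Mo :: "complex mat"
  assumes "k \<ge> 1" and "T > 0" and "h = sqrt (T / real k)"
    and "sin h \<noteq> 0" and "cos h \<noteq> 0"
    and "is_state 2 \<rho>"
    and "L1 \<in> carrier_mat 2 2" and "L2 \<in> carrier_mat 2 2" and "L3 \<in> carrier_mat 2 2"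
    and "mat_adjoint L1 = L1" and "mat_adjoint L3 = L3"
    and "Mpm \<in> carrier_mat 2 2" and "Mp \<in> carrier_mat 2 2"
    and "Mm \<in> carrier_mat 2 2" and "Mo \<in> carrier_mat 2 2"
    and "\<And>l. l \<in> {1..k} \<Longrightarrow>
           M_step k h L1 L2 L3 l - 1\<^sub>m (tdim k) =
             sys k Mpm * dLam k l + sys k Mp * dAs k h l + sys k Mm * dA k h l + sys k Mo * dt k h"
  shows
    "(\<forall>l \<le> k. \<forall>X \<in> carrier_mat 2 2. \<exists>S. is_unnormalized k h \<rho> L1 L2 L3 Mp Mo l X S) \<and>
     (\<forall>\<sigma>. (\<forall>l \<le> k. \<forall>X \<in> carrier_mat 2 2. is_unnormalized k h \<rho> L1 L2 L3 Mp Mo l X (\<sigma> l X)) \<longrightarrow>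
        (\<forall>X \<in> carrier_mat 2 2. \<sigma> 0 X = \<rho> X \<cdot>\<^sub>m 1\<^sub>m (tdim k)) \<and>
        (\<forall>X \<in> carrier_mat 2 2. \<forall>l \<in> {1..k}.
           \<sigma> l X - \<sigma> (l - 1) X =
             \<sigma> (l - 1) (gen_L h Mp Mo X) * dt k h
             + \<sigma> (l - 1) (gen_T h Mp Mo X)
                 * (dY k h L1 L2 L3 l - complex_of_real ((sin h)\<^sup>2 / h\<^sup>2) \<cdot>\<^sub>m dt k h)) \<and>
        (\<forall>X \<in> carrier_mat 2 2. \<forall>l \<le> k.
           (\<exists>\<pi>. is_cond_exp (tdim k) (joint_state k \<rho>) (Y_alg k h L1 L2 L3 l)
                  (flow k (U k h L1 L2 L3 l) X) \<pi>) \<and>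
           (\<exists>Q. is_quotient (Y_alg k h L1 L2 L3 l) (\<sigma> l X) (\<sigma> l (1\<^sub>m 2)) Q) \<and>
           (\<forall>\<pi> Q. is_cond_exp (tdim k) (joint_state k \<rho>) (Y_alg k h L1 L2 L3 l)
                     (flow k (U k h L1 L2 L3 l) X) \<pi> \<longrightarrow>
                   is_quotient (Y_alg k h L1 L2 L3 l) (\<sigma> l X) (\<sigma> l (1\<^sub>m 2)) Q \<longrightarrow>
                   equal_wp1 (joint_state k \<rho>) \<pi> Q)))"
proof -
  interpret repeated_interaction k \<rho> h L1 L2 L3 Mpm Mp Mm Mo
    using assms by unfold_locales auto
  show ?thesis (is "?exists \<and> (\<forall>\<sigma>. ?unnorm \<sigma> \<longrightarrow> ?concl \<sigma>)")
  proof (rule conjI)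
    show ?exists
      by (simp add: is_unnormalized_iff)
    have "?concl \<sigma>" if unnorm: "?unnorm \<sigma>" for \<sigma>
    proof (intro conjI)
      \<comment> \<open>The admissible family is unique on the relevant arguments, so the quantifier
        over \<open>\<sigma>\<close> reduces to \<open>ev\<close>.\<close>
      have \<sigma>: "\<sigma> l X = EY l (ev l X)" if "l \<le> k" "X \<in> carrier_mat 2 2" for l X
        using unnorm that is_unnormalized_iff by blast
      show "\<forall>X \<in> carrier_mat 2 2. \<sigma> 0 X = \<rho> X \<cdot>\<^sub>m 1\<^sub>m (tdim k)"
        by (simp add: \<sigma>)
      show "\<forall>X \<in> carrier_mat 2 2. \<forall>l \<in> {1..k}. \<sigma> l X - \<sigma> (l - 1) X =
          \<sigma> (l - 1) (gen_L h Mp Mo X) * dt k h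
          + \<sigma> (l - 1) (gen_T h Mp Mo X)
              * (dY k h L1 L2 L3 l - complex_of_real ((sin h)\<^sup>2 / h\<^sup>2) \<cdot>\<^sub>m dt k h)"
      proof (intro ballI)
        fix X :: "complex mat" and l assume X: "X \<in> carrier_mat 2 2" and "l \<in> {1..k}"
        then obtain j where j: "l = Suc j" "Suc j \<le> k" by (cases l) auto
        then have "j \<le> k" by simp
        then show "\<sigma> l X - \<sigma> (l - 1) X = \<sigma> (l - 1) (gen_L h Mp Mo X) * dt k h
            + \<sigma> (l - 1) (gen_T h Mp Mo X)
                * (dY k h L1 L2 L3 l - complex_of_real ((sin h)\<^sup>2 / h\<^sup>2) \<cdot>\<^sub>m dt k h)"
          using filtering_equation[OF j(2) X] j X by (simp only: \<sigma> gen_closed diff_Suc_1)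
      qed
      show "\<forall>X \<in> carrier_mat 2 2. \<forall>l \<le> k.
          (\<exists>\<pi>. is_cond_exp (tdim k) P (Y_alg k h L1 L2 L3 l) (flow k (UU l) X) \<pi>) \<and>
          (\<exists>Q. is_quotient (Y_alg k h L1 L2 L3 l) (\<sigma> l X) (\<sigma> l (1\<^sub>m 2)) Q) \<and>
          (\<forall>\<pi> Q. is_cond_exp (tdim k) P (Y_alg k h L1 L2 L3 l) (flow k (UU l) X) \<pi> \<longrightarrow>
            is_quotient (Y_alg k h L1 L2 L3 l) (\<sigma> l X) (\<sigma> l (1\<^sub>m 2)) Q \<longrightarrow> equal_wp1 P \<pi> Q)"
        using cond_exp_flow_exists quotient_exists kallianpur_striebel by (simp add: \<sigma>)
    qed
    then show "\<forall>\<sigma>. ?unnorm \<sigma> \<longrightarrow> ?concl \<sigma>" by blast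
  qed
qed

end
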